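(* Let $A\in\mathrm{Sect}(\pi/2-)$ on a Banach space $X$, $f\in\mathcal{D}_\infty$ and $\lambda\in\mathbb{C}$. 1. If $x\in D(A)$ and $Ax=\lambda x$, then $f_{\mathcal{D}}(A)x=f(\lambda)x$. 2. If $x^*\in D(A^* )$ and $A^*x^*=\lambda x^*$, then $f_{\mathcal{D}}(A)^*x^*=f(\lambda)x^*$. 3. If $(x_n)_{n\ge1}$ are unit vectors in $D(A)$ with $\lim_{n\to\infty}\|Ax_n-\lambda x_n\|=0$, then $\lim_{n\to\infty}\|f_{\mathcal{D}}(A)x_n-f(\lambda)x_n\|=0$. 4. $\sigma(f_{\mathcal{D}}(A))\cup\{f(\infty)\}=f(\sigma(A))\cup\{f(\infty)\}$.
   Context: $\Sigma_\theta=\{z\ne0:|\arg z|<\theta\}$. $\mathrm{Sect}(\pi/2-)$: densely defined closed $A$ with $\sigma(A)\subset\overline{\Sigma_\theta}$ for some $\theta<\pi/2$ and $\sup_{z\in\Sigma_{\pi-\varphi}}\|z(z+A)^{-1}\|<\infty$ for all $\varphi\in(\theta,\pi]$. For $s>-1$, $\mathcal{D}_s$: holomorphic $f$ on $\mathbb{C}_+$ with $\int_0^\infty\alpha^s\int_{-\infty}^\infty\frac{|f'(\alpha+i\beta)|}{(\alpha^2+\beta^2)^{(s+1)/2}}d\beta\,d\alpha<\infty$; $\mathcal{D}_\infty=\bigcup_{s>-1}\mathcal{D}_s$. Such $f$ have sectorial limits $f(\infty)$ and $f(0)$ (limits within every $\Sigma_\psi$, $\psi<\pi/2$), which define $f$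 at $\infty$ and $0$. For $f\in\mathcal{D}_s$, $f_{\mathcal{D}}(A):=f(\infty)-\frac{2^s}{\pi}\int_0^\infty\alpha^s\int_{-\infty}^\infty f'(\alpha+i\beta)(A+\alpha-i\beta)^{-(s+1)}d\beta\,d\alpha$ (independent of $s$). *)

theory Defs
  imports "HOL-Analysis.Analysis"
begin

class complex_banach = banach +
  fixes scaleC :: "complex \<Rightarrow> 'a \<Rightarrow> 'a" (infixr \<open>*\<^sub>C\<close> 75)
  assumes scaleC_add_right: "a *\<^sub>C (x + y) = a *\<^sub>C x + a *\<^sub>C y"
    and scaleC_add_left: "(a + b) *\<^sub>C x = a *\<^sub>C x + b *\<^sub>C x"
    and scaleC_scaleC: "a *\<^sub>C (b *\<^sub>C x) = (a * b) *\<^sub>C x"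
    and scaleC_one: "1 *\<^sub>C x = x"
    and scaleR_scaleC: "scaleR r x = complex_of_real r *\<^sub>C x"
    and norm_scaleC: "norm (a *\<^sub>C x) = cmod a * norm x"

definition csubspace :: "'a::complex_banach set \<Rightarrow> bool" where
  "csubspace D \<longleftrightarrow> 0 \<in> D \<and> (\<forall>x\<in>D. \<forall>y\<in>D. x + y \<in> D) \<and> (\<forall>c. \<forall>x\<in>D. c *\<^sub>C x \<in> D)"

definition clinear_on :: "'a::complex_banach set \<Rightarrow> ('a \<Rightarrow> 'b::complex_banach) \<Rightarrow> bool" where
  "clinear_on D A \<longleftrightarrow> (\<forall>x\<in>D. \<forall>y\<in>D. A (x + y) = A x + A y) \<and> (\<forall>c. \<forall>x\<in>D. A (c *\<^sub>C x) = c *\<^sub>C A x)"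

definition cfunctional :: "('a::complex_banach \<Rightarrow> complex) \<Rightarrow> bool" where
  "cfunctional \<phi> \<longleftrightarrow> (\<forall>x y. \<phi> (x + y) = \<phi> x + \<phi> y) \<and> (\<forall>c x. \<phi> (c *\<^sub>C x) = c * \<phi> x)
     \<and> (\<exists>K. \<forall>x. cmod (\<phi> x) \<le> K * norm x)"

text \<open>An (unbounded) operator is a pair of a domain \<open>D\<close> and a map \<open>A\<close> (relevant on \<open>D\<close>).
  \<open>closed_op\<close>: closed graph.\<close>
definition closed_op :: "'a::complex_banach set \<Rightarrow> ('a \<Rightarrow> 'a) \<Rightarrow> bool" where
  "closed_op D A \<longleftrightarrow> closed {(x, A x) | x. x \<in> D}"

definition res :: "'a::complex_banach set \<Rightarrow> ('a \<Rightarrow> 'a) \<Rightarrow> complex \<Rightarrow> 'a \<Rightarrow> 'a" where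
  "res D A w y = (THE u. u \<in> D \<and> w *\<^sub>C u + A u = y)"

definition inv_ok :: "'a::complex_banach set \<Rightarrow> ('a \<Rightarrow> 'a) \<Rightarrow> complex \<Rightarrow> bool" where
  "inv_ok D A w \<longleftrightarrow> (\<forall>y. \<exists>!u. u \<in> D \<and> w *\<^sub>C u + A u = y) \<and> (\<exists>K. \<forall>y. norm (res D A w y) \<le> K * norm y)"

definition spec :: "'a::complex_banach set \<Rightarrow> ('a \<Rightarrow> 'a) \<Rightarrow> complex set" where
  "spec D A = {\<mu>. \<not> inv_ok D A (- \<mu>)}"

definition adj_dom :: "'a::complex_banach set \<Rightarrow> ('a \<Rightarrow> 'a) \<Rightarrow> ('a \<Rightarrow> complex) \<Rightarrow> bool" where
  "adj_dom D A \<phi> \<longleftrightarrow> cfunctional \<phi> \<and> (\<exists>\<psi>. cfunctional \<psi> \<and> (\<forall>x\<in>D. \<phi> (A x) = \<psi> x))"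

definition adj :: "'a::complex_banach set \<Rightarrow> ('a \<Rightarrow> 'a) \<Rightarrow> ('a \<Rightarrow> complex) \<Rightarrow> ('a \<Rightarrow> complex)" where
  "adj D A \<phi> = (SOME \<psi>. cfunctional \<psi> \<and> (\<forall>x\<in>D. \<phi> (A x) = \<psi> x))"

definition sector :: "real \<Rightarrow> complex set" where
  "sector \<theta> = {z. z \<noteq> 0 \<and> \<bar>Arg z\<bar> < \<theta>}"

definition sect_op :: "'a::complex_banach set \<Rightarrow> ('a \<Rightarrow> 'a) \<Rightarrow> bool" where
  "sect_op D A \<longleftrightarrow> csubspace D \<and> clinear_on D A \<and> closed_op D A \<and> closure D = UNIV \<and>
     (\<exists>\<theta>. 0 \<le> \<theta> \<and> \<theta> < pi/2 \<and> spec D A \<subseteq> closure (sector \<theta>) \<and>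
        (\<forall>\<phi>\<in>{\<theta><..pi}. \<exists>M. \<forall>z\<in>sector (pi - \<phi>).
            inv_ok D A z \<and> (\<forall>y. norm (z *\<^sub>C res D A z y) \<le> M * norm y)))"

definition Dclass :: "real \<Rightarrow> (complex \<Rightarrow> complex) set" where
  "Dclass s = {f. f holomorphic_on {z. 0 < Re z} \<and>
     (\<integral>\<^sup>+ \<alpha>. (\<integral>\<^sup>+ \<beta>. ennreal (\<alpha> powr s * cmod (deriv f (Complex \<alpha> \<beta>))
           / (\<alpha>\<^sup>2 + \<beta>\<^sup>2) powr ((s + 1) / 2)) \<partial>lborel) * indicator {0<..} \<alpha> \<partial>lborel) < \<infinity>}"

definition Dinf :: "(complex \<Rightarrow> complex) set" where
  "Dinf = (\<Union>s\<in>{-1<..}. Dclass s)"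

definition f_infty :: "(complex \<Rightarrow> complex) \<Rightarrow> complex" where
  "f_infty f = (THE L. \<forall>\<psi>. 0 < \<psi> \<and> \<psi> < pi/2 \<longrightarrow> (f \<longlongrightarrow> L) (inf at_infinity (principal (sector \<psi>))))"

definition f_zero :: "(complex \<Rightarrow> complex) \<Rightarrow> complex" where
  "f_zero f = (THE L. \<forall>\<psi>. 0 < \<psi> \<and> \<psi> < pi/2 \<longrightarrow> (f \<longlongrightarrow> L) (at 0 within sector \<psi>))"

definition fval :: "(complex \<Rightarrow> complex) \<Rightarrow> complex \<Rightarrow> complex" where
  "fval f z = (if z = 0 then f_zero f else f z)"

text \<open>The \<open>\<D>\<close>-calculus, applied to a vector \<open>x\<close>.  Since \<open>f\<^sub>\<D>(A)\<close> does not depend on \<open>s\<close> and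
  \<open>\<D>\<^sub>s \<subseteq> \<D>\<^sub>t\<close> for \<open>s \<le> t\<close>, we use the least natural number \<open>n\<close> with \<open>f \<in> \<D>\<^sub>n\<close>, so that
  \<open>(A + \<alpha> - i\<beta>)\<^sup>-\<^sup>(\<^sup>n\<^sup>+\<^sup>1\<^sup>)\<close> is the \<open>(n+1)\<close>-fold iterate of the resolvent.\<close>
definition fD :: "(complex \<Rightarrow> complex) \<Rightarrow> 'a::complex_banach set \<Rightarrow> ('a \<Rightarrow> 'a) \<Rightarrow> 'a \<Rightarrow> 'a" where
  "fD f D A x = (let n = (LEAST n::nat. f \<in> Dclass (real n)) in
     f_infty f *\<^sub>C x - complex_of_real (2 ^ n / pi) *\<^sub>C
       integral {0<..} (\<lambda>\<alpha>. integral UNIV (\<lambda>\<beta>.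
          (complex_of_real (\<alpha> ^ n) * deriv f (Complex \<alpha> \<beta>)) *\<^sub>C
            ((res D A (Complex \<alpha> (- \<beta>))) ^^ (n + 1)) x)))"

end

theory Submission
  imports Defs "HOL-Complex_Analysis.Complex_Analysis"
begin

text \<open>
  Everything takes place in the Banach algebra of bounded complex-linear operators. With
  \<open>R = (A + 1)\<^sup>-\<^sup>1\<close>, the reproducing formula
  \<open>f(\<mu>) = f(\<infinity>) - (2\<^sup>n/\<pi>) \<integral>\<integral> \<alpha>\<^sup>n f'(\<alpha> + i\<beta>) (\<mu> + \<alpha> - i\<beta>)\<^sup>-\<^sup>(\<^sup>n\<^sup>+\<^sup>1\<^sup>)\<close> represents \<open>f(A) - f(\<mu>)\<close> by an
  integral whose kernel is divisible by \<open>R - 1/(1 + \<mu>)\<close>, so \<open>f(A) - f(\<mu>)\<close> is a norm limit of operators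
  \<open>(R - 1/(1 + \<mu>)) C\<close> with \<open>C\<close> in the bicommutant of \<open>R\<close>; likewise \<open>f(A) - f(\<infinity>)\<close> is a limit of
  operators \<open>R C\<close>. The statements on eigenvectors and the inclusion of \<open>f(\<sigma>(A))\<close> follow at once. For the
  converse inclusion, if \<open>a\<close> is not among the values of \<open>f\<close>, then \<open>f(A) - a\<close> and \<open>R - \<rho>\<close> generate the
  whole commutant of both for every \<open>\<rho>\<close>; since spectra in quotient algebras are not empty, \<open>f(A) - a\<close> is
  invertible.

  The reproducing formula itself follows by evaluating the inner integral with residues on large
  rectangles and integrating by parts in \<open>\<alpha>\<close>.
\<close>

section \<open>The Banach algebra of bounded complex-linear operators\<close>

text \<open>Under \<mu> -> 1/(1 + \<mu>) the spectrum of the unbounded A becomes a matter of the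
  bounded operator R; the additional point 0 is the image of infinity, and it is the source of the
  exceptional value f(\<infinity>) in the fourth statement.

  Three obstacles shape the proof. \<open>fD\<close> is an iterated gauge integral in an arbitrary
  Banach space, and the condition on f controls the inner integral for almost every \<alpha> only;
  existence, linearity and dominated convergence are therefore derived from continuity of the kernel
  and one real integrable majorant on the plane. Next, f' is bounded in a weighted mean, not
  pointwise; the sides of contours are moved within a window until they carry at most the average
  mass. Finally, at the two ends \<mu> = 0 and \<mu> = infinity the quotient of the kernel by its
  factor is one power of z too large for the majorant, which is why norm limits of products (R -
  1/(1 + \<mu>)) C appear and not exact factorizations.\<close>

lemma scaleC_zero_left [simp]: "0 *\<^sub>C x = (0::'a::complex_banach)"
  using scaleC_add_left[of 0 0 x] by simp

lemma scaleC_zero_right [simp]: "c *\<^sub>C 0 = (0::'a::complex_banach)"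
  using scaleC_add_right[of c 0 0] by simp

lemma scaleC_minus_left: "(- c) *\<^sub>C x = - (c *\<^sub>C (x::'a::complex_banach))"
  using scaleC_add_left[of c "- c" x] by (simp add: eq_neg_iff_add_eq_0 add.commute)

lemma scaleC_minus_right: "c *\<^sub>C (- x) = - (c *\<^sub>C (x::'a::complex_banach))"
  using scaleC_add_right[of c x "- x"] by (simp add: eq_neg_iff_add_eq_0 add.commute)

lemma scaleC_diff_left: "(a - b) *\<^sub>C x = a *\<^sub>C x - b *\<^sub>C (x::'a::complex_banach)"
  using scaleC_add_left[of a "- b" x] by (simp add: scaleC_minus_left)

lemma scaleC_diff_right: "c *\<^sub>C (x - y) = c *\<^sub>C x - c *\<^sub>C (y::'a::complex_banach)"
  using scaleC_add_right[of c x "- y"] by (simp add: scaleC_minus_right)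

lemma bounded_bilinear_scaleC: "bounded_bilinear ((*\<^sub>C) :: complex \<Rightarrow> 'a \<Rightarrow> 'a::complex_banach)"
  by (rule bounded_bilinear.intro)
     (auto simp: scaleC_add_left scaleC_add_right scaleR_scaleC scaleC_scaleC norm_scaleC scaleR_conv_of_real
        mult.commute intro!: exI[of _ 1])

lemmas bounded_linear_scaleC_right = bounded_bilinear.bounded_linear_right[OF bounded_bilinear_scaleC]
lemmas continuous_on_scaleC [continuous_intros] = bounded_bilinear.continuous_on[OF bounded_bilinear_scaleC]
lemmas tendsto_scaleC [tendsto_intros] = bounded_bilinear.tendsto[OF bounded_bilinear_scaleC]

text \<open>With the scalars as an instance, one construction of the integral serves both f(\<mu>)
  and f(A), and the map from c to c times the unit operator can be pulled through it.\<close>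

instantiation complex :: complex_banach
begin
definition scaleC_complex :: "complex \<Rightarrow> complex \<Rightarrow> complex" where "scaleC_complex = (*)"
instance
  by standard (auto simp: scaleC_complex_def algebra_simps norm_mult scaleR_conv_of_real)
end

text \<open>The unit comes from \<open>monoid_mult\<close>, without norm 1 = 1 or 0 \<noteq> 1: the
  zero space is allowed, and its operator algebra is trivial.\<close>

class complex_banach_algebra = complex_banach + real_normed_algebra + monoid_mult +
  assumes scaleC_mult_left: "(c *\<^sub>C x) * y = c *\<^sub>C (x * y)"
    and scaleC_mult_right: "x * (c *\<^sub>C y) = c *\<^sub>C (x * y)"

lemmas scaleC_mult = scaleC_mult_left scaleC_mult_right
lemmas scaleC_diff = scaleC_diff_right scaleC_diff_left
lemmas scaleC_ring_distribs = distrib_left distrib_right left_diff_distrib right_diff_distrib scaleC_mult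

text \<open>Bounded real-linear maps already form a Banach space; complex homogeneity is a closed
  condition there, so norm and completeness are inherited.\<close>

typedef (overloaded) 'a cop = "{T :: 'a::complex_banach \<Rightarrow>\<^sub>L 'a. \<forall>c x. T (c *\<^sub>C x) = c *\<^sub>C T x}"
  by (rule exI[of _ 0]) simp

setup_lifting type_definition_cop

lift_definition cop_app :: "'a::complex_banach cop \<Rightarrow> 'a \<Rightarrow> 'a" is blinfun_apply .

lemma cop_eqI: "(\<And>x. cop_app S x = cop_app T x) \<Longrightarrow> S = T"
  by transfer (rule blinfun_eqI)

instantiation cop :: (complex_banach) real_normed_vector
begin

lift_definition zero_cop :: "'a cop" is 0 by simp
lift_definition plus_cop :: "'a cop \<Rightarrow> 'a cop \<Rightarrow> 'a cop" is "(+)"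
  by (auto simp: blinfun.add_left scaleC_add_right)
lift_definition minus_cop :: "'a cop \<Rightarrow> 'a cop \<Rightarrow> 'a cop" is "(-)"
  by (auto simp: blinfun.diff_left scaleC_diff_right)
lift_definition uminus_cop :: "'a cop \<Rightarrow> 'a cop" is uminus
  by (auto simp: blinfun.minus_left scaleC_minus_right)
lift_definition scaleR_cop :: "real \<Rightarrow> 'a cop \<Rightarrow> 'a cop" is scaleR
  by (auto simp: blinfun.scaleR_left scaleR_scaleC scaleC_scaleC mult.commute)
lift_definition norm_cop :: "'a cop \<Rightarrow> real" is norm .
definition dist_cop :: "'a cop \<Rightarrow> 'a cop \<Rightarrow> real" where "dist_cop S T = norm (S - T)"
definition sgn_cop :: "'a cop \<Rightarrow> 'a cop" where "sgn_cop S = inverse (norm S) *\<^sub>R S"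
definition uniformity_cop :: "('a cop \<times> 'a cop) filter" where
  "uniformity_cop = (INF e\<in>{0<..}. principal {(S, T). dist S T < e})"
definition open_cop :: "'a cop set \<Rightarrow> bool" where
  "open_cop U = (\<forall>S\<in>U. \<forall>\<^sub>F (S', T) in uniformity. S' = S \<longrightarrow> T \<in> U)"

instance
proof
  fix a b c :: "'a cop" and r s :: real
  show "a + b + c = a + (b + c)" "a + b = b + a" "0 + a = a" "- a + a = 0" "a - b = a + - b"
    by (transfer; simp)+
  show "r *\<^sub>R (a + b) = r *\<^sub>R a + r *\<^sub>R b" "(r + s) *\<^sub>R a = r *\<^sub>R a + s *\<^sub>R a"
    "r *\<^sub>R s *\<^sub>R a = (r * s) *\<^sub>R a" "1 *\<^sub>R a = a"
    by (transfer; simp add: algebra_simps)+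
  show "dist a b = norm (a - b)" by (rule dist_cop_def)
  show "sgn a = inverse (norm a) *\<^sub>R a" by (rule sgn_cop_def)
  show "uniformity = (INF e\<in>{0<..}. principal {(S::'a cop, T). dist S T < e})" by (rule uniformity_cop_def)
  show "open U = (\<forall>S\<in>U. \<forall>\<^sub>F (S', T) in uniformity. S' = S \<longrightarrow> T \<in> U)" for U :: "'a cop set" by (rule open_cop_def)
  show "(norm a = 0) = (a = 0)" "norm (a + b) \<le> norm a + norm b" "norm (r *\<^sub>R a) = \<bar>r\<bar> * norm a"
    by (transfer; simp add: norm_triangle_ineq)+
qed

end

instance cop :: (complex_banach) banach
proof
  fix X :: "nat \<Rightarrow> 'a cop" assume "Cauchy X"
  have d: "dist (Rep_cop S) (Rep_cop T) = dist S T" for S T :: "'a cop"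
    by (simp add: dist_cop_def dist_norm norm_cop.rep_eq minus_cop.rep_eq)
  have "Cauchy (\<lambda>n. Rep_cop (X n))" using \<open>Cauchy X\<close> by (simp add: Cauchy_def d)
  then obtain L where L: "(\<lambda>n. Rep_cop (X n)) \<longlonglongrightarrow> L"
    using Cauchy_convergent convergent_def by blast
  have "L (c *\<^sub>C x) = c *\<^sub>C L x" for c x
  proof (rule LIMSEQ_unique)
    show "(\<lambda>n. Rep_cop (X n) (c *\<^sub>C x)) \<longlonglongrightarrow> L (c *\<^sub>C x)"
      by (intro tendsto_intros L)
    have "(\<lambda>n. c *\<^sub>C Rep_cop (X n) x) \<longlonglongrightarrow> c *\<^sub>C L x"
      by (intro tendsto_intros L)
    moreover have "Rep_cop (X n) (c *\<^sub>C x) = c *\<^sub>C Rep_cop (X n) x" for n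
      using Rep_cop[of "X n"] by blast
    ultimately show "(\<lambda>n. Rep_cop (X n) (c *\<^sub>C x)) \<longlonglongrightarrow> c *\<^sub>C L x" by simp
  qed
  then have "Rep_cop (Abs_cop L) = L" by (subst Abs_cop_inverse) auto
  then have "dist (X n) (Abs_cop L) = dist (Rep_cop (X n)) L" for n using d[of "X n" "Abs_cop L"] by simp
  moreover have "(\<lambda>n. dist (Rep_cop (X n)) L) \<longlonglongrightarrow> 0" using L by (rule tendsto_dist_iff[THEN iffD1])
  ultimately have "(\<lambda>n. dist (X n) (Abs_cop L)) \<longlonglongrightarrow> 0" by simp
  then have "X \<longlonglongrightarrow> Abs_cop L" by (rule tendsto_dist_iff[THEN iffD2])
  then show "convergent X" by (rule convergentI)
qed

instantiation cop :: (complex_banach) complex_banach_algebra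
begin

lift_definition one_cop :: "'a cop" is id_blinfun by simp
lift_definition times_cop :: "'a cop \<Rightarrow> 'a cop \<Rightarrow> 'a cop" is "(o\<^sub>L)"
  by auto
lift_definition scaleC_cop :: "complex \<Rightarrow> 'a cop \<Rightarrow> 'a cop" is
  "\<lambda>c T. Blinfun (scaleC c) o\<^sub>L T"
  by (auto simp: bounded_linear_Blinfun_apply bounded_linear_scaleC_right scaleC_scaleC mult.commute)

text \<open>The upper bound, used for c and again for the inverse of c, forces equality.\<close>

lemma norm_cop_scaleC: "norm (c *\<^sub>C (T::'a cop)) = cmod c * norm T"
proof -
  have le: "norm (c *\<^sub>C (T::'a cop)) \<le> cmod c * norm T" for c T
  proof (transfer, rule norm_blinfun_bound)
    fix c and T :: "'a \<Rightarrow>\<^sub>L 'a" and x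
    show "norm ((Blinfun ((*\<^sub>C) c) o\<^sub>L T) x) \<le> cmod c * norm T * norm x"
      by (simp add: bounded_linear_Blinfun_apply bounded_linear_scaleC_right norm_scaleC norm_blinfun
           mult_left_mono mult.assoc)
  qed simp
  have inv: "inverse c *\<^sub>C (c *\<^sub>C T) = T" if "c \<noteq> 0"
    using that by transfer
      (auto intro!: blinfun_eqI simp: bounded_linear_Blinfun_apply bounded_linear_scaleC_right scaleC_scaleC scaleC_one)
  show ?thesis
  proof (cases "c = 0")
    case True
    have "0 \<le> norm (c *\<^sub>C T)" by transfer simp
    then show ?thesis using le[of c T] True by simp
  next
    case False
    have "norm T \<le> cmod (inverse c) * norm (c *\<^sub>C T)" using le[of "inverse c" "c *\<^sub>C T"] inv[OF False] by simp
    then have "cmod c * norm T \<le> norm (c *\<^sub>C T)"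
      using False mult_left_mono[of "norm T" _ "cmod c"] by (fastforce simp: norm_inverse mult.assoc[symmetric])
    then show ?thesis using le[of c T] by simp
  qed
qed

instance
proof
  fix a b c :: "'a cop" and r :: real and x y :: complex
  show "a * b * c = a * (b * c)" "1 * a = a" "a * 1 = a"
    by (transfer; auto intro!: blinfun_eqI)+
  show "(a + b) * c = a * c + b * c" "a * (b + c) = a * b + a * c"
    "r *\<^sub>R a * b = r *\<^sub>R (a * b)" "a * r *\<^sub>R b = r *\<^sub>R (a * b)"
    by (transfer; auto intro!: blinfun_eqI simp: blinfun.bilinear_simps)+
  show "norm (a * b) \<le> norm a * norm b" by transfer (rule norm_blinfun_compose)
  show "x *\<^sub>C (a + b) = x *\<^sub>C a + x *\<^sub>C b" "(x + y) *\<^sub>C a = x *\<^sub>C a + y *\<^sub>C a"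
    "x *\<^sub>C y *\<^sub>C a = (x * y) *\<^sub>C a" "1 *\<^sub>C a = a" "r *\<^sub>R a = complex_of_real r *\<^sub>C a"
    "(x *\<^sub>C a) * b = x *\<^sub>C (a * b)" "a * (x *\<^sub>C b) = x *\<^sub>C (a * b)"
    by (transfer; auto intro!: blinfun_eqI simp: bounded_linear_Blinfun_apply bounded_linear_scaleC_right
        blinfun.bilinear_simps scaleC_add_right scaleC_add_left scaleC_scaleC scaleC_one scaleR_scaleC)+
  show "norm (x *\<^sub>C a) = cmod x * norm a" by (rule norm_cop_scaleC)
qed

end

lemma bounded_linear_cop_app: "bounded_linear (\<lambda>T. cop_app T x)"
proof (rule bounded_linear_intro)
  show "norm (cop_app T x) \<le> norm T * norm x" for T by transfer (rule norm_blinfun)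
qed (transfer; simp add: blinfun.bilinear_simps)+

lemma cop_app_simps:
  "cop_app (S + T) x = cop_app S x + cop_app T x"
  "cop_app (S - T) x = cop_app S x - cop_app T x"
  "cop_app (- S) x = - cop_app S x"
  "cop_app 0 x = 0" "cop_app 1 x = x"
  "cop_app (S * T) x = cop_app S (cop_app T x)"
  "cop_app (c *\<^sub>C S) x = c *\<^sub>C cop_app S x"
  by (transfer; simp add: blinfun.bilinear_simps bounded_linear_Blinfun_apply bounded_linear_scaleC_right)+

lemma cop_app_arg_simps:
  "cop_app S (x + y) = cop_app S x + cop_app S y"
  "cop_app S (x - y) = cop_app S x - cop_app S y"
  "cop_app S 0 = 0"
  "cop_app S (c *\<^sub>C x) = c *\<^sub>C cop_app S x"
  by (transfer; simp add: blinfun.bilinear_simps)+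

lemma norm_cop_app: "norm (cop_app T x) \<le> norm T * norm x"
  by transfer (rule norm_blinfun)

lemma cop_app_power: "cop_app (T ^ n) x = (cop_app T ^^ n) x"
  by (induction n) (simp_all add: cop_app_simps)

lemma cop_exists:
  fixes h :: "'a::complex_banach \<Rightarrow> 'a"
  assumes "\<And>x y. h (x + y) = h x + h y" "\<And>c x. h (c *\<^sub>C x) = c *\<^sub>C h x" "\<And>x. norm (h x) \<le> K * norm x"
  obtains T where "\<And>x. cop_app T x = h x"
proof -
  have bl: "bounded_linear h"
    by (rule bounded_linear_intro[of _ K]) (use assms in \<open>auto simp: scaleR_scaleC mult.commute\<close>)
  have "\<exists>T. \<forall>x. cop_app T x = h x"
    by (transfer fixing: h K, intro bexI[of _ "Blinfun h"])
       (use bl assms in \<open>auto simp: bounded_linear_Blinfun_apply\<close>)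
  then show ?thesis using that by blast
qed

section \<open>Local invertibility modulo a commuting element\<close>

lemma commutes_inverse:
  fixes X Y S :: "'b::complex_banach_algebra"
  assumes "X * Y = 1" "Y * X = 1" "S * X = X * S"
  shows "S * Y = Y * S"
proof -
  have "S * Y = Y * X * S * Y" using assms by simp
  also have "\<dots> = Y * (S * X) * Y" using assms(3) by (simp add: mult.assoc)
  also have "\<dots> = Y * S" using assms(1) by (simp add: mult.assoc)
  finally show ?thesis .
qed

lemma inverse_near_one:
  fixes X :: "'b::complex_banach_algebra"
  assumes "norm (1 - X) < 1"
  obtains Y where "X * Y = 1" "Y * X = 1"
proof -
  define Z where "Z = 1 - X"
  have XZ: "X = 1 - Z" by (simp add: Z_def)
  \<comment> \<open>Z to the power 0 is the unit, whose norm need not be 1; hence the factor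
    \<open>norm 1\<close> in the geometric majorant.\<close>
  have np: "norm (Z ^ k) \<le> norm (1::'b) * norm Z ^ k" for k
  proof (induction k)
    case (Suc k)
    have "norm (Z ^ Suc k) \<le> norm Z * norm (Z ^ k)" by (simp add: norm_mult_ineq)
    also have "\<dots> \<le> norm Z * (norm (1::'b) * norm Z ^ k)" by (intro mult_left_mono Suc) simp
    finally show ?case by (simp add: mult_ac)
  qed simp
  have sm: "summable (\<lambda>k. Z ^ k)"
    by (rule summable_comparison_test'[where g="\<lambda>k. norm (1::'b) * norm Z ^ k" and N=0])
       (use np assms in \<open>auto simp: Z_def intro!: summable_mult summable_geometric\<close>)
  then have lim: "(\<lambda>k. Z ^ k) \<longlonglongrightarrow> 0" by (rule summable_LIMSEQ_zero)
  have sums: "(\<lambda>k. Z ^ k - Z ^ Suc k) sums 1" using telescope_sums'[OF lim] by simp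
  have "X * suminf (\<lambda>k. Z ^ k) = suminf (\<lambda>k. X * Z ^ k)" using suminf_mult[OF sm] by simp
  also have "(\<lambda>k. X * Z ^ k) = (\<lambda>k. Z ^ k - Z ^ Suc k)" by (simp add: XZ left_diff_distrib)
  finally have 1: "X * suminf (\<lambda>k. Z ^ k) = 1" using sums_unique[OF sums] by simp
  have "suminf (\<lambda>k. Z ^ k) * X = suminf (\<lambda>k. Z ^ k * X)" using suminf_mult2[OF sm] by simp
  also have "(\<lambda>k. Z ^ k * X) = (\<lambda>k. Z ^ k - Z ^ Suc k)"
    by (simp add: XZ right_diff_distrib power_commutes)
  finally have 2: "suminf (\<lambda>k. Z ^ k) * X = 1" using sums_unique[OF sums] by simp
  show ?thesis using that 1 2 by blast
qed

lemma invertible_local_to_global: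
  fixes R G :: "'b::complex_banach_algebra"
  defines "\<A> \<equiv> {S. S * R = R * S \<and> S * G = G * S}"
  assumes RG: "R * G = G * R"
    and loc: "\<And>\<rho>. \<exists>U\<in>\<A>. \<exists>V\<in>\<A>. norm (1 - U * G - V * (R - \<rho> *\<^sub>C 1)) < 1"
  shows "\<exists>S. S * G = 1 \<and> G * S = 1"
  \<comment> \<open>Otherwise \<open>R - \<rho>\<close> has an inverse \<open>V \<rho>\<close> modulo the ideal generated by \<open>G\<close> for every \<open>\<rho>\<close>. The quotient
    seminorm \<open>\<phi>\<close> of \<open>V\<close> vanishes at infinity and nearly satisfies a four-point mean value inequality, so
    \<open>\<phi> + \<epsilon>|\<rho>|\<^sup>2\<close> has no interior maximum on a large disc, contradicting \<open>\<phi> 0 > 0\<close>.\<close>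
proof (rule ccontr)
  assume noinv: "\<nexists>S. S * G = 1 \<and> G * S = 1"
  have A_add: "S + T \<in> \<A>" and A_diff: "S - T \<in> \<A>" and A_mult: "S * T \<in> \<A>" if "S \<in> \<A>" "T \<in> \<A>" for S T
    using that by (auto simp: \<A>_def algebra_simps) (metis mult.assoc)+
  have A_sc: "c *\<^sub>C S \<in> \<A>" if "S \<in> \<A>" for c S
    using that by (auto simp: \<A>_def scaleC_mult)
  have A_1: "1 \<in> \<A>" and A_0: "0 \<in> \<A>" and A_R: "R \<in> \<A>" and A_G: "G \<in> \<A>" using RG by (auto simp: \<A>_def)
  have A_inv: "Y \<in> \<A>" if "X \<in> \<A>" "X * Y = 1" "Y * X = 1" for X Y
    using that commutes_inverse[of X Y R] commutes_inverse[of X Y G] by (auto simp: \<A>_def)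
  \<comment> \<open>The ideal generated by \<open>G\<close> in the commutant \<A>. \<open>G\<close>
    is central there, so the ideal is two-sided. It need not be closed: only the distance to it is
    used below.\<close>
  define J where "J = (\<lambda>U. U * G) ` \<A>"
  have J_add: "S + T \<in> J" and J_diff: "S - T \<in> J" if "S \<in> J" "T \<in> J" for S T
    using that A_add A_diff by (auto simp: J_def image_iff ring_distribs(2) left_diff_distrib)
      (metis distrib_right, metis left_diff_distrib)
  have J_neg: "- S \<in> J" if "S \<in> J" for S
    using J_diff[OF _ that, of 0] A_0 by (force simp: J_def)
  have J_left: "S * T \<in> J" if "S \<in> \<A>" "T \<in> J" for S T
    using that A_mult by (auto simp: J_def image_iff) (metis mult.assoc)
  have J_right: "T * S \<in> J" if ST: "S \<in> \<A>" "T \<in> J" for S T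
  proof -
    obtain U where "U \<in> \<A>" "T = U * G" using ST(2) unfolding J_def by blast
    moreover have "G * S = S * G" using ST(1) by (simp add: \<A>_def)
    ultimately have "T * S = (U * S) * G" by (metis mult.assoc)
    then show ?thesis using \<open>U \<in> \<A>\<close> ST(1) A_mult by (auto simp: J_def)
  qed
  \<comment> \<open>An element at distance less than 1 from the unit is invertible inside \<A>;
    multiplying by its inverse turns the approximate identity of \<open>loc\<close> into an exact
    one modulo \<open>J\<close>.\<close>
  have "\<exists>V\<in>\<A>. V * (R - \<rho> *\<^sub>C 1) - 1 \<in> J" for \<rho>
  proof -
    obtain U V where UV: "U \<in> \<A>" "V \<in> \<A>" "norm (1 - (U * G + V * (R - \<rho> *\<^sub>C 1))) < 1"
      using loc[of \<rho>] by (auto simp: algebra_simps)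
    define X where "X = U * G + V * (R - \<rho> *\<^sub>C 1)"
    have XA: "X \<in> \<A>" unfolding X_def by (intro A_add A_mult A_diff A_sc A_1 A_R A_G UV)
    obtain Y where Y: "X * Y = 1" "Y * X = 1" using inverse_near_one[of X] UV by (auto simp: X_def)
    then have YA: "Y \<in> \<A>" using A_inv XA by blast
    have "1 = (Y * U) * G + (Y * V) * (R - \<rho> *\<^sub>C 1)"
      using Y(2) unfolding X_def by (simp add: distrib_left mult.assoc)
    then have "(Y * V) * (R - \<rho> *\<^sub>C 1) - 1 = - ((Y * U) * G)" by (simp add: algebra_simps)
    then show ?thesis using YA UV A_mult J_neg by (auto simp: J_def intro!: bexI[of _ "Y * V"])
  qed
  then obtain V where VA: "\<And>\<rho>. V \<rho> \<in> \<A>" and VJ: "\<And>\<rho>. V \<rho> * (R - \<rho> *\<^sub>C 1) - 1 \<in> J" by metis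

  define E where "E = (\<lambda>S. infdist S J)"
  have Jne: "J \<noteq> {}" using A_0 by (auto simp: J_def)
  have E_le: "E S \<le> norm (S - T)" if "T \<in> J" for S T
    using infdist_le[OF that, of S] by (simp add: E_def dist_norm)
  have E_approx: "\<exists>T\<in>J. norm (S - T) < E S + e" if "e > 0" for S e
  proof -
    have "\<exists>x\<in>(\<lambda>a. dist S a) ` J. x < E S + e"
      by (rule cInf_lessD) (use Jne that in \<open>auto simp: E_def infdist_notempty\<close>)
    then show ?thesis by (auto simp: dist_norm)
  qed
  have E_norm: "E S \<le> norm S" for S using E_le[of 0 S] A_0 by (force simp: J_def)
  have E_nonneg: "E S \<ge> 0" for S by (simp add: E_def infdist_nonneg)
  have E_add: "E (S + T) \<le> E S + E T" for S T
  proof (rule field_le_epsilon)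
    fix e :: real assume "e > 0"
    obtain S' where S': "S' \<in> J" "norm (S - S') < E S + e/2" using E_approx[of "e/2" S] \<open>e > 0\<close> by auto
    obtain T' where T': "T' \<in> J" "norm (T - T') < E T + e/2" using E_approx[of "e/2" T] \<open>e > 0\<close> by auto
    have "E (S + T) \<le> norm ((S - S') + (T - T'))" using E_le[OF J_add[OF S'(1) T'(1)], of "S + T"] by (simp add: algebra_simps)
    also have "\<dots> \<le> norm (S - S') + norm (T - T')" by (rule norm_triangle_ineq)
    finally show "E (S + T) \<le> E S + E T + e" using S' T' by simp
  qed
  have E_mult: "E (S * T) \<le> E S * E T" if "S \<in> \<A>" "T \<in> \<A>" for S T
  proof (rule tendsto_lowerbound[where F="at_right (0::real)" and f="\<lambda>e. (E S + e) * (E T + e)"])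
    have "((\<lambda>e. (E S + e) * (E T + e)) \<longlongrightarrow> (E S + 0) * (E T + 0)) (at_right 0)"
      by (intro tendsto_intros)
    then show "((\<lambda>e. (E S + e) * (E T + e)) \<longlongrightarrow> E S * E T) (at_right 0)" by simp
    show "\<forall>\<^sub>F e in at_right 0. E (S * T) \<le> (E S + e) * (E T + e)"
    proof (rule eventually_at_right_less[of 0, THEN eventually_mono])
      fix e :: real assume "0 < e"
      obtain S' where S': "S' \<in> J" "norm (S - S') < E S + e" using E_approx[of e S] \<open>e > 0\<close> by auto
      obtain T' where T': "T' \<in> J" "norm (T - T') < E T + e" using E_approx[of e T] \<open>e > 0\<close> by auto
      have S'A: "S' \<in> \<A>" using S'(1) A_mult A_G by (auto simp: J_def)
      have "S * T' + S' * T - S' * T' \<in> J"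
        by (intro J_add J_diff J_left J_right S' T' that S'A)
      then have "E (S * T) \<le> norm ((S - S') * (T - T'))" using E_le[of "S * T' + S' * T - S' * T'" "S * T"]
        by (simp add: algebra_simps)
      also have "\<dots> \<le> norm (S - S') * norm (T - T')" by (rule norm_mult_ineq)
      also have "\<dots> \<le> (E S + e) * (E T + e)" using S' T' by (intro mult_mono) (auto intro: order_trans[OF norm_ge_zero less_imp_le])
      finally show "E (S * T) \<le> (E S + e) * (E T + e)" .
    qed
  qed simp
  have E_cong: "E S = E T" if "S - T \<in> J" for S T
  proof -
    have *: "E S \<le> E T" if "S - T \<in> J" for S T
    proof -
      have "E (S - T) \<le> 0" using E_le[OF that, of "S - T"] by simp
      then show ?thesis using E_add[of T "S - T"] by simp
    qed
    show ?thesis using *[OF that] *[of T S] J_neg[OF that] by simp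
  qed
  have E_sc: "E (c *\<^sub>C S) = cmod c * E S" if SA: "S \<in> \<A>" for c S
  proof -
    have le: "E (c *\<^sub>C S) \<le> cmod c * E S" for c S
    proof (rule field_le_epsilon)
      fix e :: real assume "e > 0"
      then have e: "e / (cmod c + 1) > 0" by (simp add: add_nonneg_pos)
      obtain T where T: "T \<in> J" "norm (S - T) < E S + e / (cmod c + 1)" using E_approx[OF e, of S] by auto
      have "c *\<^sub>C T \<in> J" using T(1) A_sc by (auto simp: J_def image_iff) (metis scaleC_mult_left)
      then have "E (c *\<^sub>C S) \<le> norm (c *\<^sub>C (S - T))" using E_le[of "c *\<^sub>C T"] by (simp add: scaleC_diff_right)
      also have "\<dots> \<le> cmod c * (E S + e / (cmod c + 1))" using T by (simp add: norm_scaleC mult_left_mono)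
      also have "\<dots> \<le> cmod c * E S + e"
      proof -
        have "cmod c + 1 > 0" by (simp add: add_nonneg_pos)
        then have "cmod c * e / (cmod c + 1) \<le> e" using \<open>e > 0\<close> by (simp add: pos_divide_le_eq algebra_simps)
        then show ?thesis by (simp add: distrib_left)
      qed
      finally show "E (c *\<^sub>C S) \<le> cmod c * E S + e" .
    qed
    show ?thesis
    proof (cases "c = 0")
      case True then show ?thesis using E_norm[of 0] E_nonneg[of 0] by simp
    next
      case False
      have "E S \<le> cmod (inverse c) * E (c *\<^sub>C S)"
        using le[of "inverse c" "c *\<^sub>C S"] False by (simp add: scaleC_scaleC scaleC_one)
      then have "cmod c * E S \<le> E (c *\<^sub>C S)"
        using False mult_left_mono[of "E S" _ "cmod c"] by (fastforce simp: norm_inverse mult.assoc[symmetric])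
      then show ?thesis using le[of c S] by simp
    qed
  qed
  \<comment> \<open>A member of \<open>J\<close> nearer than 1 to the unit would be invertible, and
    with it \<open>G\<close>, contrary to \<open>noinv\<close>.\<close>
  have E_1: "1 \<le> E 1"
  proof -
    have "1 \<le> norm (1 - T)" if TJ: "T \<in> J" for T
    proof (rule ccontr)
      assume "\<not> ?thesis"
      then obtain Y where Y: "T * Y = 1" "Y * T = 1" using inverse_near_one[of T] by auto
      obtain U where U: "U \<in> \<A>" "T = U * G" using TJ unfolding J_def by blast
      have YA: "Y \<in> \<A>" using A_inv Y U A_mult A_G by blast
      have "(Y * U) * G = 1" using Y U by (simp add: mult.assoc)
      moreover have "G * (Y * U) = 1" using A_mult[OF YA U(1)] calculation by (simp add: \<A>_def)
      ultimately show False using noinv by blast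
    qed
    then show ?thesis using Jne unfolding E_def infdist_notempty[OF Jne]
      by (intro cInf_greatest) (auto simp: dist_norm)
  qed

  \<comment> \<open>Modulo \<open>J\<close>, \<open>V \<rho>\<close> is the inverse of R - \<rho>,
    so it obeys the resolvent identity.\<close>
  have res_id: "V \<rho> - V \<sigma> - (\<rho> - \<sigma>) *\<^sub>C (V \<rho> * V \<sigma>) \<in> J" for \<rho> \<sigma>
  proof -
    have RV: "R * V \<sigma> = V \<sigma> * R" using VA[of \<sigma>] by (auto simp: \<A>_def)
    have "- (V \<rho> * (V \<sigma> * (R - \<sigma> *\<^sub>C 1) - 1)) + (V \<rho> * (R - \<rho> *\<^sub>C 1) - 1) * V \<sigma> \<in> J"
      by (intro J_add J_neg J_left J_right VA VJ)
    also have "- (V \<rho> * (V \<sigma> * (R - \<sigma> *\<^sub>C 1) - 1)) + (V \<rho> * (R - \<rho> *\<^sub>C 1) - 1) * V \<sigma> =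
      V \<rho> - V \<sigma> - (\<rho> - \<sigma>) *\<^sub>C (V \<rho> * V \<sigma>)"
      by (simp add: algebra_simps RV scaleC_mult scaleC_diff_left)
    finally show ?thesis .
  qed
  define \<phi> where "\<phi> = (\<lambda>\<rho>. E (V \<rho>))"
  have \<phi>_nonneg: "\<phi> \<rho> \<ge> 0" for \<rho> by (simp add: \<phi>_def E_nonneg)
  have lip0: "\<phi> \<rho> \<le> \<phi> \<sigma> + cmod (\<rho> - \<sigma>) * (\<phi> \<rho> * \<phi> \<sigma>)"
    and lip1: "\<phi> \<sigma> \<le> \<phi> \<rho> + cmod (\<rho> - \<sigma>) * (\<phi> \<rho> * \<phi> \<sigma>)" for \<rho> \<sigma>
  proof -
    have m: "E (c *\<^sub>C (V \<rho> * V \<sigma>)) \<le> cmod c * (\<phi> \<rho> * \<phi> \<sigma>)" for c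
      by (simp add: E_sc A_mult VA \<phi>_def mult_left_mono E_mult)
    have "V \<rho> - (V \<sigma> + (\<rho> - \<sigma>) *\<^sub>C (V \<rho> * V \<sigma>)) \<in> J" using res_id[of \<rho> \<sigma>] by (simp add: algebra_simps)
    from E_cong[OF this] show "\<phi> \<rho> \<le> \<phi> \<sigma> + cmod (\<rho> - \<sigma>) * (\<phi> \<rho> * \<phi> \<sigma>)"
      using E_add[of "V \<sigma>" "(\<rho> - \<sigma>) *\<^sub>C (V \<rho> * V \<sigma>)"] m[of "\<rho> - \<sigma>"] by (simp add: \<phi>_def)
    have "V \<sigma> - (V \<rho> + (\<sigma> - \<rho>) *\<^sub>C (V \<rho> * V \<sigma>)) \<in> J" using J_neg[OF res_id[of \<rho> \<sigma>]]
      by (simp add: algebra_simps scaleC_diff_left)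
    from E_cong[OF this] show "\<phi> \<sigma> \<le> \<phi> \<rho> + cmod (\<rho> - \<sigma>) * (\<phi> \<rho> * \<phi> \<sigma>)"
      using E_add[of "V \<rho>" "(\<sigma> - \<rho>) *\<^sub>C (V \<rho> * V \<sigma>)"] m[of "\<sigma> - \<rho>"] by (simp add: \<phi>_def norm_minus_commute)
  qed
  \<comment> \<open>Near \<sigma> the term with \<open>\<phi> \<rho>\<close> on the right of
    \<open>lip0\<close> can be absorbed; this gives
    \<open>\<phi> \<rho> \<le> 2 * \<phi> \<sigma>\<close> and then a local Lipschitz bound.\<close>
  have cont: "isCont \<phi> \<sigma>" for \<sigma>
  proof -
    have "\<forall>\<^sub>F \<rho> in at \<sigma>. cmod (\<rho> - \<sigma>) * \<phi> \<sigma> < 1/2"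
      by (rule order_tendstoD(2)[where y="cmod (\<sigma> - \<sigma>) * \<phi> \<sigma>"]) (auto intro!: tendsto_eq_intros)
    then have "\<forall>\<^sub>F \<rho> in at \<sigma>. norm (\<phi> \<rho> - \<phi> \<sigma>) \<le> cmod (\<rho> - \<sigma>) * (2 * \<phi> \<sigma> * \<phi> \<sigma>)"
    proof eventually_elim
      case (elim \<rho>)
      have "cmod (\<rho> - \<sigma>) * \<phi> \<sigma> * \<phi> \<rho> \<le> 1/2 * \<phi> \<rho>" using elim \<phi>_nonneg by (intro mult_right_mono) auto
      then have "\<phi> \<rho> \<le> 2 * \<phi> \<sigma>" using lip0[of \<rho> \<sigma>] by (simp add: mult_ac)
      then have "cmod (\<rho> - \<sigma>) * (\<phi> \<rho> * \<phi> \<sigma>) \<le> cmod (\<rho> - \<sigma>) * (2 * \<phi> \<sigma> * \<phi> \<sigma>)"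
        by (intro mult_left_mono mult_right_mono \<phi>_nonneg) auto
      then show ?case using lip0[of \<rho> \<sigma>] lip1[of \<sigma> \<rho>] by (auto simp: abs_le_iff)
    qed
    moreover have "((\<lambda>\<rho>. cmod (\<rho> - \<sigma>) * (2 * \<phi> \<sigma> * \<phi> \<sigma>)) \<longlongrightarrow> 0) (at \<sigma>)"
      by (auto intro!: tendsto_eq_intros)
    ultimately have "((\<lambda>\<rho>. \<phi> \<rho> - \<phi> \<sigma>) \<longlongrightarrow> 0) (at \<sigma>)" by (rule Lim_null_comparison)
    then show ?thesis unfolding isCont_def by (simp add: LIM_zero_iff)
  qed
  have decay: "cmod \<rho> * \<phi> \<rho> \<le> \<phi> \<rho> * norm R + norm (1::'b)" for \<rho>
  proof -
    have "\<rho> *\<^sub>C V \<rho> - (V \<rho> * R + (- 1)) \<in> J" using J_neg[OF VJ[of \<rho>]] by (simp add: algebra_simps scaleC_mult_right)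
    then have "cmod \<rho> * \<phi> \<rho> = E (V \<rho> * R + (- 1))" using E_cong E_sc VA unfolding \<phi>_def by metis
    also have "\<dots> \<le> E (V \<rho> * R) + E (- 1)" by (rule E_add)
    also have "\<dots> \<le> \<phi> \<rho> * E R + norm (-1::'b)" unfolding \<phi>_def by (intro add_mono E_mult VA A_R E_norm)
    also have "\<dots> \<le> \<phi> \<rho> * norm R + norm (1::'b)" using E_norm[of R] \<phi>_nonneg by (simp add: mult_left_mono)
    finally show ?thesis .
  qed
  \<comment> \<open>With x = r V(\<rho>) the resolvent identity reads V(\<rho> + \<omega> r)(1 -
    \<omega> x) = V(\<rho>) modulo \<open>J\<close>. Multiplying by the geometric sum
    \<open>p \<omega>\<close> turns the factor into 1 - x^4 for every fourth root of unity \<omega>,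
    and the four sums add up to 4. An average over four points thus replaces Cauchy's integral, with
    an error of fourth order in r.\<close>
  have mean: "4 * \<phi> \<rho> \<le> (\<phi> (\<rho> + r) + \<phi> (\<rho> + \<i> * r) + \<phi> (\<rho> - r) + \<phi> (\<rho> - \<i> * r)) * (1 + (cmod r * \<phi> \<rho>) ^ 4)"
    for \<rho> r
  proof -
    define x where "x = r *\<^sub>C V \<rho>"
    have xA: "x \<in> \<A>" by (simp add: x_def A_sc VA)
    define p where "p = (\<lambda>\<omega>. 1 + \<omega> *\<^sub>C x + (\<omega> * \<omega>) *\<^sub>C (x * x) + (\<omega> * \<omega> * \<omega>) *\<^sub>C (x * x * x))"
    define x4 where "x4 = x * x * x * x"
    have x4A: "x4 \<in> \<A>" unfolding x4_def by (intro A_mult xA)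
    have one: "V (\<rho> + \<omega> * r) * (1 - x4) - V \<rho> * p \<omega> \<in> J" if "\<omega> ^ 4 = 1" for \<omega>
    proof -
      have w4: "\<omega> * (\<omega> * (\<omega> * \<omega>)) = 1" using that by (simp add: power4_eq_xxxx mult_ac)
      have "V (\<rho> + \<omega> * r) * (1 - \<omega> *\<^sub>C x) - V \<rho> \<in> J"
        using res_id[of "\<rho> + \<omega> * r" \<rho>] by (simp add: x_def algebra_simps scaleC_mult_right scaleC_scaleC)
      then have "(V (\<rho> + \<omega> * r) * (1 - \<omega> *\<^sub>C x) - V \<rho>) * p \<omega> \<in> J"
        by (rule J_right[rotated]) (auto simp: p_def intro!: A_add A_1 A_sc A_mult xA)
      also have "(V (\<rho> + \<omega> * r) * (1 - \<omega> *\<^sub>C x) - V \<rho>) * p \<omega> = V (\<rho> + \<omega> * r) * ((1 - \<omega> *\<^sub>C x) * p \<omega>) - V \<rho> * p \<omega>"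
        by (simp add: algebra_simps)
      also have "(1 - \<omega> *\<^sub>C x) * p \<omega> = 1 - x4" unfolding p_def x4_def
        by (simp add: algebra_simps scaleC_mult scaleC_scaleC scaleC_diff_right scaleC_add_right w4 scaleC_one)
      finally show ?thesis .
    qed
    let ?S = "V (\<rho> + r) + V (\<rho> + \<i> * r) + V (\<rho> - r) + V (\<rho> - \<i> * r)"
    have "V (\<rho> + 1 * r) * (1 - x4) - V \<rho> * p 1 + (V (\<rho> + \<i> * r) * (1 - x4) - V \<rho> * p \<i>) +
       (V (\<rho> + (-1) * r) * (1 - x4) - V \<rho> * p (-1)) + (V (\<rho> + (-\<i>) * r) * (1 - x4) - V \<rho> * p (-\<i>)) \<in> J"
      by (intro J_add one) auto
    also have "V (\<rho> + 1 * r) * (1 - x4) - V \<rho> * p 1 + (V (\<rho> + \<i> * r) * (1 - x4) - V \<rho> * p \<i>) +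
       (V (\<rho> + (-1) * r) * (1 - x4) - V \<rho> * p (-1)) + (V (\<rho> + (-\<i>) * r) * (1 - x4) - V \<rho> * p (-\<i>)) =
       ?S * (1 - x4) - V \<rho> * (p 1 + p \<i> + p (-1) + p (-\<i>))"
      by (simp add: algebra_simps)
    also have "p 1 + p \<i> + p (-1) + p (-\<i>) = 4 *\<^sub>C 1"
    proof -
      have "(4::complex) *\<^sub>C (1::'b) = 1 + 1 + 1 + 1"
        using scaleC_add_left[of 2 2 "1::'b"] scaleC_add_left[of 1 1 "1::'b"] by (simp add: scaleC_one)
      then show ?thesis by (simp add: p_def scaleC_minus_left scaleC_one)
    qed
    finally have "4 *\<^sub>C V \<rho> - ?S * (1 - x4) \<in> J" using J_neg by (fastforce simp: scaleC_mult_right)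
    then have "4 * \<phi> \<rho> = E (?S * (1 - x4))" using E_cong[of "4 *\<^sub>C V \<rho>"] E_sc[OF VA, of 4 \<rho>] by (simp add: \<phi>_def)
    also have "?S * (1 - x4) = ?S + ?S * ((-1) *\<^sub>C x4)" by (simp add: algebra_simps scaleC_minus_left scaleC_one)
    also have "E \<dots> \<le> E ?S + E (?S * ((-1) *\<^sub>C x4))" by (rule E_add)
    also have "\<dots> \<le> E ?S + E ?S * E ((-1) *\<^sub>C x4)" by (intro add_left_mono E_mult A_add VA A_sc x4A)
    also have "E ((-1) *\<^sub>C x4) = E x4" using E_sc[OF x4A, of "-1"] by simp
    also have "E ?S + E ?S * E x4 = E ?S * (1 + E x4)" by (simp add: algebra_simps)
    also have "\<dots> \<le> (\<phi> (\<rho> + r) + \<phi> (\<rho> + \<i> * r) + \<phi> (\<rho> - r) + \<phi> (\<rho> - \<i> * r)) * (1 + (cmod r * \<phi> \<rho>) ^ 4)"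
    proof (rule mult_mono)
      show "E ?S \<le> \<phi> (\<rho> + r) + \<phi> (\<rho> + \<i> * r) + \<phi> (\<rho> - r) + \<phi> (\<rho> - \<i> * r)"
        unfolding \<phi>_def using E_add by (meson add_right_mono order_trans)
      have Ex: "E x = cmod r * \<phi> \<rho>" by (simp add: x_def E_sc VA \<phi>_def)
      have "E x4 \<le> E x * E x * E x * E x" unfolding x4_def
        by (meson E_mult A_mult xA E_nonneg order_trans mult_right_mono)
      then show "1 + E x4 \<le> 1 + (cmod r * \<phi> \<rho>) ^ 4" by (simp add: Ex power4_eq_xxxx)
    qed (auto intro!: add_nonneg_nonneg \<phi>_nonneg E_nonneg)
    finally show ?thesis .
  qed

  define m where "m = \<phi> 0"
  have m: "m > 0"
  proof -
    have "1 \<le> E 1" by (rule E_1)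
    also have "E 1 = E (V 0 * R)" using E_cong[of "V 0 * R" 1] VJ[of 0] by simp
    also have "\<dots> \<le> m * E R" unfolding m_def \<phi>_def by (intro E_mult VA A_R)
    finally show ?thesis using \<phi>_nonneg[of 0] E_nonneg[of R] unfolding m_def
      by (metis less_eq_real_def mult_zero_left not_one_le_zero)
  qed
  \<comment> \<open>Chosen so that B - norm R is at least 4 norm 1 / m; then \<open>decay\<close>
    gives \<open>\<phi> \<rho> \<le> m / 4\<close> on the circle of radius B.\<close>
  define B where "B = norm R + 4 * norm (1::'b) / m + 1"
  have B: "B > 0" using m by (simp add: B_def add_nonneg_pos)
  have bd: "\<phi> \<rho> \<le> m / 4" if "cmod \<rho> = B" for \<rho>
  proof -
    have "\<phi> \<rho> * (B - norm R) \<le> norm (1::'b)" using decay[of \<rho>] that by (simp add: algebra_simps)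
    moreover have "\<phi> \<rho> * (4 * norm (1::'b) / m) \<le> \<phi> \<rho> * (B - norm R)"
      by (intro mult_left_mono \<phi>_nonneg) (simp add: B_def)
    ultimately have "\<phi> \<rho> * (4 * norm (1::'b) / m) \<le> norm (1::'b)" by simp
    moreover have "norm (1::'b) > 0" using E_1 E_norm[of 1] by linarith
    ultimately show ?thesis using m by (simp add: field_simps)
  qed
  \<comment> \<open>On that circle \<epsilon> B^2 = m/4, so \<Psi> is at most m/2 there, below its
    value m at 0: the maximum is interior.\<close>
  define \<epsilon> where "\<epsilon> = m / (4 * B\<^sup>2)"
  have \<epsilon>: "\<epsilon> > 0" using m B by (simp add: \<epsilon>_def)
  define \<Psi> where "\<Psi> = (\<lambda>\<rho>. \<phi> \<rho> + \<epsilon> * (cmod \<rho>)\<^sup>2)"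
  have "continuous_on (cball 0 B) \<Psi>" unfolding \<Psi>_def
    by (intro continuous_intros continuous_at_imp_continuous_on ballI cont)
  then obtain \<rho>0 where \<rho>0: "\<rho>0 \<in> cball 0 B" "\<And>\<rho>. \<rho> \<in> cball 0 B \<Longrightarrow> \<Psi> \<rho> \<le> \<Psi> \<rho>0"
    using continuous_attains_sup[of "cball (0::complex) B" \<Psi>] B by auto
  have "cmod \<rho>0 \<noteq> B"
  proof
    assume "cmod \<rho>0 = B"
    then have "\<Psi> \<rho>0 \<le> m / 4 + m / 4" using bd[of \<rho>0] B by (simp add: \<Psi>_def \<epsilon>_def)
    moreover have "m \<le> \<Psi> \<rho>0" using \<rho>0(2)[of 0] B by (simp add: \<Psi>_def m_def)
    ultimately show False using m by simp
  qed
  then have \<rho>0B: "cmod \<rho>0 < B" using \<rho>0(1) by simp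
  \<comment> \<open>At the maximum, the four squares lower the average of \<phi> by \<epsilon> r^2,
    while the error in \<open>mean\<close> contributes M^5 r^4; a small r is contradictory.\<close>
  define M where "M = \<phi> \<rho>0"
  have "\<forall>\<^sub>F r::real in at_right 0. M ^ 5 * r\<^sup>2 < \<epsilon> \<and> cmod \<rho>0 + r < B \<and> r > 0"
  proof (intro eventually_conj)
    show "\<forall>\<^sub>F r in at_right 0. M ^ 5 * r\<^sup>2 < \<epsilon>"
      by (rule order_tendstoD(2)[where y="M ^ 5 * 0\<^sup>2"]) (use \<epsilon> in \<open>auto intro!: tendsto_eq_intros\<close>)
    show "\<forall>\<^sub>F r in at_right 0. cmod \<rho>0 + r < B"
      by (rule order_tendstoD(2)[where y="cmod \<rho>0 + 0"]) (use \<rho>0B in \<open>auto intro!: tendsto_eq_intros\<close>)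
  qed (simp add: eventually_at_right_less)
  then obtain r :: real where r: "M ^ 5 * r\<^sup>2 < \<epsilon>" "cmod \<rho>0 + r < B" "r > 0"
    using eventually_happens by force
  have pt: "\<phi> (\<rho>0 + h) \<le> M + \<epsilon> * (cmod \<rho>0)\<^sup>2 - \<epsilon> * (cmod (\<rho>0 + h))\<^sup>2" if "cmod h = r" for h
    using \<rho>0(2)[of "\<rho>0 + h"] norm_triangle_ineq[of \<rho>0 h] that r by (simp add: \<Psi>_def M_def)
  have "\<phi> (\<rho>0 + r) + \<phi> (\<rho>0 + \<i> * r) + \<phi> (\<rho>0 + (- r)) + \<phi> (\<rho>0 + (- \<i> * r)) \<le>
     4 * M + 4 * \<epsilon> * (cmod \<rho>0)\<^sup>2 - \<epsilon> * ((cmod (\<rho>0 + r))\<^sup>2 + (cmod (\<rho>0 + \<i> * r))\<^sup>2 + (cmod (\<rho>0 + (-r)))\<^sup>2 + (cmod (\<rho>0 + (- \<i> * r)))\<^sup>2)"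
    using pt[of r] pt[of "\<i> * r"] pt[of "- r"] pt[of "- \<i> * r"] r(3) by (simp add: norm_mult algebra_simps)
  also have "(cmod (\<rho>0 + r))\<^sup>2 + (cmod (\<rho>0 + \<i> * r))\<^sup>2 + (cmod (\<rho>0 + (-r)))\<^sup>2 + (cmod (\<rho>0 + (- \<i> * r)))\<^sup>2 = 4 * (cmod \<rho>0)\<^sup>2 + 4 * r\<^sup>2"
    unfolding cmod_power2 by (simp add: power2_eq_square algebra_simps)
  finally have sum4: "\<phi> (\<rho>0 + r) + \<phi> (\<rho>0 + \<i> * r) + \<phi> (\<rho>0 - r) + \<phi> (\<rho>0 - \<i> * r) \<le> 4 * M - 4 * \<epsilon> * r\<^sup>2"
    by (simp add: algebra_simps)
  have "4 * M \<le> (4 * M - 4 * \<epsilon> * r\<^sup>2) * (1 + (r * M) ^ 4)"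
    using mean[of \<rho>0 r] mult_right_mono[OF sum4, of "1 + (r * M) ^ 4"] r(3) \<phi>_nonneg[of \<rho>0]
    by (simp add: M_def)
  also have "\<dots> \<le> 4 * M + 4 * M * (r * M) ^ 4 - 4 * \<epsilon> * r\<^sup>2"
    using \<epsilon> by (simp add: algebra_simps)
  finally have "\<epsilon> * r\<^sup>2 \<le> (M ^ 5 * r\<^sup>2) * r\<^sup>2"
    by (simp add: power_mult_distrib algebra_simps power_numeral_reduce)
  then show False using r by simp
qed

section \<open>Iterated integrals of Banach space valued kernels\<close>

text \<open>Cauchy's criterion for gauge integrals works in any Banach space: Riemann sums of f
  differ from those of \<open>F k\<close> by at most a Riemann sum of \<open>h k\<close>, which is
  close to an integral tending to 0.\<close>

lemma integrable_L1_limit: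
  fixes f :: "real \<Rightarrow> 'b::banach"
  assumes F: "\<And>k::nat. F k integrable_on cbox a b" and h: "\<And>k. h k integrable_on cbox a b"
    and le: "\<And>k x. x \<in> cbox a b \<Longrightarrow> norm (f x - F k x) \<le> h k x"
    and lim: "(\<lambda>k. integral (cbox a b) (h k)) \<longlonglongrightarrow> 0"
  shows "f integrable_on cbox a b"
  unfolding integrable_Cauchy
proof (intro allI impI)
  fix e :: real assume "e > 0"
  \<comment> \<open>Budget: e/8 for the integral of \<open>h k\<close>, e/8 for its Riemann sum and
    e/8 for that of \<open>F k\<close>. Each Riemann sum of f is then within 3e/8 of the integral of
    \<open>F k\<close>, and any two are within e of each other.\<close>
  then obtain k where k: "integral (cbox a b) (h k) < e/8"
    using order_tendstoD(2)[OF lim, of "e/8"] by (auto simp: eventually_sequentially)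
  obtain \<gamma>1 where \<gamma>1: "gauge \<gamma>1" "\<And>\<D>. \<D> tagged_division_of cbox a b \<Longrightarrow> \<gamma>1 fine \<D> \<Longrightarrow>
      norm ((\<Sum>(x,K)\<in>\<D>. measure lborel K *\<^sub>R h k x) - integral (cbox a b) (h k)) < e/8"
    using has_integralD[OF integrable_integral[OF h[of k]], of "e/8"] \<open>e > 0\<close> by (metis divide_pos_pos zero_less_numeral)
  obtain \<gamma>2 where \<gamma>2: "gauge \<gamma>2" "\<And>\<D>. \<D> tagged_division_of cbox a b \<Longrightarrow> \<gamma>2 fine \<D> \<Longrightarrow>
      norm ((\<Sum>(x,K)\<in>\<D>. measure lborel K *\<^sub>R F k x) - integral (cbox a b) (F k)) < e/8"
    using has_integralD[OF integrable_integral[OF F[of k]], of "e/8"] \<open>e > 0\<close> by (metis divide_pos_pos zero_less_numeral)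
  have est: "norm ((\<Sum>(x,K)\<in>\<D>. measure lborel K *\<^sub>R f x) - integral (cbox a b) (F k)) < 3 * (e/8)"
    if D: "\<D> tagged_division_of cbox a b" "\<gamma>1 fine \<D>" "\<gamma>2 fine \<D>" for \<D>
  proof -
    have "norm ((\<Sum>(x,K)\<in>\<D>. measure lborel K *\<^sub>R f x) - (\<Sum>(x,K)\<in>\<D>. measure lborel K *\<^sub>R F k x))
        = norm (\<Sum>(x,K)\<in>\<D>. measure lborel K *\<^sub>R (f x - F k x))"
      by (simp add: sum_subtractf[symmetric] case_prod_unfold scaleR_diff_right)
    also have "\<dots> \<le> (\<Sum>(x,K)\<in>\<D>. measure lborel K *\<^sub>R h k x)"
    proof (rule sum_norm_le, clarsimp)
      fix x K assume "(x, K) \<in> \<D>"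
      then have "x \<in> cbox a b" using tag_in_interval[OF D(1)] by blast
      then show "measure lborel K * norm (f x - F k x) \<le> measure lborel K * h k x" by (intro mult_left_mono le) auto
    qed
    also have "\<dots> < e/4" using \<gamma>1(2)[OF D(1,2)] k unfolding real_norm_def by linarith
    finally have "norm ((\<Sum>(x,K)\<in>\<D>. measure lborel K *\<^sub>R f x) - (\<Sum>(x,K)\<in>\<D>. measure lborel K *\<^sub>R F k x)) < e/4" .
    then show ?thesis using \<gamma>2(2)[OF D(1,3)]
      norm_diff_triangle_ineq[of "\<Sum>(x,K)\<in>\<D>. measure lborel K *\<^sub>R f x" "\<Sum>(x,K)\<in>\<D>. measure lborel K *\<^sub>R F k x"
       "\<Sum>(x,K)\<in>\<D>. measure lborel K *\<^sub>R F k x" "integral (cbox a b) (F k)"]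
      norm_triangle_lt[of "(\<Sum>(x,K)\<in>\<D>. measure lborel K *\<^sub>R f x) - (\<Sum>(x,K)\<in>\<D>. measure lborel K *\<^sub>R F k x)"
         "(\<Sum>(x,K)\<in>\<D>. measure lborel K *\<^sub>R F k x) - integral (cbox a b) (F k)" "3 * (e/8)"] by simp
  qed
  have tri: "norm (p - q) < e" if "norm (p - i) < 3 * (e/8)" "norm (q - i) < 3 * (e/8)" for p q i :: 'b
    using norm_triangle_ineq4[of "p - i" "q - i"] that \<open>e > 0\<close> by simp
  show "\<exists>\<gamma>. gauge \<gamma> \<and> (\<forall>\<D>1 \<D>2. \<D>1 tagged_division_of (cbox a b) \<and> \<gamma> fine \<D>1 \<and>
            \<D>2 tagged_division_of (cbox a b) \<and> \<gamma> fine \<D>2 \<longrightarrow>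
            norm ((\<Sum>(x,K)\<in>\<D>1. measure lborel K *\<^sub>R f x) - (\<Sum>(x,K)\<in>\<D>2. measure lborel K *\<^sub>R f x)) < e)"
  proof (intro exI[of _ "\<lambda>x. \<gamma>1 x \<inter> \<gamma>2 x"] conjI allI impI)
    show "gauge (\<lambda>x. \<gamma>1 x \<inter> \<gamma>2 x)" by (rule gauge_Int[OF \<gamma>1(1) \<gamma>2(1)])
  next
    fix \<D>1 \<D>2 assume *: "\<D>1 tagged_division_of (cbox a b) \<and> (\<lambda>x. \<gamma>1 x \<inter> \<gamma>2 x) fine \<D>1 \<and>
            \<D>2 tagged_division_of (cbox a b) \<and> (\<lambda>x. \<gamma>1 x \<inter> \<gamma>2 x) fine \<D>2"
    have "norm ((\<Sum>(x,K)\<in>\<D>1. measure lborel K *\<^sub>R f x) - integral (cbox a b) (F k)) < 3 * (e/8)"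
       "norm ((\<Sum>(x,K)\<in>\<D>2. measure lborel K *\<^sub>R f x) - integral (cbox a b) (F k)) < 3 * (e/8)"
      using * est[of \<D>1] est[of \<D>2] by (simp_all only: fine_Int simp_thms)
    then show "norm ((\<Sum>(x,K)\<in>\<D>1. measure lborel K *\<^sub>R f x) - (\<Sum>(x,K)\<in>\<D>2. measure lborel K *\<^sub>R f x)) < e"
      by (rule tri)
  qed
qed

text \<open>On these lines the inner integral of a dominated kernel is not controlled. By Fubini
  they form a null set, on which the outer integrand may be altered freely.\<close>

definition bad_lines :: "(real \<times> real \<Rightarrow> real) \<Rightarrow> real set" where
  "bad_lines v = {\<alpha>. \<not> integrable lborel (\<lambda>\<beta>. v (\<alpha>, \<beta>))}"

lemma negligible_bad_lines:
  assumes "integrable (lborel \<Otimes>\<^sub>M lborel) v"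
  shows "negligible (bad_lines v)"
proof -
  have "AE \<alpha> in lborel. integrable lborel (\<lambda>\<beta>. v (\<alpha>, \<beta>))"
    using lborel_pair.AE_integrable_fst'[OF assms] .
  then obtain N where N: "{\<alpha> \<in> space lborel. \<not> integrable lborel (\<lambda>\<beta>. v (\<alpha>, \<beta>))} \<subseteq> N"
      "emeasure lborel N = 0" "N \<in> sets lborel" by (rule AE_E)
  then have "N \<in> null_sets lebesgue" by (intro null_sets_completionI) auto
  then have "negligible N" by (simp add: negligible_iff_null_sets)
  then show ?thesis by (rule negligible_subset) (use N in \<open>auto simp: bad_lines_def\<close>)
qed

text \<open>Measure theory is applied to the real majorant \<open>v\<close>; the kernel itself
  contributes continuity and a norm bound.\<close>

locale dominated_kernel =
  fixes K :: "real \<Rightarrow> real \<Rightarrow> 'b::banach" and v :: "real \<times> real \<Rightarrow> real"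
  assumes contK: "continuous_on ({0<..} \<times> UNIV) (\<lambda>(\<alpha>, \<beta>). K \<alpha> \<beta>)"
    and v_int: "integrable (lborel \<Otimes>\<^sub>M lborel) v"
    and v_nonneg: "\<And>p. 0 \<le> v p" and v_zero: "\<And>\<alpha> \<beta>. \<alpha> \<le> 0 \<Longrightarrow> v (\<alpha>, \<beta>) = 0"
    and K_le: "\<And>\<alpha> \<beta>. 0 < \<alpha> \<Longrightarrow> norm (K \<alpha> \<beta>) \<le> v (\<alpha>, \<beta>)"
begin

lemma inner_integrable_on_cbox: "0 < \<alpha> \<Longrightarrow> K \<alpha> integrable_on cbox a b"
  by (intro integrable_continuous continuous_on_compose2[OF contK, of _ "\<lambda>\<beta>. (\<alpha>, \<beta>)", simplified]
      continuous_intros) auto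

lemma inner_integrable:
  assumes "0 < \<alpha>" "\<alpha> \<notin> bad_lines v"
  shows "K \<alpha> integrable_on UNIV"
proof (rule integrable_on_all_intervals_UNIV)
  show "(\<lambda>\<beta>. v (\<alpha>, \<beta>)) integrable_on UNIV"
    using assms by (intro integrable_on_lborel) (simp add: bad_lines_def)
qed (use assms inner_integrable_on_cbox K_le in auto)

lemma norm_inner_le:
  assumes "0 < \<alpha>" "\<alpha> \<notin> bad_lines v"
  shows "norm (integral UNIV (K \<alpha>)) \<le> (\<integral>\<beta>. v (\<alpha>, \<beta>) \<partial>lborel)"
proof -
  have i: "integrable lborel (\<lambda>\<beta>. v (\<alpha>, \<beta>))" using assms by (simp add: bad_lines_def)
  have "norm (integral UNIV (K \<alpha>)) \<le> integral UNIV (\<lambda>\<beta>. v (\<alpha>, \<beta>))"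
    by (rule Henstock_Kurzweil_Integration.integral_norm_bound_integral[OF inner_integrable[OF assms] integrable_on_lborel[OF i]])
       (use assms K_le in auto)
  then show ?thesis using integral_lborel[OF i] by simp
qed

text \<open>On a bad line the gauge integral may exist without any bound in terms of
  \<open>v\<close>; with 0 in its place the norm bound holds at every \<alpha>.\<close>

definition good_inner :: "real \<Rightarrow> 'b" where
  "good_inner \<alpha> = (if 0 < \<alpha> \<and> \<alpha> \<notin> bad_lines v then integral UNIV (K \<alpha>) else 0)"

lemma v_fst_integrable: "integrable lborel (\<lambda>\<alpha>. \<integral>\<beta>. v (\<alpha>, \<beta>) \<partial>lborel)"
  using lborel_pair.integrable_fst'[OF v_int] .

text \<open>Truncated to the half-strip \<open>Q k\<close>, the kernel has inner integrals
  continuous in \<alpha> on the range kept. The error on a line is at most the mass of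
  \<open>v\<close> on it outside \<open>Q k\<close>, and the total of that mass tends to 0 by
  dominated convergence.\<close>

lemma good_inner_integrable_on_cbox: "good_inner integrable_on cbox a b"
proof -
  let ?LL = "lborel \<Otimes>\<^sub>M lborel :: (real \<times> real) measure"
  define Q :: "nat \<Rightarrow> (real \<times> real) set" where "Q = (\<lambda>k. {inverse (real (Suc k))..} \<times> {- real k..real k})"
  \<comment> \<open>Set to 0 on bad lines as well, since \<open>integrable_L1_limit\<close> compares
    at every point; this affects \<open>F k\<close> on a null set only.\<close>
  define F where "F = (\<lambda>k \<alpha>. if \<alpha> \<in> bad_lines v then 0 else
      if \<alpha> \<in> {inverse (real (Suc k))..} then integral {- real k..real k} (K \<alpha>) else 0)"
  define u where "u = (\<lambda>k p. if p \<in> Q k then 0 else v p)"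
  define h where "h = (\<lambda>k \<alpha>. \<integral>\<beta>. u k (\<alpha>, \<beta>) \<partial>lborel)"
  have meas[measurable]: "Q k \<in> sets (borel \<Otimes>\<^sub>M borel)" for k by (simp add: Q_def)
  have [measurable]: "v \<in> borel_measurable (borel \<Otimes>\<^sub>M borel)" using borel_measurable_integrable[OF v_int] by simp
  have u_int: "integrable ?LL (u k)" for k
    by (rule Bochner_Integration.integrable_bound[OF v_int]) (auto simp: u_def v_nonneg)
  have [measurable]: "u k \<in> borel_measurable (borel \<Otimes>\<^sub>M borel)" for k unfolding u_def by measurable
  have u_le: "0 \<le> u k p" "u k p \<le> v p" for k p by (auto simp: u_def v_nonneg)
  have h_int: "integrable lborel (h k)" for k
    unfolding h_def using lborel_pair.integrable_fst'[OF u_int] .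
  have h_nonneg: "h k \<alpha> \<ge> 0" for k \<alpha> unfolding h_def by (intro integral_nonneg_AE) (auto simp: u_le)
  have lim: "(\<lambda>k. integral\<^sup>L lborel (h k)) \<longlonglongrightarrow> 0"
  proof -
    have "(\<lambda>k. integral\<^sup>L ?LL (u k)) \<longlonglongrightarrow> integral\<^sup>L ?LL (\<lambda>p::real\<times>real. 0::real)"
    proof (rule integral_dominated_convergence[where w=v])
      show "AE p in ?LL. (\<lambda>k. u k p) \<longlonglongrightarrow> 0"
      proof (rule AE_I2)
        fix p :: "real \<times> real"
        obtain \<alpha> \<beta> where p: "p = (\<alpha>, \<beta>)" by (cases p)
        show "(\<lambda>k. u k p) \<longlonglongrightarrow> 0"
        proof (cases "\<alpha> > 0")
          case True
          have "\<forall>\<^sub>F k in sequentially. inverse (real (Suc k)) < \<alpha>"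
            using order_tendstoD(2)[OF LIMSEQ_inverse_real_of_nat True] .
          moreover have "\<forall>\<^sub>F k in sequentially. real k \<ge> \<bar>\<beta>\<bar>"
            using filterlim_real_sequentially unfolding filterlim_at_top by auto
          ultimately have "\<forall>\<^sub>F k in sequentially. u k p = 0"
            by eventually_elim (auto simp: u_def Q_def p)
          then show ?thesis by (rule tendsto_eventually)
        next
          case False
          then have "u k p = 0" for k by (simp add: u_def p v_zero)
          then show ?thesis by simp
        qed
      qed
    qed (use v_int u_le in \<open>auto simp: v_nonneg u_def\<close>)
    then show ?thesis unfolding h_def lborel_pair.integral_fst'[OF u_int] by simp
  qed
  show ?thesis
  proof (rule integrable_L1_limit[where F=F and h=h])
    show "F k integrable_on cbox a b" for k
    proof -
      let ?c = "max a (inverse (real (Suc k)))"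
      have eq: "{inverse (real (Suc k))..} \<inter> cbox a b = {?c..b}" by auto
      have "continuous_on {?c..b} (\<lambda>\<alpha>. integral (cbox (- real k) (real k)) (K \<alpha>))"
        by (rule integral_continuous_on_param, rule continuous_on_subset[OF contK])
           (auto intro: less_le_trans[of 0 "inverse (real (Suc k))"])
      then have "(\<lambda>\<alpha>. integral {- real k..real k} (K \<alpha>)) integrable_on {inverse (real (Suc k))..} \<inter> cbox a b"
        using integrable_continuous_interval eq by (metis cbox_interval)
      then have "(\<lambda>\<alpha>. if \<alpha> \<in> {inverse (real (Suc k))..} then integral {- real k..real k} (K \<alpha>) else 0) integrable_on cbox a b"
        by (simp only: integrable_restrict_Int)
      then show ?thesis
        by (rule integrable_spike[OF _ negligible_bad_lines[OF v_int]]) (auto simp: F_def)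
    qed
    show "h k integrable_on cbox a b" for k
      using integrable_on_lborel[OF h_int] integrable_on_subcbox by blast
    show "norm (good_inner \<alpha> - F k \<alpha>) \<le> h k \<alpha>" for k \<alpha>
    proof (cases "0 < \<alpha> \<and> \<alpha> \<notin> bad_lines v")
      case False
      moreover have "\<not> inverse (real (Suc k)) \<le> \<alpha>" if "\<not> 0 < \<alpha>"
        using that by (auto simp: not_less not_le intro: le_less_trans[of _ 0])
      ultimately show ?thesis using h_nonneg by (auto simp: good_inner_def F_def)
    next
      case True
      show ?thesis
      proof (cases "inverse (real (Suc k)) \<le> \<alpha>")
        case False
        then have "u k (\<alpha>, \<beta>) = v (\<alpha>, \<beta>)" for \<beta> by (simp add: u_def Q_def)
        then show ?thesis using True False norm_inner_le[of \<alpha>] by (simp add: good_inner_def F_def h_def)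
      next
        case k: True
        have "integrable lborel (\<lambda>\<beta>. v (\<alpha>, \<beta>))" using True by (simp add: bad_lines_def)
        then have ui: "integrable lborel (\<lambda>\<beta>. u k (\<alpha>, \<beta>))"
          by (rule Bochner_Integration.integrable_bound) (auto simp: u_le v_nonneg)
        have 1: "K \<alpha> integrable_on UNIV" using inner_integrable True by blast
        have 2: "(\<lambda>\<beta>. if \<beta> \<in> {- real k..real k} then K \<alpha> \<beta> else 0) integrable_on UNIV"
          using inner_integrable_on_cbox[of \<alpha> "- real k" "real k"] True by (simp only: integrable_restrict_UNIV cbox_interval)
        have "good_inner \<alpha> - F k \<alpha> = integral UNIV (K \<alpha>) - integral UNIV (\<lambda>\<beta>. if \<beta> \<in> {- real k..real k} then K \<alpha> \<beta> else 0)"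
          using True k unfolding integral_restrict_UNIV by (simp add: good_inner_def F_def)
        also have "\<dots> = integral UNIV (\<lambda>\<beta>. K \<alpha> \<beta> - (if \<beta> \<in> {- real k..real k} then K \<alpha> \<beta> else 0))"
          by (rule Henstock_Kurzweil_Integration.integral_diff[OF 1 2, symmetric])
        also have "norm \<dots> \<le> integral UNIV (\<lambda>\<beta>. u k (\<alpha>, \<beta>))"
          by (rule Henstock_Kurzweil_Integration.integral_norm_bound_integral[OF integrable_diff[OF 1 2] integrable_on_lborel[OF ui]])
             (use True k K_le in \<open>auto simp: u_def Q_def\<close>)
        also have "\<dots> = h k \<alpha>" using integral_lborel[OF ui] by (simp add: h_def)
        finally show ?thesis .
      qed
    qed
    have hi: "h k integrable_on cbox a b" for k
      using integrable_on_lborel[OF h_int] integrable_on_subcbox by blast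
    show "(\<lambda>k. integral (cbox a b) (h k)) \<longlonglongrightarrow> 0"
    proof (rule tendsto_sandwich[OF _ _ tendsto_const lim])
      show "\<forall>\<^sub>F k in sequentially. 0 \<le> integral (cbox a b) (h k)"
        by (intro always_eventually allI Henstock_Kurzweil_Integration.integral_nonneg hi h_nonneg)
      show "\<forall>\<^sub>F k in sequentially. integral (cbox a b) (h k) \<le> integral\<^sup>L lborel (h k)"
        using h_nonneg by (intro always_eventually allI)
          (auto intro!: integral_subset_le[OF _ hi[unfolded cbox_interval] integrable_on_lborel[OF h_int]]
             simp flip: integral_lborel[OF h_int])
    qed
  qed
qed

lemma
  shows iterated_integrable: "(\<lambda>\<alpha>. integral UNIV (K \<alpha>)) integrable_on {0<..}"
    and norm_iterated_le: "norm (integral {0<..} (\<lambda>\<alpha>. integral UNIV (K \<alpha>))) \<le> integral\<^sup>L (lborel \<Otimes>\<^sub>M lborel) v"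
proof -
  have nn: "0 \<le> (\<integral>\<beta>. v (\<alpha>, \<beta>) \<partial>lborel)" for \<alpha> by (intro integral_nonneg_AE) (auto simp: v_nonneg)
  have le: "norm (good_inner \<alpha>) \<le> (\<integral>\<beta>. v (\<alpha>, \<beta>) \<partial>lborel)" for \<alpha>
    using norm_inner_le[of \<alpha>] nn by (auto simp: good_inner_def)
  note vi = integrable_on_lborel[OF v_fst_integrable]
  have gi: "good_inner integrable_on UNIV"
    by (rule integrable_on_all_intervals_UNIV[OF good_inner_integrable_on_cbox le vi])
  have eq: "(\<lambda>\<alpha>. if \<alpha> \<in> {0<..} then good_inner \<alpha> else 0) = good_inner" by (auto simp: good_inner_def)
  have gi': "good_inner integrable_on {0<..}" using gi integrable_restrict_UNIV[of "{0<..}" good_inner] eq by simp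
  show "(\<lambda>\<alpha>. integral UNIV (K \<alpha>)) integrable_on {0<..}"
    by (rule integrable_spike[OF gi' negligible_bad_lines[OF v_int]]) (auto simp: good_inner_def)
  have "integral {0<..} (\<lambda>\<alpha>. integral UNIV (K \<alpha>)) = integral {0<..} good_inner"
    by (rule integral_spike[OF negligible_bad_lines[OF v_int]]) (auto simp: good_inner_def)
  also have "\<dots> = integral UNIV good_inner" using integral_restrict_UNIV[of "{0<..}" good_inner] eq by simp
  also have "norm \<dots> \<le> integral UNIV (\<lambda>\<alpha>. \<integral>\<beta>. v (\<alpha>, \<beta>) \<partial>lborel)"
    by (rule Henstock_Kurzweil_Integration.integral_norm_bound_integral[OF gi vi le])
  also have "\<dots> = integral\<^sup>L (lborel \<Otimes>\<^sub>M lborel) v"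
    using integral_lborel[OF v_fst_integrable] lborel_pair.integral_fst'[OF v_int] by simp
  finally show "norm (integral {0<..} (\<lambda>\<alpha>. integral UNIV (K \<alpha>))) \<le> integral\<^sup>L (lborel \<Otimes>\<^sub>M lborel) v" .
qed

end

section \<open>Line integrals over rectangles\<close>

text \<open>Selects sides of contours: a line in the given window that carries no more than the
  average mass and still has a property valid almost everywhere.\<close>

lemma exists_below_mean:
  fixes m :: "real \<Rightarrow> real"
  assumes m: "integrable lborel m" "\<And>s. 0 \<le> m s" and P: "AE s in lborel. P s" and "a < b"
  obtains s where "a < s" "s < b" "P s" "(b - a) * m s \<le> integral\<^sup>L lborel m"
proof (rule ccontr)
  assume *: "\<not> thesis"
  define I where "I = integral\<^sup>L lborel m"
  have "I \<ge> 0" unfolding I_def by (intro integral_nonneg_AE) (auto simp: m)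
  have big: "I < (b - a) * m s" if "a < s" "s < b" "P s" for s
    using * \<open>\<And>s. a < s \<Longrightarrow> s < b \<Longrightarrow> P s \<Longrightarrow> (b - a) * m s \<le> integral\<^sup>L lborel m \<Longrightarrow> thesis\<close> that
    by (force simp: I_def)
  have ii: "integrable lborel (indicator {a<..<b} :: real \<Rightarrow> real)"
    using \<open>a < b\<close> by (intro integrable_real_indicator) auto
  \<comment> \<open>Under the negation k is nonnegative almost everywhere and positive almost
    everywhere on the interval, yet its integral is at most 0.\<close>
  define k where "k = (\<lambda>s. indicator {a<..<b} s * ((b - a) * m s - I))"
  have ki: "integrable lborel k"
  proof -
    have "integrable lborel (\<lambda>s. (b - a) * (indicator {a<..<b} s *\<^sub>R m s) - I * indicator {a<..<b} s)"
      by (intro Bochner_Integration.integrable_diff integrable_mult_right integrable_mult_indicator m ii) auto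
    then show ?thesis by (rule back_subst[where P="integrable lborel"]) (auto simp: k_def indicator_def)
  qed
  have "integral\<^sup>L lborel k \<le> integral\<^sup>L lborel (\<lambda>s. (b - a) * m s - I * indicator {a<..<b} s)"
  proof (rule integral_mono)
    show "integrable lborel (\<lambda>s. (b - a) * m s - I * indicator {a<..<b} s)" using m ii by auto
    show "k s \<le> (b - a) * m s - I * indicator {a<..<b} s" for s
      using m(2)[of s] \<open>a < b\<close> by (auto simp: k_def indicator_def)
  qed (rule ki)
  also have "\<dots> = (b - a) * I - I * (b - a)"
    using m ii \<open>a < b\<close> by (subst Bochner_Integration.integral_diff) (auto simp: I_def)
  finally have "integral\<^sup>L lborel k \<le> 0" by simp
  moreover have k0: "AE s in lborel. 0 \<le> k s"
    using P by eventually_elim (use big in \<open>fastforce simp: k_def indicator_def\<close>)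
  ultimately have "integral\<^sup>L lborel k = 0" using integral_nonneg_AE[OF k0] by simp
  then have "AE s in lborel. k s = 0" using integral_nonneg_eq_0_iff_AE[OF ki k0] by simp
  with P have "AE s in lborel. s \<notin> {a<..<b}"
    by eventually_elim (use big in \<open>fastforce simp: k_def indicator_def\<close>)
  then have "emeasure lborel {a<..<b} = 0" by (subst (asm) AE_iff_measurable[where N="{a<..<b}"]) auto
  then show False using \<open>a < b\<close> by simp
qed

lemma norm_integral_le_lborel:
  fixes h :: "real \<Rightarrow> complex"
  assumes "continuous_on {a..b} h" "integrable lborel u" "\<And>x. 0 \<le> u x" "\<And>x. x \<in> {a..b} \<Longrightarrow> cmod (h x) \<le> u x"
  shows "cmod (integral {a..b} h) \<le> integral\<^sup>L lborel u"
proof -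
  note u = integrable_on_lborel[OF assms(2)]
  have u': "u integrable_on {a..b}" using integrable_on_subcbox[OF u, of a b] by simp
  have "cmod (integral {a..b} h) \<le> integral {a..b} u"
    by (rule Henstock_Kurzweil_Integration.integral_norm_bound_integral[OF integrable_continuous_interval[OF assms(1)] u' assms(4)])
  also have "\<dots> \<le> integral UNIV u" by (rule integral_subset_le[OF _ u' u]) (use assms in auto)
  finally show ?thesis using integral_lborel[OF assms(2)] by simp
qed

lemma contour_integral_linepath_same_Im:
  assumes "a < b"
  shows "contour_integral (linepath (Complex a c) (Complex b c)) h = integral {a..b} (\<lambda>x. h (Complex x c))"
proof -
  have "contour_integral (linepath (Complex a c) (Complex b c)) h =
        contour_integral (linepath (of_real a) (of_real b)) (\<lambda>z. h (z + \<i> * c))"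
    by (simp add: contour_integral_integral linepath_def Complex_eq scaleR_conv_of_real algebra_simps)
  also have "\<dots> = integral {a..b} (\<lambda>x. h (of_real x + \<i> * c))"
    using assms by (subst contour_integral_linepath_Reals_eq) auto
  finally show ?thesis by (simp add: Complex_eq)
qed

lemma contour_integral_rectpath:
  assumes "a < b" "c < d" and h: "continuous_on (path_image (rectpath (Complex a c) (Complex b d))) h"
  shows "contour_integral (rectpath (Complex a c) (Complex b d)) h =
    integral {a..b} (\<lambda>x. h (Complex x c)) + \<i> * integral {c..d} (\<lambda>y. h (Complex b y))
    - integral {a..b} (\<lambda>x. h (Complex x d)) - \<i> * integral {c..d} (\<lambda>y. h (Complex a y))"
proof -
  let ?P = "rectpath (Complex a c) (Complex b d)"
  have im: "path_image ?P =
     closed_segment (Complex a c) (Complex b c) \<union> closed_segment (Complex b c) (Complex b d) \<union>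
     closed_segment (Complex b d) (Complex a d) \<union> closed_segment (Complex a d) (Complex a c)"
    by (simp add: rectpath_def Let_def path_image_join Un_assoc)
  have ci: "h contour_integrable_on linepath (Complex a c) (Complex b c)"
    "h contour_integrable_on linepath (Complex b c) (Complex b d)"
    "h contour_integrable_on linepath (Complex b d) (Complex a d)"
    "h contour_integrable_on linepath (Complex a d) (Complex a c)"
    by (rule contour_integrable_continuous_linepath, rule continuous_on_subset[OF h], unfold im, blast)+
  have "contour_integral ?P h =
     contour_integral (linepath (Complex a c) (Complex b c)) h + contour_integral (linepath (Complex b c) (Complex b d)) h +
     contour_integral (linepath (Complex b d) (Complex a d)) h + contour_integral (linepath (Complex a d) (Complex a c)) h"
    using ci by (simp add: rectpath_def Let_def)
  also have "contour_integral (linepath (Complex b d) (Complex a d)) h = - contour_integral (linepath (Complex a d) (Complex b d)) h"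
    using contour_integral_reversepath[of "linepath (Complex a d) (Complex b d)" h] by simp
  also have "contour_integral (linepath (Complex a d) (Complex a c)) h = - contour_integral (linepath (Complex a c) (Complex a d)) h"
    using contour_integral_reversepath[of "linepath (Complex a c) (Complex a d)" h] by simp
  finally show ?thesis using assms
    by (simp add: contour_integral_linepath_same_Im contour_integral_linepath_same_Re[where a=c and b=d])
qed

lemma continuous_on_rectpath_sides:
  assumes "a < b" "c < d" and h: "continuous_on (path_image (rectpath (Complex a c) (Complex b d))) h"
  shows "continuous_on {a..b} (\<lambda>x. h (Complex x c))" "continuous_on {a..b} (\<lambda>x. h (Complex x d))"
    "continuous_on {c..d} (\<lambda>y. h (Complex a y))" "continuous_on {c..d} (\<lambda>y. h (Complex b y))"
  using assms
  by (auto intro!: continuous_on_compose2[OF h] continuous_intros simp: path_image_rectpath Complex_eq)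

text \<open>The left side is kept apart since in the reproducing formula it is the only one that survives.\<close>

lemma rectpath_integral_bound:
  assumes ab: "a < b" "c < d" and h: "continuous_on (path_image (rectpath (Complex a c) (Complex b d))) h"
    and u: "integrable lborel u1" "integrable lborel u2" "integrable lborel u3"
      "\<And>x. 0 \<le> u1 x" "\<And>x. 0 \<le> u2 x" "\<And>x. 0 \<le> u3 x"
    and le: "\<And>x. x \<in> {a..b} \<Longrightarrow> cmod (h (Complex x c)) \<le> u1 x"
      "\<And>y. y \<in> {c..d} \<Longrightarrow> cmod (h (Complex b y)) \<le> u2 y"
      "\<And>x. x \<in> {a..b} \<Longrightarrow> cmod (h (Complex x d)) \<le> u3 x"
  shows "cmod (contour_integral (rectpath (Complex a c) (Complex b d)) h + \<i> * integral {c..d} (\<lambda>y. h (Complex a y)))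
     \<le> integral\<^sup>L lborel u1 + integral\<^sup>L lborel u2 + integral\<^sup>L lborel u3"
proof -
  let ?P = "rectpath (Complex a c) (Complex b d)"
  note cont = continuous_on_rectpath_sides[OF ab h]
  have "contour_integral ?P h + \<i> * integral {c..d} (\<lambda>y. h (Complex a y)) =
     integral {a..b} (\<lambda>x. h (Complex x c)) + \<i> * integral {c..d} (\<lambda>y. h (Complex b y)) - integral {a..b} (\<lambda>x. h (Complex x d))"
    by (simp add: contour_integral_rectpath[OF ab h])
  also have "cmod \<dots> \<le> cmod (integral {a..b} (\<lambda>x. h (Complex x c))) + cmod (integral {c..d} (\<lambda>y. h (Complex b y)))
     + cmod (integral {a..b} (\<lambda>x. h (Complex x d)))"
    by (rule order_trans[OF norm_triangle_ineq4]) (auto intro!: order_trans[OF norm_triangle_ineq] simp: norm_mult)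
  also have "\<dots> \<le> integral\<^sup>L lborel u1 + integral\<^sup>L lborel u2 + integral\<^sup>L lborel u3"
    by (intro add_mono norm_integral_le_lborel cont u le)
  finally show ?thesis .
qed

text \<open>Used with order n for the inner integral of the reproducing formula, and with order 0 as
  Cauchy's formula for f'.\<close>

lemma residue_rectpath:
  assumes "open S" "connected S" "g holomorphic_on S" "cbox (Complex a c) (Complex b d) \<subseteq> S"
    "p \<in> box (Complex a c) (Complex b d)"
  shows "contour_integral (rectpath (Complex a c) (Complex b d)) (\<lambda>z. g z / (z - p) ^ Suc n) =
    2 * pi * \<i> * (deriv ^^ n) g p / fact n"
proof -
  let ?P = "rectpath (Complex a c) (Complex b d)"
  have ab: "a < b" "c < d" using assms(5) by (auto simp: in_box_complex_iff)
  have im: "path_image ?P = cbox (Complex a c) (Complex b d) - box (Complex a c) (Complex b d)"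
    using ab by (intro path_image_rectpath_cbox_minus_box) auto
  have pS: "p \<in> S" using assms(4,5) box_subset_cbox by blast
  have "contour_integral ?P (\<lambda>z. g z / (z - p) ^ Suc n) =
    2 * pi * \<i> * (\<Sum>q\<in>{p}. winding_number ?P q * residue (\<lambda>z. g z / (z - p) ^ Suc n) q)"
  proof (rule Residue_theorem[of S])
    show "(\<lambda>z. g z / (z - p) ^ Suc n) holomorphic_on S - {p}"
      by (intro holomorphic_intros holomorphic_on_subset[OF assms(3)]) auto
    show "path_image ?P \<subseteq> S - {p}" using im assms(4,5) by auto
    show "\<forall>z. z \<notin> S \<longrightarrow> winding_number ?P z = 0"
      using assms(4) ab by (auto intro!: winding_number_rectpath_outside)
  qed (use assms in auto)
  also have "\<dots> = 2 * pi * \<i> * residue (\<lambda>z. g z / (z - p) ^ Suc n) p"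
    using winding_number_rectpath[OF assms(5)] by simp
  also have "residue (\<lambda>z. g z / (z - p) ^ Suc n) p = (deriv ^^ n) g p / fact n"
    by (rule residue_holomorphic_over_power[OF assms(1) pS assms(3)])
  finally show ?thesis by simp
qed

section \<open>The reproducing formula\<close>

lemma open_halfplane: "open {z. 0 < Re z}" by (rule open_halfspace_Re_gt)

lemma measurable_cont_halfplane:
  fixes h :: "real \<times> real \<Rightarrow> real"
  assumes "continuous_on {p. 0 < fst p} h"
  shows "(\<lambda>p. if 0 < fst p then h p else 0) \<in> borel_measurable (lborel \<Otimes>\<^sub>M lborel)"
proof -
  have "(\<lambda>p. if p \<in> {p. 0 < fst p} then h p else 0) \<in> borel_measurable borel"
    by (intro borel_measurable_continuous_on_if assms continuous_on_const)
       (auto intro!: borel_open open_Collect_less continuous_intros)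
  then show ?thesis by (subst lborel_prod) simp
qed

lemma connected_halfplane: "connected {z. 0 < Re z}"
  by (intro convex_connected convex_halfspace_Re_gt)

lemma row_integral:
  assumes "integrable (lborel \<Otimes>\<^sub>M lborel) (v :: real \<times> real \<Rightarrow> real)"
  shows "AE s in lborel. integrable lborel (\<lambda>x. v (x, s))"
    and "integrable lborel (\<lambda>s. \<integral>x. v (x, s) \<partial>lborel)"
    and "(\<integral>s. (\<integral>x. v (x, s) \<partial>lborel) \<partial>lborel) = integral\<^sup>L (lborel \<Otimes>\<^sub>M lborel) v"
  using lborel_pair.AE_integrable_snd[of "\<lambda>x y. v (x, y)"] lborel_pair.integrable_snd[of "\<lambda>x y. v (x, y)"]
    lborel_pair.integral_snd[of "\<lambda>x y. v (x, y)"] assms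
  by (auto simp: case_prod_unfold)

text \<open>The constant depends on the opening k of the cone alone, so poles at points of one cone
  running to 0 or to infinity share a majorant.\<close>

lemma norm_le_norm_add:
  assumes "0 < k" "k * cmod \<mu> \<le> Re \<mu>" "0 \<le> Re z"
  shows "cmod z \<le> (1 + 1 / k) * cmod (\<mu> + z)"
proof -
  have "k * cmod \<mu> \<le> cmod (\<mu> + z)" using assms complex_Re_le_cmod[of "\<mu> + z"] by simp
  then have "cmod \<mu> \<le> cmod (\<mu> + z) / k" using assms(1) by (simp add: field_simps)
  moreover have "cmod z \<le> cmod (\<mu> + z) + cmod \<mu>" using norm_triangle_ineq4[of "\<mu> + z" \<mu>] by simp
  ultimately show ?thesis by (simp add: algebra_simps)
qed

lemma integral_symmetric_limit:
  fixes h :: "real \<Rightarrow> 'b::banach"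
  assumes "h integrable_on UNIV" "0 < e"
  obtains B where "\<And>T. B < T \<Longrightarrow> norm (integral {-T..T} h - integral UNIV h) < e"
proof -
  obtain B where B: "B > 0" "\<And>a b. ball 0 B \<subseteq> cbox a b \<Longrightarrow> norm (integral (cbox a b) h - integral UNIV h) < e"
    using integrable_integral[OF assms(1)] assms(2) unfolding has_integral_alt'[of h] by auto
  show ?thesis
    by (rule that[of B]) (use B in \<open>auto simp: subset_iff dist_norm intro!: B(2)[of "-T" T for T, unfolded cbox_interval]\<close>)
qed

lemma integrable_affine_comp:
  fixes m :: "real \<Rightarrow> real"
  assumes "integrable lborel m" "\<bar>c\<bar> = 1"
  shows "integrable lborel (\<lambda>s. m (t + c * s))" "(\<integral>s. m (t + c * s) \<partial>lborel) = integral\<^sup>L lborel m"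
  using assms lborel_integrable_real_affine[of m c t] lborel_integral_real_affine[of c m t]
  by (auto simp: abs_if split: if_splits)

lemma AE_affine_comp:
  assumes "AE s in lborel. P (s::real)" "c \<noteq> 0"
  shows "AE s in lborel. P (t + c * s)"
proof -
  from assms(1) obtain N where N: "{s \<in> space lborel. \<not> P s} \<subseteq> N" "emeasure lborel N = 0" "N \<in> sets lborel" by (rule AE_E)
  have "(\<integral>\<^sup>+ s. indicator N s \<partial>lborel) = \<bar>c\<bar> * (\<integral>\<^sup>+ s. indicator N (t + c * s) \<partial>lborel)"
    by (rule nn_integral_real_affine[OF _ assms(2)]) (use N in simp)
  then have "(\<integral>\<^sup>+ s. indicator N (t + c * s) \<partial>lborel) = 0" using N assms(2) by simp
  then have "AE s in lborel. indicator N (t + c * s) = (0::ennreal)"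
    by (subst (asm) nn_integral_0_iff_AE) (use N in measurable)
  then show ?thesis by eventually_elim (use N in \<open>auto simp: indicator_def split: if_splits\<close>)
qed

lemma Complex_cnj_norm: "cmod (Complex a (- b)) = cmod (Complex a b)"
  by (simp add: cmod_def)

section \<open>Functions of class \<open>Dclass (real n)\<close> and integration against their
  kernels\<close>

locale D_fun =
  fixes f :: "complex \<Rightarrow> complex" and n :: nat
  assumes f_D: "f \<in> Dclass (real n)"
begin

abbreviation g :: "complex \<Rightarrow> complex" where "g \<equiv> deriv f"

text \<open>The integrand of the condition defining \<open>Dclass (real n)\<close>, as a function on
  the plane; up to constants it is the majorant of all kernels below.\<close>

definition w :: "real \<times> real \<Rightarrow> real" where
  "w p = (if 0 < fst p then fst p ^ n * cmod (g (Complex (fst p) (snd p))) / cmod (Complex (fst p) (snd p)) ^ Suc n else 0)"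

lemma hol_f: "f holomorphic_on {z. 0 < Re z}" using f_D by (simp add: Dclass_def)

lemma hol_g: "g holomorphic_on {z. 0 < Re z}" by (intro holomorphic_deriv hol_f open_halfplane)

lemma cont_g: "continuous_on {p. 0 < fst p} (\<lambda>p. g (Complex (fst p) (snd p)))"
  by (rule continuous_on_compose2[OF holomorphic_on_imp_continuous_on[OF hol_g], of _ "\<lambda>p. Complex (fst p) (snd p)"])
     (auto simp: Complex_eq intro!: continuous_intros)

lemma w_nonneg: "0 \<le> w p" by (simp add: w_def)

lemma w_zero: "\<alpha> \<le> 0 \<Longrightarrow> w (\<alpha>, \<beta>) = 0" by (simp add: w_def)

lemma w_measurable: "w \<in> borel_measurable (lborel \<Otimes>\<^sub>M lborel)"
proof -
  have "continuous_on {p. 0 < fst p} (\<lambda>p. fst p ^ n * cmod (g (Complex (fst p) (snd p))) / cmod (Complex (fst p) (snd p)) ^ Suc n)"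
    by (intro continuous_intros cont_g) (auto simp: Complex_eq complex_eq_iff intro!: continuous_intros)
  from measurable_cont_halfplane[OF this] show ?thesis by (simp add: w_def[abs_def])
qed

lemma w_int: "integrable (lborel \<Otimes>\<^sub>M lborel) w"
proof (rule integrableI_nonneg)
  have *: "ennreal (w (\<alpha>, \<beta>)) = ennreal (\<alpha> powr real n * cmod (g (Complex \<alpha> \<beta>)) / (\<alpha>\<^sup>2 + \<beta>\<^sup>2) powr ((real n + 1) / 2))
      * indicator {0<..} \<alpha>" for \<alpha> \<beta>
  proof (cases "\<alpha> > 0")
    case True
    have "(\<alpha>\<^sup>2 + \<beta>\<^sup>2) powr ((real n + 1) / 2) = cmod (Complex \<alpha> \<beta>) ^ Suc n"
    proof -
      have pos: "\<alpha>\<^sup>2 + \<beta>\<^sup>2 > 0" using True by (simp add: add_pos_nonneg)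
      have "cmod (Complex \<alpha> \<beta>) ^ Suc n = ((\<alpha>\<^sup>2 + \<beta>\<^sup>2) powr (1/2)) powr real (Suc n)"
        using pos by (subst powr_realpow) (auto simp: cmod_def powr_half_sqrt)
      then show ?thesis by (simp add: powr_powr add.commute)
    qed
    then show ?thesis using True by (simp add: w_def powr_realpow)
  qed (simp add: w_def)
  have "(\<integral>\<^sup>+ p. ennreal (w p) \<partial>(lborel \<Otimes>\<^sub>M lborel)) = (\<integral>\<^sup>+ \<alpha>. \<integral>\<^sup>+ \<beta>. ennreal (w (\<alpha>, \<beta>)) \<partial>lborel \<partial>lborel)"
    by (rule lborel.nn_integral_fst[symmetric]) (use w_measurable in measurable)
  also have "\<dots> = (\<integral>\<^sup>+ \<alpha>. (\<integral>\<^sup>+ \<beta>. ennreal (\<alpha> powr real n * cmod (g (Complex \<alpha> \<beta>)) / (\<alpha>\<^sup>2 + \<beta>\<^sup>2) powr ((real n + 1) / 2)) \<partial>lborel)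
      * indicator {0<..} \<alpha> \<partial>lborel)"
    unfolding * by (intro nn_integral_cong) (auto simp: indicator_def)
  also have "\<dots> < \<infinity>" using f_D by (simp add: Dclass_def)
  finally show "(\<integral>\<^sup>+ p. ennreal (w p) \<partial>(lborel \<Otimes>\<^sub>M lborel)) < \<infinity>" .
qed (auto simp: w_nonneg w_measurable)

definition ker :: "(complex \<Rightarrow> 'b::complex_banach) \<Rightarrow> real \<Rightarrow> real \<Rightarrow> 'b" where
  "ker L \<alpha> \<beta> = (complex_of_real (\<alpha> ^ n) * g (Complex \<alpha> \<beta>)) *\<^sub>C L (Complex \<alpha> (- \<beta>))"

text \<open>The integral of the calculus with L(z) in place of (A + z)^-(n+1). The conjugate
  argument is built into \<open>ker\<close>, so that \<open>L\<close> is a function on the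
  half-plane.\<close>

definition dint :: "(complex \<Rightarrow> 'b::complex_banach) \<Rightarrow> 'b" where
  "dint L = integral {0<..} (\<lambda>\<alpha>. integral UNIV (ker L \<alpha>))"

text \<open>Exactly the decay that makes c times \<open>w\<close> a majorant of the kernel.\<close>

definition admissible :: "real \<Rightarrow> (complex \<Rightarrow> 'b::complex_banach) \<Rightarrow> bool" where
  "admissible c L \<longleftrightarrow> continuous_on {z. 0 < Re z} L \<and> (\<forall>z. 0 < Re z \<longrightarrow> norm (L z) \<le> c / cmod z ^ Suc n)"

lemma admissible_mono: "admissible c L \<Longrightarrow> c \<le> d \<Longrightarrow> admissible d L"
  unfolding admissible_def by (meson divide_right_mono norm_ge_zero order_trans zero_le_power)

lemma admissible_nonneg: "admissible c L \<Longrightarrow> 0 \<le> c"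
  unfolding admissible_def by (auto dest!: spec[of _ 1] intro: order_trans[OF norm_ge_zero])

lemma ker_continuous:
  assumes "continuous_on {z. 0 < Re z} L"
  shows "continuous_on {p. 0 < fst p} (\<lambda>p. ker L (fst p) (snd p))"
  unfolding ker_def
  by (intro continuous_intros cont_g continuous_on_compose2[OF assms, of _ "\<lambda>p. Complex (fst p) (- snd p)"])
     (auto simp: Complex_eq intro!: continuous_intros)

lemma ker_le:
  assumes "admissible c L" "0 < \<alpha>"
  shows "norm (ker L \<alpha> \<beta>) \<le> c * w (\<alpha>, \<beta>)"
proof -
  have "norm (L (Complex \<alpha> (- \<beta>))) \<le> c / cmod (Complex \<alpha> \<beta>) ^ Suc n"
    using assms unfolding admissible_def by (metis Complex_cnj_norm complex.sel(1))
  then have "\<alpha> ^ n * cmod (g (Complex \<alpha> \<beta>)) * norm (L (Complex \<alpha> (- \<beta>))) \<le>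
      \<alpha> ^ n * cmod (g (Complex \<alpha> \<beta>)) * (c / cmod (Complex \<alpha> \<beta>) ^ Suc n)"
    using assms(2) by (intro mult_left_mono) auto
  then show ?thesis using assms(2) by (simp add: ker_def w_def norm_scaleC norm_mult norm_power mult_ac)
qed

lemma dominated_kernel_ker:
  assumes "admissible c L"
  shows "dominated_kernel (ker L) (\<lambda>p. c * w p)"
proof
  have "continuous_on {p. 0 < fst p} (\<lambda>p. ker L (fst p) (snd p))"
    using assms by (intro ker_continuous) (simp add: admissible_def)
  then show "continuous_on ({0<..} \<times> UNIV) (\<lambda>(\<alpha>, \<beta>). ker L \<alpha> \<beta>)"
    by (rule continuous_on_cong[THEN iffD1, rotated 2]) auto
qed (use assms w_int admissible_nonneg[OF assms] in \<open>auto simp: w_nonneg w_zero ker_le\<close>)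

lemma dint_diff:
  assumes "admissible c L1" "admissible c L2"
  shows "dint (\<lambda>z. L1 z - L2 z) = dint L1 - dint L2"
proof -
  interpret K1: dominated_kernel "ker L1" "\<lambda>p. c * w p" by (rule dominated_kernel_ker[OF assms(1)])
  interpret K2: dominated_kernel "ker L2" "\<lambda>p. c * w p" by (rule dominated_kernel_ker[OF assms(2)])
  have kd: "ker (\<lambda>z. L1 z - L2 z) \<alpha> = (\<lambda>\<beta>. ker L1 \<alpha> \<beta> - ker L2 \<alpha> \<beta>)" for \<alpha>
    by (auto simp: ker_def scaleC_diff_right)
  have "dint (\<lambda>z. L1 z - L2 z) = integral {0<..} (\<lambda>\<alpha>. integral UNIV (ker L1 \<alpha>) - integral UNIV (ker L2 \<alpha>))"
    unfolding dint_def
  proof (rule integral_spike[OF negligible_bad_lines[OF K1.v_int]])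
    fix \<alpha> assume "\<alpha> \<in> {0<..} - bad_lines (\<lambda>p. c * w p)"
    then show "integral UNIV (ker L1 \<alpha>) - integral UNIV (ker L2 \<alpha>) = integral UNIV (ker (\<lambda>z. L1 z - L2 z) \<alpha>)"
      unfolding kd by (intro Henstock_Kurzweil_Integration.integral_diff[symmetric] K1.inner_integrable K2.inner_integrable) auto
  qed
  also have "\<dots> = dint L1 - dint L2" unfolding dint_def
    by (rule Henstock_Kurzweil_Integration.integral_diff[OF K1.iterated_integrable K2.iterated_integrable])
  finally show ?thesis .
qed

lemma dint_linear:
  assumes T: "bounded_linear T" "\<And>a x. T (a *\<^sub>C x) = a *\<^sub>C T x" and L: "admissible c L"
  shows "dint (\<lambda>z. T (L z)) = T (dint L)"
proof -
  interpret K: dominated_kernel "ker L" "\<lambda>p. c * w p" by (rule dominated_kernel_ker[OF L])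
  have kT: "ker (\<lambda>z. T (L z)) \<alpha> = T \<circ> ker L \<alpha>" for \<alpha> by (auto simp: ker_def T)
  have "T (dint L) = integral {0<..} (T \<circ> (\<lambda>\<alpha>. integral UNIV (ker L \<alpha>)))"
    unfolding dint_def by (rule integral_linear[OF K.iterated_integrable T(1), symmetric])
  also have "\<dots> = dint (\<lambda>z. T (L z))" unfolding dint_def
  proof (rule integral_spike[OF negligible_bad_lines[OF K.v_int]])
    fix \<alpha> assume "\<alpha> \<in> {0<..} - bad_lines (\<lambda>p. c * w p)"
    then show "integral UNIV (ker (\<lambda>z. T (L z)) \<alpha>) = (T \<circ> (\<lambda>\<alpha>. integral UNIV (ker L \<alpha>))) \<alpha>"
      unfolding kT by (subst integral_linear[OF _ T(1)]) (auto intro: K.inner_integrable)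
  qed
  finally show ?thesis by simp
qed

lemma dint_dominated:
  fixes L :: "nat \<Rightarrow> complex \<Rightarrow> 'b::complex_banach"
  assumes L: "\<And>j. admissible c (L j)" and lim: "\<And>z. 0 < Re z \<Longrightarrow> (\<lambda>j. L j z) \<longlonglongrightarrow> 0"
  shows "(\<lambda>j. dint (L j)) \<longlonglongrightarrow> 0"
proof -
  let ?LL = "lborel \<Otimes>\<^sub>M lborel :: (real \<times> real) measure"
  \<comment> \<open>The norm of the kernel is itself a majorant, so \<open>norm_iterated_le\<close>
    bounds \<open>dint (L j)\<close> by a real double integral, to which Lebesgue's theorem
    applies.\<close>
  define v where "v = (\<lambda>j p. if 0 < fst p then norm (ker (L j) (fst p) (snd p)) else 0)"
  have v_meas: "v j \<in> borel_measurable ?LL" for j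
    unfolding v_def using L by (intro measurable_cont_halfplane continuous_on_norm ker_continuous) (simp add: admissible_def)
  have cw: "integrable ?LL (\<lambda>p. c * w p)" using w_int by simp
  have c: "0 \<le> c" using admissible_nonneg[OF L] .
  have v_le: "0 \<le> v j p" "v j p \<le> c * w p" for j p
    using ker_le[OF L[of j], of "fst p" "snd p"] c by (auto simp: v_def w_def)
  have v_int: "integrable ?LL (v j)" for j
    by (rule Bochner_Integration.integrable_bound[OF cw v_meas]) (use v_le c in \<open>auto simp: w_nonneg\<close>)
  have le: "norm (dint (L j)) \<le> integral\<^sup>L ?LL (v j)" for j
  proof -
    interpret K: dominated_kernel "ker (L j)" "\<lambda>p. c * w p" by (rule dominated_kernel_ker[OF L])
    interpret dominated_kernel "ker (L j)" "v j"
      by standard (use K.contK v_int v_le in \<open>auto simp: v_def\<close>)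
    show ?thesis unfolding dint_def by (rule norm_iterated_le)
  qed
  have "(\<lambda>j. integral\<^sup>L ?LL (v j)) \<longlonglongrightarrow> integral\<^sup>L ?LL (\<lambda>p::real\<times>real. 0::real)"
  proof (rule integral_dominated_convergence[OF _ v_meas cw])
    show "AE p in ?LL. (\<lambda>j. v j p) \<longlonglongrightarrow> 0"
    proof (rule AE_I2)
      fix p :: "real \<times> real"
      show "(\<lambda>j. v j p) \<longlonglongrightarrow> 0"
      proof (cases "0 < fst p")
        case True
        then have "(\<lambda>j. norm (ker (L j) (fst p) (snd p))) \<longlonglongrightarrow>
           norm ((complex_of_real (fst p ^ n) * g (Complex (fst p) (snd p))) *\<^sub>C (0::'b))"
          unfolding ker_def by (intro tendsto_intros lim) simp
        then show ?thesis using True by (simp add: v_def)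
      qed (simp add: v_def)
    qed
  qed (use v_le in auto)
  then have "(\<lambda>j. integral\<^sup>L ?LL (v j)) \<longlonglongrightarrow> 0" by simp
  then show ?thesis by (rule Lim_null_comparison[rotated]) (simp add: le)
qed

end

text \<open>Obtained by integrating \<open>z\<^sup>m f\<^sup>(\<^sup>m\<^sup>+\<^sup>1\<^sup>)(\<mu> + z)\<close> by parts \<open>m\<close> times.\<close>

primrec parts_antideriv :: "(complex \<Rightarrow> complex) \<Rightarrow> complex \<Rightarrow> nat \<Rightarrow> complex \<Rightarrow> complex" where
  "parts_antideriv f \<mu> 0 z = f (\<mu> + z)"
| "parts_antideriv f \<mu> (Suc m) z =
     z ^ Suc m * (deriv ^^ Suc m) f (\<mu> + z) - of_nat (Suc m) * parts_antideriv f \<mu> m z"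

lemma parts_antideriv_0: "parts_antideriv f \<mu> m 0 = (-1) ^ m * fact m * f \<mu>"
  by (induction m) auto

lemma parts_antideriv_deriv:
  assumes "open S" "f holomorphic_on S" "\<mu> + z \<in> S"
  shows "(parts_antideriv f \<mu> m has_field_derivative z ^ m * (deriv ^^ Suc m) f (\<mu> + z)) (at z)"
proof (induction m)
  have D: "((\<lambda>z. (deriv ^^ k) f (\<mu> + z)) has_field_derivative (deriv ^^ Suc k) f (\<mu> + z)) (at z)" for k
  proof -
    have "((deriv ^^ k) f has_field_derivative deriv ((deriv ^^ k) f) (\<mu> + z)) (at (\<mu> + z))"
      using holomorphic_higher_deriv[OF assms(2,1)] assms(1,3) by (metis holomorphic_derivI)
    then show ?thesis using DERIV_shift[of "(deriv ^^ k) f" _ z \<mu>] by (simp add: add.commute)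
  qed
  {
    case 0
    show ?case using D[of 0] by (simp add: fun_eq_iff[of "parts_antideriv f \<mu> 0" "\<lambda>z. f (\<mu> + z)", THEN iffD2] )
  next
    case (Suc m)
    have pw: "((\<lambda>z. z ^ Suc m) has_field_derivative of_nat (Suc m) * z ^ m) (at z)"
      using DERIV_power_Suc[OF DERIV_ident[of "at z"], of m] by simp
    have "((\<lambda>z. z ^ Suc m * (deriv ^^ Suc m) f (\<mu> + z) - of_nat (Suc m) * parts_antideriv f \<mu> m z) has_field_derivative
       (of_nat (Suc m) * z ^ m * (deriv ^^ Suc m) f (\<mu> + z) + (deriv ^^ Suc (Suc m)) f (\<mu> + z) * z ^ Suc m)
        - of_nat (Suc m) * (z ^ m * (deriv ^^ Suc m) f (\<mu> + z))) (at z)"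
      by (intro DERIV_diff DERIV_mult DERIV_cmult Suc D pw)
    then show ?case by (simp add: fun_eq_iff[of "parts_antideriv f \<mu> (Suc m)", THEN iffD2] algebra_simps)
  }
qed

lemma sector_Re:
  assumes "z \<in> sector \<psi>" "\<psi> \<le> pi"
  shows "cos \<psi> * cmod z \<le> Re z"
proof -
  have nz: "z \<noteq> 0" and A: "\<bar>Arg z\<bar> < \<psi>" using assms by (auto simp: sector_def)
  have "Re z = Re (of_real (cmod z) * exp (\<i> * of_real (Arg z)))" using Arg_eq[OF nz] by (rule arg_cong)
  also have "\<dots> = cmod z * cos (Arg z)" by (simp add: Re_exp)
  also have "cos (Arg z) = cos \<bar>Arg z\<bar>" by simp
  also have "cmod z * cos \<psi> \<le> cmod z * cos \<bar>Arg z\<bar>"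
    using A assms by (intro mult_left_mono cos_monotone_0_pi_le) auto
  finally show ?thesis by (simp add: mult.commute)
qed

lemma of_real_in_sector: "0 < \<psi> \<Longrightarrow> 0 < t \<Longrightarrow> complex_of_real t \<in> sector \<psi>"
  by (simp add: sector_def Arg_of_real)

text \<open>Leads from limits along sequences, the form in which \<open>dint_dominated\<close>
  supplies them, to the filter in \<open>f_infty\<close>.\<close>

lemma tendsto_at_infinity_sequentially:
  fixes F :: "complex \<Rightarrow> complex"
  assumes "\<And>X. (\<And>j. X j \<in> S) \<Longrightarrow> filterlim X at_infinity sequentially \<Longrightarrow> (\<lambda>j. F (X j)) \<longlonglongrightarrow> l"
  shows "(F \<longlongrightarrow> l) (inf at_infinity (principal S))"
proof (rule tendstoI, rule ccontr)
  fix e :: real assume "e > 0" and no: "\<not> (\<forall>\<^sub>F x in inf at_infinity (principal S). dist (F x) l < e)"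
  then have "\<forall>j::nat. \<exists>x. real j \<le> norm x \<and> x \<in> S \<and> \<not> dist (F x) l < e"
    unfolding eventually_inf_principal eventually_at_infinity by blast
  then obtain X where X: "\<And>j::nat. real j \<le> norm (X j)" "\<And>j. X j \<in> S" "\<And>j. \<not> dist (F (X j)) l < e" by metis
  have "filterlim X at_infinity sequentially"
    by (rule filterlim_at_infinity_conv_norm_at_top[THEN iffD2], rule filterlim_at_top_mono[OF filterlim_real_sequentially])
       (simp add: X)
  from assms[OF X(2) this] have "\<forall>\<^sub>F j in sequentially. dist (F (X j)) l < e" using \<open>e > 0\<close> by (rule tendstoD)
  then show False using X(3) by (auto simp: eventually_sequentially)
qed

section \<open>Residues, integration by parts and limits along horizontal rays\<close>

context D_fun
begin

text \<open>The hypotheses also admit \<mu> = 0, with any k > 0; this case represents f(0).\<close>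

lemma admissible_pole:
  assumes "0 < k" "k * cmod \<mu> \<le> Re \<mu>"
  shows "admissible ((1 + 1 / k) ^ Suc n) (\<lambda>z. 1 / (\<mu> + z) ^ Suc n)"
proof -
  have "0 \<le> k * cmod \<mu>" using assms(1) by simp
  then have Re: "0 \<le> Re \<mu>" using assms(2) by linarith
  have nz: "\<mu> + z \<noteq> 0" if "0 < Re z" for z using Re that by (auto simp: complex_eq_iff)
  have "cmod (1 / (\<mu> + z) ^ Suc n) \<le> (1 + 1 / k) ^ Suc n / cmod z ^ Suc n" if z: "0 < Re z" for z
  proof -
    have "cmod z ^ Suc n \<le> ((1 + 1 / k) * cmod (\<mu> + z)) ^ Suc n"
      using norm_le_norm_add[OF assms, of z] z by (intro power_mono) auto
    moreover have "cmod z > 0" "cmod (\<mu> + z) > 0" using z nz[OF z] by auto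
    ultimately show ?thesis by (simp add: norm_divide norm_power power_mult_distrib divide_simps del: power_Suc)
  qed
  moreover have "continuous_on {z. 0 < Re z} (\<lambda>z. 1 / (\<mu> + z) ^ Suc n)"
    by (intro continuous_intros) (use nz in auto)
  ultimately show ?thesis by (auto simp: admissible_def)
qed

lemma AE_good_col: "AE s in lborel. integrable lborel (\<lambda>\<beta>. w (s, \<beta>))"
  using lborel_pair.AE_integrable_fst'[OF w_int] .

text \<open>On the line Re z = \<alpha> the conjugate of z is 2 \<alpha> - z, and \<mu> plus this is
  -(z - p) with p = \<mu> + 2 \<alpha>. The integrand thus extends holomorphically apart from a pole
  of order n + 1 to the right of the line. Closing the contour on that side leaves the residue,
  provided the other three sides of some rectangle contribute arbitrarily little.\<close>

lemma inner_integral: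
  assumes \<alpha>: "0 < \<alpha>" and \<mu>: "0 < Re \<mu>" and adm: "admissible c (\<lambda>z. 1 / (\<mu> + z) ^ Suc n)"
    and good: "\<alpha> \<notin> bad_lines (\<lambda>p. c * w p)"
  shows "integral UNIV (ker (\<lambda>z. 1 / (\<mu> + z) ^ Suc n) \<alpha>) =
    2 * pi * (-1) ^ n * \<alpha> ^ n * (deriv ^^ n) g (\<mu> + 2 * \<alpha>) / fact n"
proof -
  let ?L = "\<lambda>z. 1 / (\<mu> + z) ^ Suc n"
  interpret K: dominated_kernel "ker ?L" "\<lambda>p. c * w p" by (rule dominated_kernel_ker[OF adm])
  define p where "p = \<mu> + 2 * \<alpha>"
  define h where "h = (\<lambda>z. g z / (z - p) ^ Suc n)"
  define s :: complex where "s = of_real (\<alpha> ^ n) * (-1) ^ Suc n"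
  define S where "S = 2 * pi * \<i> * (deriv ^^ n) g p / fact n"
  have Rep: "Re p > \<alpha>" using \<alpha> \<mu> by (simp add: p_def)
  have s0: "s \<noteq> 0" using \<alpha> by (simp add: s_def)
  have ker_h: "ker ?L \<alpha> \<beta> = s * h (Complex \<alpha> \<beta>)" for \<beta>
  proof -
    have "\<mu> + Complex \<alpha> (- \<beta>) = - (Complex \<alpha> \<beta> - p)" by (simp add: p_def complex_eq_iff)
    then have "(\<mu> + Complex \<alpha> (- \<beta>)) ^ Suc n = (-1) ^ Suc n * (Complex \<alpha> \<beta> - p) ^ Suc n"
      by (metis mult_minus1 power_mult_distrib)
    moreover have "x / ((-1) ^ Suc n * y) = (-1) ^ Suc n * (x / y)" for x y :: complex
      by (cases "even n") auto
    ultimately show ?thesis unfolding ker_def s_def h_def scaleC_complex_def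
      by (simp del: power_Suc)
  qed
  have ki: "ker ?L \<alpha> integrable_on UNIV" using K.inner_integrable[OF \<alpha> good] .
  have hi: "(\<lambda>\<beta>. h (Complex \<alpha> \<beta>)) integrable_on UNIV"
  proof -
    have "(\<lambda>\<beta>. (1/s) * ker ?L \<alpha> \<beta>) integrable_on UNIV" using integrable_on_mult_right[OF ki] .
    then show ?thesis unfolding ker_h using s0 by simp
  qed
  \<comment> \<open>If |z| \<ge> 2|p| then |z - p| \<ge> |z|/2, which costs 2^(n+1); the weight (Re
    z)^n in \<open>w\<close> is at least \<alpha>^n.\<close>
  define C where "C = 2 ^ Suc n / \<alpha> ^ n"
  have C: "C > 0" using \<alpha> by (simp add: C_def)
  have hb: "cmod (h (Complex x y)) \<le> C * w (x, y)" if x: "\<alpha> \<le> x" and far: "2 * cmod p \<le> cmod (Complex x y)" "0 < cmod (Complex x y)" for x y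
  proof -
    let ?z = "Complex x y"
    have "cmod ?z / 2 \<le> cmod (?z - p)" using far norm_triangle_ineq2[of ?z p] by simp
    then have "(cmod ?z / 2) ^ Suc n \<le> cmod (?z - p) ^ Suc n" by (intro power_mono) auto
    moreover have "0 < (cmod ?z / 2) ^ Suc n" using far by simp
    ultimately have "cmod (h ?z) \<le> cmod (g ?z) / (cmod ?z / 2) ^ Suc n"
      unfolding h_def norm_divide norm_power by (intro divide_left_mono mult_pos_pos) auto
    also have "\<dots> = 2 ^ Suc n * (cmod (g ?z) / cmod ?z ^ Suc n)" by (simp add: power_divide)
    also have "\<dots> = 2 ^ Suc n / x ^ n * w (x, y)" using x \<alpha> by (simp add: w_def)
    also have "\<dots> \<le> C * w (x, y)" unfolding C_def
      using x \<alpha> by (intro mult_right_mono divide_left_mono power_mono w_nonneg) auto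
    finally show ?thesis .
  qed
  \<comment> \<open>The mass of \<open>w\<close> on the lines through the bottom, right and top
    sides when the rectangle has corners at \<alpha> - i s and s + i s.\<close>
  define m where "m = (\<lambda>s. (\<integral>x. w (x, 0 + (-1) * s) \<partial>lborel) + (\<integral>\<beta>. w (s, \<beta>) \<partial>lborel) + (\<integral>x. w (x, s) \<partial>lborel))"
  have m_int: "integrable lborel m" unfolding m_def
    by (intro Bochner_Integration.integrable_add row_integral[OF w_int]
         integrable_affine_comp[OF row_integral(2)[OF w_int]] lborel_pair.integrable_fst'[OF w_int]) auto
  have m_nonneg: "0 \<le> m s" for s unfolding m_def by (intro add_nonneg_nonneg integral_nonneg_AE) (auto simp: w_nonneg)
  have AE_all: "AE s in lborel. integrable lborel (\<lambda>x. w (x, 0 + (-1) * s)) \<and> integrable lborel (\<lambda>\<beta>. w (s, \<beta>)) \<and> integrable lborel (\<lambda>x. w (x, s))"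
    using AE_affine_comp[OF row_integral(1)[OF w_int], of "-1" 0] AE_good_col row_integral(1)[OF w_int] by auto
  have "cmod (S + \<i> * integral UNIV (\<lambda>\<beta>. h (Complex \<alpha> \<beta>))) \<le> 0 + e" if "e > 0" for e
  proof -
    obtain B where B: "\<And>T. B < T \<Longrightarrow> norm (integral {-T..T} (\<lambda>\<beta>. h (Complex \<alpha> \<beta>)) - integral UNIV (\<lambda>\<beta>. h (Complex \<alpha> \<beta>))) < e/2"
      using integral_symmetric_limit[OF hi, of "e/2"] \<open>e > 0\<close> by auto
    define I where "I = integral\<^sup>L lborel m"
    have I: "I \<ge> 0" unfolding I_def by (intro integral_nonneg_AE) (auto simp: m_nonneg)
    \<comment> \<open>A window of this length makes C times the average of m at most e/2. It starts
      at a, beyond 2|p|, so that \<open>hb\<close> applies on the three sides.\<close>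
    define l where "l = 2 * C * I / e + 1"
    have l: "l > 0" using C I \<open>e > 0\<close> by (simp add: l_def add_nonneg_pos)
    define a where "a = max B (2 * cmod p + \<alpha> + 1)"
    obtain T where T: "a < T" "integrable lborel (\<lambda>x. w (x, 0 + (-1) * T)) \<and> integrable lborel (\<lambda>\<beta>. w (T, \<beta>)) \<and> integrable lborel (\<lambda>x. w (x, T))"
       "((a + l) - a) * m T \<le> I"
      using exists_below_mean[OF m_int m_nonneg AE_all, of a "a + l"] l unfolding I_def by auto
    have T0: "T > 2 * cmod p + \<alpha> + 1" "T > B" using T(1) by (auto simp: a_def)
    have T1: "\<alpha> < T" "T > 0" "2 * cmod p \<le> T" "cmod p < T" using T0 \<alpha> norm_ge_zero[of p] by linarith+
    have Cm: "C * m T \<le> e/2"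
    proof -
      have "l * (C * m T) \<le> C * I" using T(3) C by (simp add: mult.left_commute mult_left_mono)
      also have "C * I \<le> l * (e/2)" using \<open>e > 0\<close> by (simp add: l_def field_simps)
      finally show ?thesis using l by simp
    qed
    let ?P = "rectpath (Complex \<alpha> (-T)) (Complex T T)"
    have sub: "cbox (Complex \<alpha> (-T)) (Complex T T) \<subseteq> {z. 0 < Re z}" using \<alpha> by (auto simp: in_cbox_complex_iff)
    have pin: "p \<in> box (Complex \<alpha> (-T)) (Complex T T)"
      using Rep T1 complex_Re_le_cmod[of p] abs_Im_le_cmod[of p] by (auto simp: in_box_complex_iff abs_le_iff)
    have im: "path_image ?P = cbox (Complex \<alpha> (-T)) (Complex T T) - box (Complex \<alpha> (-T)) (Complex T T)"
      using T1 by (intro path_image_rectpath_cbox_minus_box) auto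
    have hcont: "continuous_on (path_image ?P) h"
      unfolding h_def im using pin sub
      by (intro continuous_intros continuous_on_subset[OF holomorphic_on_imp_continuous_on[OF hol_g]]) auto
    have big: "T \<le> cmod (Complex x y)" if "\<bar>x\<bar> = T \<or> \<bar>y\<bar> = T" for x y
      using that abs_Re_le_cmod[of "Complex x y"] abs_Im_le_cmod[of "Complex x y"] by auto
    have "cmod (contour_integral ?P h + \<i> * integral {-T..T} (\<lambda>y. h (Complex \<alpha> y)))
       \<le> (\<integral>x. C * w (x, -T) \<partial>lborel) + (\<integral>y. C * w (T, y) \<partial>lborel) + (\<integral>x. C * w (x, T) \<partial>lborel)"
    proof (rule rectpath_integral_bound[OF _ _ hcont])
      fix x assume "x \<in> {\<alpha>..T}"
      then show "cmod (h (Complex x (-T))) \<le> C * w (x, -T)" "cmod (h (Complex x T)) \<le> C * w (x, T)"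
        using big[of x T] big[of x "-T"] T1 by (auto intro!: hb)
    next
      fix y assume "y \<in> {-T..T}"
      then show "cmod (h (Complex T y)) \<le> C * w (T, y)"
        using big[of T y] T1 by (auto intro!: hb)
    qed (use T T1 C in \<open>auto simp: w_nonneg\<close>)
    also have "\<dots> = C * m T" by (simp add: m_def algebra_simps)
    also have "contour_integral ?P h = S"
      unfolding h_def S_def by (rule residue_rectpath[OF open_halfplane connected_halfplane hol_g sub pin])
    finally have 1: "cmod (S + \<i> * integral {-T..T} (\<lambda>y. h (Complex \<alpha> y))) \<le> e/2" using Cm by simp
    have "S + \<i> * integral UNIV (\<lambda>\<beta>. h (Complex \<alpha> \<beta>)) = (S + \<i> * integral {-T..T} (\<lambda>y. h (Complex \<alpha> y))) -
        \<i> * (integral {-T..T} (\<lambda>\<beta>. h (Complex \<alpha> \<beta>)) - integral UNIV (\<lambda>\<beta>. h (Complex \<alpha> \<beta>)))" by (simp add: algebra_simps)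
    also have "cmod \<dots> \<le> e/2 + e/2"
      by (rule order_trans[OF norm_triangle_ineq4 add_mono[OF 1]]) (use B[OF T0(2)] in \<open>simp add: norm_mult\<close>)
    finally show ?thesis by simp
  qed
  then have "cmod (S + \<i> * integral UNIV (\<lambda>\<beta>. h (Complex \<alpha> \<beta>))) \<le> 0" by (rule field_le_epsilon)
  then have "\<i> * integral UNIV (\<lambda>\<beta>. h (Complex \<alpha> \<beta>)) = - S" by (simp add: add_eq_0_iff)
  then have "\<i> * (\<i> * integral UNIV (\<lambda>\<beta>. h (Complex \<alpha> \<beta>))) = \<i> * (- S)" by simp
  then have "integral UNIV (\<lambda>\<beta>. h (Complex \<alpha> \<beta>)) = \<i> * S" by (simp add: mult.assoc[symmetric])
  also have "\<i> * S = - (2 * pi * (deriv ^^ n) g p / fact n)" by (simp add: S_def algebra_simps)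
  finally have "integral UNIV (\<lambda>\<beta>. h (Complex \<alpha> \<beta>)) = - (2 * pi * (deriv ^^ n) g p / fact n)" .
  moreover have "integral UNIV (ker ?L \<alpha>) = s * integral UNIV (\<lambda>\<beta>. h (Complex \<alpha> \<beta>))"
  proof -
    have "ker ?L \<alpha> = (\<lambda>\<beta>. s * h (Complex \<alpha> \<beta>))" by (rule ext) (rule ker_h)
    then show ?thesis by simp
  qed
  ultimately show ?thesis by (simp add: s_def p_def mult_ac)
qed

text \<open>Cauchy's formula on a square about z whose half-side, between Re z / 4 and Re z / 2, is
  chosen by averaging. Only mass of \<open>w\<close> far to the right enters, and that is small. The
  cone |Im z| \<le> Re z keeps the weight in \<open>w\<close> comparable to 1 / Re z on the
  square.\<close>

lemma g_decay:
  assumes "e > 0"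
  obtains X where "X > 0" "\<And>z. X \<le> Re z \<Longrightarrow> \<bar>Im z\<bar> \<le> Re z \<Longrightarrow> Re z * cmod (g z) \<le> e"
proof -
  let ?LL = "lborel \<Otimes>\<^sub>M lborel :: (real \<times> real) measure"
  define v where "v = (\<lambda>N::nat. \<lambda>p. if real N \<le> fst p then w p else 0)"
  have [measurable]: "w \<in> borel_measurable (borel \<Otimes>\<^sub>M borel)" using w_measurable by simp
  have v_meas: "v N \<in> borel_measurable ?LL" for N unfolding v_def by measurable
  have v_nonneg: "0 \<le> v N p" for N p by (auto simp: v_def w_nonneg)
  have v_int: "integrable ?LL (v N)" for N
    by (rule Bochner_Integration.integrable_bound[OF w_int v_meas]) (auto simp: v_def w_nonneg)
  have "(\<lambda>N. integral\<^sup>L ?LL (v N)) \<longlonglongrightarrow> integral\<^sup>L ?LL (\<lambda>p::real\<times>real. 0::real)"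
  proof (rule integral_dominated_convergence[OF _ v_meas w_int])
    show "AE p in ?LL. (\<lambda>N. v N p) \<longlonglongrightarrow> 0"
    proof (rule AE_I2)
      fix p :: "real \<times> real"
      have "\<forall>\<^sub>F N in sequentially. fst p < real N"
        using filterlim_real_sequentially unfolding filterlim_at_top_dense by blast
      then have "\<forall>\<^sub>F N in sequentially. v N p = 0" by eventually_elim (simp add: v_def)
      then show "(\<lambda>N. v N p) \<longlonglongrightarrow> 0" by (rule tendsto_eventually)
    qed
  qed (auto simp: v_def w_nonneg)
  then have lim: "(\<lambda>N. integral\<^sup>L ?LL (v N)) \<longlonglongrightarrow> 0" by simp
  \<comment> \<open>On the square |z| \<le> 3X and Re z \<ge> X/2, so |z|^(n+1) / (Re z)^n \<le> K
    X.\<close>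
  define K :: real where "K = 3 ^ Suc n * 2 ^ n"
  have K: "K > 0" by (simp add: K_def)
  \<comment> \<open>The factor 64 is 16 times 4: X times 4 K m(s) is 16 K times the window length
    X/4 times m(s), and m has four times the mass of the tail.\<close>
  obtain N where N: "integral\<^sup>L ?LL (v N) < e / (64 * K)"
    using order_tendstoD(2)[OF lim, of "e / (64 * K)"] K assms by (auto simp: eventually_sequentially)
  define u where "u = v N"
  have u_int: "integrable ?LL u" and u0: "0 \<le> u p" for p unfolding u_def by (auto simp: v_int v_nonneg)
  \<comment> \<open>For X = Re z \<ge> 2N + 1 the square, which stays to the right of X/2, lies in
    the region where the tail \<open>u\<close> equals \<open>w\<close>.\<close>
  show thesis
  proof (rule that[of "2 * real N + 1"])
    fix z assume z: "2 * real N + 1 \<le> Re z" "\<bar>Im z\<bar> \<le> Re z"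
    define X Y where "X = Re z" and "Y = Im z"
    have X: "X > 0" "X / 2 \<ge> N" "\<bar>Y\<bar> \<le> X" using z by (auto simp: X_def Y_def)
    have zXY: "z = Complex X Y" by (simp add: X_def Y_def)
    define col row where "col = (\<lambda>x. \<integral>\<beta>. u (x, \<beta>) \<partial>lborel)" and "row = (\<lambda>y. \<integral>x. u (x, y) \<partial>lborel)"
    have col: "integrable lborel col" "integral\<^sup>L lborel col = integral\<^sup>L ?LL u"
      unfolding col_def using lborel_pair.integrable_fst'[OF u_int] lborel_pair.integral_fst'[OF u_int] by auto
    have row: "integrable lborel row" "integral\<^sup>L lborel row = integral\<^sup>L ?LL u"
      unfolding row_def using row_integral(2,3)[OF u_int] by auto
    define m where "m = (\<lambda>s. col (X + 1 * s) + col (X + (-1) * s) + row (Y + 1 * s) + row (Y + (-1) * s))"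
    have m_int: "integrable lborel m" unfolding m_def
      by (intro Bochner_Integration.integrable_add integrable_affine_comp col row) auto
    have "integral\<^sup>L lborel m = integral\<^sup>L lborel col + integral\<^sup>L lborel col + integral\<^sup>L lborel row + integral\<^sup>L lborel row"
      unfolding m_def using integrable_affine_comp[OF col(1), of 1 X] integrable_affine_comp[OF col(1), of "-1" X]
        integrable_affine_comp[OF row(1), of 1 Y] integrable_affine_comp[OF row(1), of "-1" Y]
      by (simp add: Bochner_Integration.integral_add Bochner_Integration.integrable_add)
    then have m_eq: "integral\<^sup>L lborel m = 4 * integral\<^sup>L ?LL u" using col row by simp
    have m_nonneg: "0 \<le> m s" for s unfolding m_def col_def row_def
      by (intro add_nonneg_nonneg integral_nonneg_AE) (auto simp: u0)
    define gc gr where "gc = (\<lambda>x. integrable lborel (\<lambda>\<beta>. u (x, \<beta>)))" and "gr = (\<lambda>y. integrable lborel (\<lambda>x. u (x, y)))"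
    have c1: "AE s in lborel. gc s" unfolding gc_def using lborel_pair.AE_integrable_fst'[OF u_int] .
    have r1: "AE s in lborel. gr s" unfolding gr_def using row_integral(1)[OF u_int] .
    have AE_all: "AE s in lborel. gc (X + 1 * s) \<and> gc (X + (-1) * s) \<and> gr (Y + 1 * s) \<and> gr (Y + (-1) * s)"
      using AE_affine_comp[OF c1, of 1 X] AE_affine_comp[OF c1, of "-1" X] AE_affine_comp[OF r1, of 1 Y] AE_affine_comp[OF r1, of "-1" Y]
      by auto
    have "X / 4 < X / 2" using X by simp
    from exists_below_mean[OF m_int m_nonneg AE_all this] obtain s where s: "X / 4 < s" "s < X / 2"
        "gc (X + 1 * s) \<and> gc (X + (-1) * s) \<and> gr (Y + 1 * s) \<and> gr (Y + (-1) * s)" "(X / 2 - X / 4) * m s \<le> integral\<^sup>L lborel m"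
      by blast
    have s0: "s > 0" using s X by linarith
    define h where "h = (\<lambda>\<zeta>. g \<zeta> / (\<zeta> - z) ^ Suc 0)"
    have gb: "cmod (g (Complex x y)) \<le> K * X * u (x, y)" if xy: "X / 2 \<le> x" "x \<le> 3 * X / 2" "\<bar>y - Y\<bar> \<le> X / 2" for x y
    proof -
      let ?z = "Complex x y"
      have x0: "x > 0" using xy X by linarith
      have "\<bar>y\<bar> \<le> \<bar>y - Y\<bar> + \<bar>Y\<bar>" by linarith
      then have "cmod ?z \<le> 3 * X" using cmod_le[of ?z] xy X x0 by simp
      then have le: "cmod ?z ^ Suc n / x ^ n \<le> (3 * X) ^ Suc n / (X / 2) ^ n"
        using xy X x0 by (intro frac_le power_mono) auto
      have "?z \<noteq> 0" using x0 by (auto simp: complex_eq_iff)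
      then have "cmod (g ?z) = w (x, y) * (cmod ?z ^ Suc n / x ^ n)" using x0 by (simp add: w_def)
      also have "\<dots> \<le> w (x, y) * ((3 * X) ^ Suc n / (X / 2) ^ n)" by (intro mult_left_mono le w_nonneg)
      also have "(3 * X) ^ Suc n / (X / 2) ^ n = K * X" using X by (simp add: K_def power_mult_distrib power_divide)
      also have "w (x, y) = u (x, y)" using xy X by (simp add: u_def v_def)
      finally show ?thesis by (simp add: mult_ac)
    qed
    have hb: "cmod (h (Complex x y)) \<le> 4 * K * u (x, y)"
      if xy: "X - s \<le> x" "x \<le> X + s" "\<bar>y - Y\<bar> \<le> s" "\<bar>x - X\<bar> = s \<or> \<bar>y - Y\<bar> = s" for x y
    proof -
      have "s \<le> cmod (Complex x y - z)"
        using xy(4) abs_Re_le_cmod[of "Complex x y - z"] abs_Im_le_cmod[of "Complex x y - z"] by (auto simp: zXY)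
      then have "X / 4 \<le> cmod (Complex x y - z)" using s by linarith
      then have "cmod (h (Complex x y)) \<le> cmod (g (Complex x y)) / (X / 4)"
        unfolding h_def norm_divide power_Suc0_right using X(1)
        by (intro divide_left_mono mult_pos_pos) (linarith | simp)+
      also have "\<dots> \<le> (K * X * u (x, y)) / (X / 4)" using xy s X by (intro divide_right_mono gb) auto
      also have "\<dots> = 4 * K * u (x, y)" using X by simp
      finally show ?thesis .
    qed
    let ?a = "X - s" and ?b = "X + s" and ?c = "Y - s" and ?d = "Y + s"
    let ?P = "rectpath (Complex ?a ?c) (Complex ?b ?d)"
    have lt: "?a < ?b" "?c < ?d" using s0 by auto
    have sub: "cbox (Complex ?a ?c) (Complex ?b ?d) \<subseteq> {z. 0 < Re z}" using s X by (auto simp: in_cbox_complex_iff)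
    have zin: "z \<in> box (Complex ?a ?c) (Complex ?b ?d)" using s0 by (auto simp: in_box_complex_iff zXY)
    have im: "path_image ?P = cbox (Complex ?a ?c) (Complex ?b ?d) - box (Complex ?a ?c) (Complex ?b ?d)"
      using lt by (intro path_image_rectpath_cbox_minus_box) auto
    have hcont: "continuous_on (path_image ?P) h"
      unfolding h_def im using zin sub
      by (intro continuous_intros continuous_on_subset[OF holomorphic_on_imp_continuous_on[OF hol_g]]) auto
    have i4: "integrable lborel (\<lambda>x. 4 * K * u (x, ?c))" "integrable lborel (\<lambda>y. 4 * K * u (?b, y))"
      "integrable lborel (\<lambda>x. 4 * K * u (x, ?d))" "integrable lborel (\<lambda>y. 4 * K * u (?a, y))"
      using s(3) by (auto simp: gc_def gr_def)
    have "cmod (contour_integral ?P h + \<i> * integral {?c..?d} (\<lambda>y. h (Complex ?a y)))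
       \<le> (\<integral>x. 4 * K * u (x, ?c) \<partial>lborel) + (\<integral>y. 4 * K * u (?b, y) \<partial>lborel) + (\<integral>x. 4 * K * u (x, ?d) \<partial>lborel)"
      by (rule rectpath_integral_bound[OF lt hcont i4(1-3)]) (use s0 K u0 in \<open>auto intro!: hb\<close>)
    moreover have "cmod (integral {?c..?d} (\<lambda>y. h (Complex ?a y))) \<le> (\<integral>y. 4 * K * u (?a, y) \<partial>lborel)"
      by (rule norm_integral_le_lborel[OF continuous_on_rectpath_sides(3)[OF lt hcont] i4(4)])
         (use s0 K u0 in \<open>auto intro!: hb\<close>)
    ultimately have "cmod (contour_integral ?P h) \<le> 4 * K * m s"
      using norm_triangle_ineq4[of "contour_integral ?P h + \<i> * integral {?c..?d} (\<lambda>y. h (Complex ?a y))"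
          "\<i> * integral {?c..?d} (\<lambda>y. h (Complex ?a y))"]
      by (simp add: m_def col_def row_def norm_mult algebra_simps)
    moreover have "contour_integral ?P h = 2 * pi * \<i> * g z"
      using residue_rectpath[OF open_halfplane connected_halfplane hol_g sub zin, of 0] by (simp add: h_def)
    ultimately have "2 * pi * cmod (g z) \<le> 4 * K * m s" by (simp add: norm_mult)
    moreover have "1 * cmod (g z) \<le> 2 * pi * cmod (g z)" using pi_gt3 by (intro mult_right_mono) auto
    ultimately have "cmod (g z) \<le> 4 * K * m s" by simp
    then have "X * cmod (g z) \<le> X * (4 * K * m s)" using X by (intro mult_left_mono) auto
    also have "\<dots> = 16 * K * ((X / 2 - X / 4) * m s)" by simp
    also have "\<dots> \<le> 16 * K * (4 * integral\<^sup>L ?LL u)"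
      using s(4) K unfolding m_eq by (intro mult_left_mono) auto
    also have "\<dots> \<le> e" using N K by (simp add: u_def field_simps)
    finally show "Re z * cmod (g z) \<le> e" by (simp add: X_def)
  qed simp
qed

text \<open>Cauchy's estimate for f' on the disc of radius t/4 about \<mu> + t, which for large t
  lies in the cone of \<open>g_decay\<close> and to the right of t/2.\<close>

lemma higher_deriv_decay:
  assumes "m > 0"
  shows "((\<lambda>t. of_real t ^ m * (deriv ^^ m) f (\<mu> + of_real t)) \<longlongrightarrow> 0) at_top"
proof -
  obtain k where k: "m = Suc k" using assms gr0_implies_Suc by blast
  show ?thesis
  proof (rule tendstoI)
    fix e :: real assume "e > 0"
    \<comment> \<open>On the disc |f'| is at most 2d/t. Cauchy's estimate multiplies this by k!
      (4/t)^k, and the factor t^(k+1) leaves 2 k! 4^k d = e/2.\<close>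
    define d where "d = e / (2 * (fact k * 2 * 4 ^ k))"
    have d: "d > 0" using \<open>e > 0\<close> by (simp add: d_def)
    obtain X where X: "X > 0" "\<And>z. X \<le> Re z \<Longrightarrow> \<bar>Im z\<bar> \<le> Re z \<Longrightarrow> Re z * cmod (g z) \<le> d" using g_decay[OF d] by blast
    show "\<forall>\<^sub>F t in at_top. dist (of_real t ^ m * (deriv ^^ m) f (\<mu> + of_real t)) 0 < e"
      using eventually_ge_at_top[of "4 * cmod \<mu> + 2 * X"]
    proof eventually_elim
      case (elim t)
      have t: "t > 0" "cmod \<mu> \<le> t / 4" "X \<le> t / 2" using elim X(1) norm_ge_zero[of \<mu>] by linarith+
      have loc: "t / 2 \<le> Re z" "\<bar>Im z\<bar> \<le> Re z" if "cmod (\<mu> + of_real t - z) \<le> t / 4" for z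
        using that t abs_Re_le_cmod[of "\<mu> + of_real t - z"] abs_Im_le_cmod[of "\<mu> + of_real t - z"]
          abs_Re_le_cmod[of \<mu>] abs_Im_le_cmod[of \<mu>] by (auto simp: abs_le_iff)
      have sub: "cball (\<mu> + of_real t) (t / 4) \<subseteq> {z. 0 < Re z}"
        using loc t by (fastforce simp: dist_norm)
      have "cmod ((deriv ^^ k) g (\<mu> + of_real t)) \<le> fact k * (2 * d / t) / (t / 4) ^ k"
      proof (rule Cauchy_inequality)
        show "g holomorphic_on ball (\<mu> + of_real t) (t / 4)"
          using holomorphic_on_subset[OF hol_g] sub ball_subset_cball by blast
        show "continuous_on (cball (\<mu> + of_real t) (t / 4)) g"
          using holomorphic_on_subset[OF hol_g sub] by (rule holomorphic_on_imp_continuous_on)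
        show "cmod (g z) \<le> 2 * d / t" if "cmod (\<mu> + of_real t - z) = t / 4" for z
        proof -
          have z: "t / 2 \<le> Re z" "\<bar>Im z\<bar> \<le> Re z" using loc[of z] that by auto
          have "t / 2 * cmod (g z) \<le> Re z * cmod (g z)" using z by (intro mult_right_mono) auto
          also have "\<dots> \<le> d" using X(2)[of z] z t by simp
          finally show ?thesis using t by (simp add: field_simps)
        qed
      qed (use t in simp)
      then have "t ^ m * cmod ((deriv ^^ k) g (\<mu> + of_real t)) \<le> t ^ m * (fact k * (2 * d / t) / (t / 4) ^ k)"
        using t by (intro mult_left_mono) auto
      also have "\<dots> = e / 2" using t by (simp add: k d_def power_divide)
      also have "\<dots> < e" using \<open>e > 0\<close> by simp
      finally have "t ^ m * cmod ((deriv ^^ k) g (\<mu> + of_real t)) < e" .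
      moreover have "(deriv ^^ m) f = (deriv ^^ k) g" by (simp add: k funpow_swap1)
      ultimately show ?case using t by (simp add: norm_mult norm_power)
    qed
  qed
qed

text \<open>Every summand with a positive power of z vanishes by \<open>higher_deriv_decay\<close>.
  A difference is stated because f(\<mu> + t) is not yet known to converge.\<close>

lemma parts_antideriv_limit:
  "((\<lambda>t. parts_antideriv f \<mu> m (of_real t) - (-1) ^ m * fact m * f (\<mu> + of_real t)) \<longlongrightarrow> 0) at_top"
proof (induction m)
  case (Suc m)
  have "((\<lambda>t. of_real t ^ Suc m * (deriv ^^ Suc m) f (\<mu> + of_real t) - of_nat (Suc m) *
     (parts_antideriv f \<mu> m (of_real t) - (-1) ^ m * fact m * f (\<mu> + of_real t))) \<longlongrightarrow> 0 - of_nat (Suc m) * 0) at_top"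
    by (intro tendsto_diff tendsto_mult tendsto_const Suc higher_deriv_decay) simp
  then show ?case by (simp add: algebra_simps)
qed simp

text \<open>By \<open>inner_integral\<close> the outer integrand is the derivative of a multiple of
  \<open>parts_antideriv\<close> at 2 \<alpha>, so integrating up to T leaves boundary terms:
  f(\<mu>) from 0 and, up to a null term, f(\<mu> + 2T) from T. Convergence of the integral then
  gives convergence of f along the ray.\<close>

lemma shift_limit:
  assumes \<mu>: "0 < Re \<mu>"
  shows "((\<lambda>t. f (\<mu> + of_real (2 * t))) \<longlongrightarrow> f \<mu> + (2 ^ n / pi) * dint (\<lambda>z. 1 / (\<mu> + z) ^ Suc n)) at_top"
proof -
  let ?L = "\<lambda>z. 1 / (\<mu> + z) ^ Suc n"
  define k where "k = Re \<mu> / cmod \<mu>"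
  have "cmod \<mu> > 0" using \<mu> by auto
  then have k: "0 < k" "k * cmod \<mu> \<le> Re \<mu>" using \<mu> by (auto simp: k_def)
  define c where "c = (1 + 1 / k) ^ Suc n"
  have adm: "admissible c ?L" unfolding c_def by (rule admissible_pole[OF k])
  interpret K: dominated_kernel "ker ?L" "\<lambda>p. c * w p" by (rule dominated_kernel_ker[OF adm])
  define \<Phi> where "\<Phi> = (\<lambda>\<alpha>::real. 2 * pi * (-1) ^ n * \<alpha> ^ n * (deriv ^^ n) g (\<mu> + 2 * \<alpha>) / fact n)"
  have sp: "\<Phi> \<alpha> = integral UNIV (ker ?L \<alpha>)" if "\<alpha> \<in> {0<..} - bad_lines (\<lambda>p. c * w p)" for \<alpha>
    unfolding \<Phi>_def using inner_integral[OF _ \<mu> adm, of \<alpha>] that by simp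
  have Phi_int: "\<Phi> integrable_on {0<..}"
    by (rule integrable_spike[OF K.iterated_integrable negligible_bad_lines[OF K.v_int] sp]) 
  have Phi_eq: "dint ?L = integral {0<..} \<Phi>" unfolding dint_def
    by (rule integral_spike[OF negligible_bad_lines[OF K.v_int] sp])
  define \<Psi> where "\<Psi> = (\<lambda>\<alpha>. if \<alpha> \<in> {0<..} then \<Phi> \<alpha> else 0)"
  have Psi: "\<Psi> integrable_on UNIV" "integral UNIV \<Psi> = dint ?L"
    unfolding \<Psi>_def integrable_restrict_UNIV integral_restrict_UNIV Phi_eq using Phi_int by auto
  have ftc: "integral {-T..T} \<Psi> = pi / 2 ^ n * ((-1) ^ n / fact n * parts_antideriv f \<mu> n (of_real (2 * T)) - f \<mu>)"
    if "T > 0" for T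
  proof -
    \<comment> \<open>\<alpha>^n is written as (2 \<alpha>)^n / 2^n, and the factor 2 in \<Phi>
      comes from the inner function 2z by the chain rule.\<close>
    define G where "G = (\<lambda>z. pi / 2 ^ n * ((-1) ^ n / fact n) * parts_antideriv f \<mu> n (2 * z))"
    have "((\<lambda>\<alpha>. G (of_real \<alpha>)) has_vector_derivative \<Phi> \<alpha>) (at \<alpha> within {0..T})" if "\<alpha> \<in> {0..T}" for \<alpha>
    proof (rule has_vector_derivative_real_field)
      have "(parts_antideriv f \<mu> n has_field_derivative (2 * \<alpha>) ^ n * (deriv ^^ Suc n) f (\<mu> + 2 * \<alpha>)) (at (2 * of_real \<alpha>))"
        using parts_antideriv_deriv[OF open_halfplane hol_f, of \<mu> "2 * of_real \<alpha>" n] that \<mu> by simp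
      then have "((\<lambda>z. parts_antideriv f \<mu> n (2 * z)) has_field_derivative ((2 * \<alpha>) ^ n * (deriv ^^ Suc n) f (\<mu> + 2 * \<alpha>)) * 2) (at (of_real \<alpha>))"
        by (rule DERIV_chain2[where g="\<lambda>z. 2 * z" and x="complex_of_real \<alpha>"]) (auto intro!: derivative_eq_intros)
      then have "(G has_field_derivative pi / 2 ^ n * ((-1) ^ n / fact n) * (((2 * \<alpha>) ^ n * (deriv ^^ Suc n) f (\<mu> + 2 * \<alpha>)) * 2)) (at (of_real \<alpha>))"
        unfolding G_def by (rule DERIV_cmult)
      moreover have "pi / 2 ^ n * ((-1) ^ n / fact n) * (((2 * \<alpha>) ^ n * (deriv ^^ Suc n) f (\<mu> + 2 * \<alpha>)) * 2) = \<Phi> \<alpha>"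
        by (simp add: \<Phi>_def funpow_swap1 power_mult_distrib field_simps)
      ultimately show "(G has_field_derivative \<Phi> \<alpha>) (at (of_real \<alpha>))" by simp
    qed
    then have "(\<Phi> has_integral (G (of_real T) - G (of_real 0))) {0..T}"
      using that by (intro fundamental_theorem_of_calculus) auto
    moreover have "negligible {x \<in> {0..T} - ({0<..} \<inter> {-T..T}). \<Phi> x \<noteq> 0}"
      by (rule negligible_subset[OF negligible_sing[of 0]]) auto
    moreover have "negligible {x \<in> ({0<..} \<inter> {-T..T}) - {0..T}. \<Phi> x \<noteq> 0}"
      by (rule negligible_subset[OF negligible_empty]) auto
    ultimately have "(\<Phi> has_integral (G (of_real T) - G (of_real 0))) ({0<..} \<inter> {-T..T})"
      using has_integral_spike_set_eq by blast
    then have "((\<lambda>\<alpha>. if \<alpha> \<in> {0<..} then \<Phi> \<alpha> else 0) has_integral (G (of_real T) - G (of_real 0))) {-T..T}"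
      unfolding has_integral_restrict_Int .
    then have "integral {-T..T} \<Psi> = G (of_real T) - G (of_real 0)" unfolding \<Psi>_def by (rule integral_unique)
    also have "G (of_real 0) = pi / 2 ^ n * f \<mu>" by (simp add: G_def parts_antideriv_0 power_mult_distrib[symmetric])
    finally show ?thesis by (simp add: G_def algebra_simps)
  qed
  have "((\<lambda>T. integral {-T..T} \<Psi>) \<longlongrightarrow> dint ?L) at_top"
  proof (rule tendstoI)
    fix e :: real assume "e > 0"
    from integral_symmetric_limit[OF Psi(1) this] obtain B where B: "\<And>T. B < T \<Longrightarrow> norm (integral {-T..T} \<Psi> - integral UNIV \<Psi>) < e" by blast
    show "\<forall>\<^sub>F T in at_top. dist (integral {-T..T} \<Psi>) (dint ?L) < e"
      using eventually_gt_at_top[of B] by eventually_elim (use B in \<open>simp only: Psi dist_norm\<close>)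
  qed
  moreover have "\<forall>\<^sub>F T in at_top. integral {-T..T} \<Psi> = pi / 2 ^ n * ((-1) ^ n / fact n * parts_antideriv f \<mu> n (of_real (2 * T)) - f \<mu>)"
    using eventually_gt_at_top[of 0] by eventually_elim (rule ftc)
  ultimately have "((\<lambda>T. pi / 2 ^ n * ((-1) ^ n / fact n * parts_antideriv f \<mu> n (of_real (2 * T)) - f \<mu>)) \<longlongrightarrow> dint ?L) at_top"
    by (rule Lim_transform_eventually)
  then have A: "((\<lambda>T. 2 ^ n / pi * (pi / 2 ^ n * ((-1) ^ n / fact n * parts_antideriv f \<mu> n (of_real (2 * T)) - f \<mu>)) + f \<mu>)
      \<longlongrightarrow> 2 ^ n / pi * dint ?L + f \<mu>) at_top"
    by (intro tendsto_add tendsto_mult tendsto_const)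
  have "filterlim (\<lambda>T::real. 2 * T) at_top at_top" by (rule filterlim_tendsto_pos_mult_at_top[OF tendsto_const]) (auto simp: filterlim_ident)
  then have "((\<lambda>T. parts_antideriv f \<mu> n (of_real (2 * T)) - (-1) ^ n * fact n * f (\<mu> + of_real (2 * T))) \<longlongrightarrow> 0) at_top"
    by (rule filterlim_compose[OF parts_antideriv_limit])
  then have "((\<lambda>T. (-1) ^ n / fact n * (parts_antideriv f \<mu> n (of_real (2 * T)) - (-1) ^ n * fact n * f (\<mu> + of_real (2 * T)))) \<longlongrightarrow> (-1) ^ n / fact n * 0) at_top"
    by (intro tendsto_mult tendsto_const)
  note lim = tendsto_diff[OF A this]
  have eq: "2 ^ n / pi * (pi / 2 ^ n * ((-1) ^ n / fact n * P - a)) + a - (-1) ^ n / fact n * (P - (-1) ^ n * fact n * F) = F"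
    for P F a :: complex
  proof -
    have "2 ^ n / pi * (pi / 2 ^ n * x) = x" for x :: complex by simp
    then show ?thesis by (cases "even n") (simp_all add: field_simps)
  qed
  show ?thesis using lim unfolding eq by (simp only: mult_zero_right diff_zero add.commute)
qed

text \<open>The limit in \<open>shift_limit\<close> might depend on \<mu>. Since f' tends to 0
  uniformly on the segments from \<mu> + 2t to 1 + 2t, it is the same as for \<mu> = 1.\<close>

lemma reproducing_formula:
  obtains C where "\<And>\<mu>. 0 < Re \<mu> \<Longrightarrow> f \<mu> = C - (2 ^ n / pi) * dint (\<lambda>z. 1 / (\<mu> + z) ^ Suc n)"
proof (rule that)
  fix \<mu> :: complex assume \<mu>: "0 < Re \<mu>"
  let ?F = "\<lambda>\<mu>. f \<mu> + (2 ^ n / pi) * dint (\<lambda>z. 1 / (\<mu> + z) ^ Suc n)"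
  have L0: "((\<lambda>t. f (\<mu> + of_real (2 * t)) - f (1 + of_real (2 * t))) \<longlongrightarrow> 0) at_top"
  proof (rule tendstoI)
    fix e :: real assume "e > 0"
    \<comment> \<open>The segment has length |\<mu> - 1|; adding 1 keeps the denominator positive
      for \<mu> = 1.\<close>
    define d where "d = e / (2 * (cmod (\<mu> - 1) + 1))"
    have pos: "cmod (\<mu> - 1) + 1 > 0" by (simp add: add_nonneg_pos)
    then have d: "d > 0" using \<open>e > 0\<close> by (simp add: d_def)
    obtain X where X: "X > 0" "\<And>z. X \<le> Re z \<Longrightarrow> \<bar>Im z\<bar> \<le> Re z \<Longrightarrow> Re z * cmod (g z) \<le> d" using g_decay[OF d] by blast
    show "\<forall>\<^sub>F t in at_top. dist (f (\<mu> + of_real (2 * t)) - f (1 + of_real (2 * t))) 0 < e"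
      using eventually_ge_at_top[of "X + cmod \<mu> + 1"]
    proof eventually_elim
      case (elim t)
      let ?S = "closed_segment (\<mu> + of_real (2 * t)) (1 + of_real (2 * t))"
      have z: "0 < Re z" "cmod (g z) \<le> d" if "z \<in> ?S" for z
      proof -
        obtain u where u: "0 \<le> u" "u \<le> 1" "z = (1 - u) *\<^sub>R (\<mu> + of_real (2 * t)) + u *\<^sub>R (1 + of_real (2 * t))"
          using \<open>z \<in> ?S\<close> by (auto simp: closed_segment_def)
        have Re: "Re z = (1 - u) * Re \<mu> + u + 2 * t" unfolding u(3) by (simp add: algebra_simps)
        have Im: "Im z = (1 - u) * Im \<mu>" unfolding u(3) by simp
        have R1: "Re z \<ge> 2 * t" using Re u \<mu> by simp
        have "\<bar>Im z\<bar> \<le> 1 * cmod \<mu>" unfolding Im abs_mult using u abs_Im_le_cmod[of \<mu>] by (intro mult_mono) auto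
        then have *: "X \<le> Re z" "\<bar>Im z\<bar> \<le> Re z" "1 \<le> Re z" using R1 elim X(1) norm_ge_zero[of \<mu>] by linarith+
        show "0 < Re z" using * by linarith
        have "1 * cmod (g z) \<le> Re z * cmod (g z)" using * by (intro mult_right_mono) auto
        then show "cmod (g z) \<le> d" using X(2)[OF *(1,2)] by simp
      qed
      have "cmod (f (\<mu> + of_real (2 * t)) - f (1 + of_real (2 * t))) \<le> d * cmod (\<mu> + of_real (2 * t) - (1 + of_real (2 * t)))"
      proof (rule field_differentiable_bound)
        show "(f has_field_derivative g z) (at z within ?S)" if "z \<in> ?S" for z
          using holomorphic_derivI[OF hol_f open_halfplane] z(1)[OF that] by (metis has_field_derivative_at_within mem_Collect_eq)
      qed (use z in auto)
      also have "\<dots> = e * (cmod (\<mu> - 1) / (2 * (cmod (\<mu> - 1) + 1)))" by (simp add: d_def algebra_simps)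
      also have "\<dots> \<le> e * (1/2)" using pos \<open>e > 0\<close> by (intro mult_left_mono) (auto simp: divide_simps)
      also have "\<dots> < e" using \<open>e > 0\<close> by simp
      finally show ?case by simp
    qed
  qed
  have L1: "((\<lambda>t. f (\<mu> + of_real (2 * t)) - f (1 + of_real (2 * t))) \<longlongrightarrow> ?F \<mu> - ?F 1) at_top"
    by (intro tendsto_diff shift_limit \<mu>) simp
  have "?F \<mu> - ?F 1 = 0" by (rule tendsto_unique[OF trivial_limit_at_top_linorder L1 L0])
  then show "f \<mu> = ?F 1 - (2 ^ n / pi) * dint (\<lambda>z. 1 / (\<mu> + z) ^ Suc n)" by (simp add: algebra_simps)
qed

section \<open>Boundary values at 0 and at infinity\<close>

lemma dint_cong:
  assumes "\<And>z. 0 < Re z \<Longrightarrow> L z = M z"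
  shows "dint L = dint M"
  unfolding dint_def ker_def[abs_def] by (intro integral_cong) (simp add: assms)

lemma admissible_diff:
  assumes "admissible c L" "admissible d M"
  shows "admissible (c + d) (\<lambda>z. L z - M z)"
  unfolding admissible_def
proof (intro conjI allI impI)
  show "continuous_on {z. 0 < Re z} (\<lambda>z. L z - M z)" using assms by (intro continuous_on_diff) (auto simp: admissible_def)
  fix z :: complex assume "0 < Re z"
  then have "norm (L z) + norm (M z) \<le> c / cmod z ^ Suc n + d / cmod z ^ Suc n"
    using assms unfolding admissible_def by (intro add_mono) auto
  then show "norm (L z - M z) \<le> (c + d) / cmod z ^ Suc n"
    unfolding add_divide_distrib by (rule order_trans[OF norm_triangle_ineq4])
qed

lemma dint_pole_at_infinity:
  assumes k: "0 < k" "\<And>j. k * cmod (X j) \<le> Re (X j)" and X: "filterlim X at_infinity sequentially"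
  shows "(\<lambda>j. dint (\<lambda>z. 1 / (X j + z) ^ Suc n)) \<longlonglongrightarrow> 0"
proof (rule dint_dominated[OF admissible_pole[OF k]])
  fix z :: complex
  have "filterlim (\<lambda>j. X j + z) at_infinity sequentially"
    by (rule tendsto_add_filterlim_at_infinity'[OF X tendsto_const])
  then have "(\<lambda>j. inverse (X j + z)) \<longlonglongrightarrow> 0" by (rule filterlim_compose[OF tendsto_inverse_0])
  then have "(\<lambda>j. inverse (X j + z) ^ Suc n) \<longlonglongrightarrow> 0 ^ Suc n" by (rule tendsto_power)
  then show "(\<lambda>j. 1 / (X j + z) ^ Suc n) \<longlonglongrightarrow> 0" by (simp add: power_inverse divide_inverse)
qed

lemma dint_pole_at_0:
  assumes k: "0 < k" "k \<le> 1" "\<And>j. k * cmod (X j) \<le> Re (X j)" and X: "X \<longlonglongrightarrow> 0"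
  shows "(\<lambda>j. dint (\<lambda>z. 1 / (X j + z) ^ Suc n)) \<longlonglongrightarrow> dint (\<lambda>z. 1 / z ^ Suc n)"
proof -
  let ?c = "(1 + 1 / k) ^ Suc n"
  have a1: "admissible ?c (\<lambda>z. 1 / (X j + z) ^ Suc n)" for j by (rule admissible_pole[OF k(1,3)])
  have a2: "admissible ?c (\<lambda>z. 1 / z ^ Suc n)" using admissible_pole[of k 0] k by simp
  have "(\<lambda>j. dint (\<lambda>z. 1 / (X j + z) ^ Suc n - 1 / z ^ Suc n)) \<longlonglongrightarrow> 0"
  proof (rule dint_dominated)
    show "admissible (?c + ?c) (\<lambda>z. 1 / (X j + z) ^ Suc n - 1 / z ^ Suc n)" for j
      by (rule admissible_diff[OF a1 a2])
    fix z :: complex assume z: "0 < Re z"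
    then have "(\<lambda>j. 1 / (X j + z) ^ Suc n - 1 / z ^ Suc n) \<longlonglongrightarrow> 1 / (0 + z) ^ Suc n - 1 / z ^ Suc n"
      by (intro tendsto_intros X) auto
    then show "(\<lambda>j. 1 / (X j + z) ^ Suc n - 1 / z ^ Suc n) \<longlonglongrightarrow> 0" by simp
  qed
  then have "(\<lambda>j. dint (\<lambda>z. 1 / (X j + z) ^ Suc n) - dint (\<lambda>z. 1 / z ^ Suc n)) \<longlonglongrightarrow> 0"
    by (simp only: dint_diff[OF a1 a2])
  then show ?thesis by (rule Lim_null[THEN iffD2])
qed

text \<open>Letting \<mu> go to infinity in a sector, where the pole integrals vanish, identifies
  the constant of \<open>reproducing_formula\<close>. Letting \<mu> go to 0 extends the formula to
  \<mu> = 0, which may belong to the spectrum. In the sector of angle \<psi> the cone constant is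
  cos \<psi>.\<close>

lemma fval_eq:
  assumes "\<mu> = 0 \<or> 0 < Re \<mu>"
  shows "fval f \<mu> = f_infty f - (2 ^ n / pi) * dint (\<lambda>z. 1 / (\<mu> + z) ^ Suc n)"
proof -
  obtain C where C: "\<And>\<mu>. 0 < Re \<mu> \<Longrightarrow> f \<mu> = C - (2 ^ n / pi) * dint (\<lambda>z. 1 / (\<mu> + z) ^ Suc n)"
    using reproducing_formula by blast
  have cone: "0 < Re z" "0 < cos \<psi>" "cos \<psi> * cmod z \<le> Re z" if "z \<in> sector \<psi>" "0 < \<psi>" "\<psi> < pi/2" for z \<psi>
  proof -
    show c: "0 < cos \<psi>" using that by (intro cos_gt_zero_pi) auto
    show r: "cos \<psi> * cmod z \<le> Re z" using that by (intro sector_Re) auto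
    have "0 < cos \<psi> * cmod z" using c that by (auto simp: sector_def)
    then show "0 < Re z" using r by linarith
  qed
  have inf: "(f \<longlongrightarrow> C) (inf at_infinity (principal (sector \<psi>)))" if \<psi>: "0 < \<psi>" "\<psi> < pi/2" for \<psi>
  proof (rule tendsto_at_infinity_sequentially)
    fix X assume X: "\<And>j. X j \<in> sector \<psi>" "filterlim X at_infinity sequentially"
    have "(\<lambda>j. C - (2 ^ n / pi) * dint (\<lambda>z. 1 / (X j + z) ^ Suc n)) \<longlonglongrightarrow> C - complex_of_real (2 ^ n / pi) * 0"
      by (intro tendsto_diff tendsto_mult tendsto_const dint_pole_at_infinity[OF _ _ X(2), of "cos \<psi>"] cone(2,3)[OF X(1) \<psi>])
    then show "(\<lambda>j. f (X j)) \<longlonglongrightarrow> C" using C[OF cone(1)[OF X(1) \<psi>]] by simp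
  qed
  have zero: "(f \<longlongrightarrow> C - (2 ^ n / pi) * dint (\<lambda>z. 1 / z ^ Suc n)) (at 0 within sector \<psi>)" if \<psi>: "0 < \<psi>" "\<psi> < pi/2" for \<psi>
    unfolding tendsto_at_iff_sequentially
  proof (intro allI impI)
    fix X assume X: "\<forall>i. X i \<in> sector \<psi> - {0}" "X \<longlonglongrightarrow> 0"
    have "(\<lambda>j. C - (2 ^ n / pi) * dint (\<lambda>z. 1 / (X j + z) ^ Suc n)) \<longlonglongrightarrow> C - (2 ^ n / pi) * dint (\<lambda>z. 1 / z ^ Suc n)"
      using X by (intro tendsto_diff tendsto_mult tendsto_const dint_pole_at_0[OF _ _ _ X(2), of "cos \<psi>"] cone(2,3)[OF _ \<psi>]) auto
    moreover have "f (X j) = C - (2 ^ n / pi) * dint (\<lambda>z. 1 / (X j + z) ^ Suc n)" for j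
      using X by (intro C cone(1)[OF _ \<psi>]) auto
    ultimately show "(f \<circ> X) \<longlonglongrightarrow> C - (2 ^ n / pi) * dint (\<lambda>z. 1 / z ^ Suc n)" by (simp add: o_def)
  qed
  \<comment> \<open>One sector suffices for uniqueness of both limits, once it is seen to accumulate
    at infinity and at 0.\<close>
  have pi4: "0 < pi/4" "pi/4 < pi/2" by auto
  have f_inf: "f_infty f = C" unfolding f_infty_def
  proof (rule the_equality)
    fix L assume "\<forall>\<psi>. 0 < \<psi> \<and> \<psi> < pi/2 \<longrightarrow> (f \<longlongrightarrow> L) (inf at_infinity (principal (sector \<psi>)))"
    then have L: "(f \<longlongrightarrow> L) (inf at_infinity (principal (sector (pi/4))))" using pi4 by blast
    have "inf at_infinity (principal (sector (pi/4))) \<noteq> bot"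
    proof
      assume "inf at_infinity (principal (sector (pi/4))) = bot"
      then have "\<forall>\<^sub>F x in inf at_infinity (principal (sector (pi/4))). False" by simp
      then obtain b where "\<And>x::complex. b \<le> norm x \<Longrightarrow> x \<notin> sector (pi/4)"
        unfolding eventually_inf_principal eventually_at_infinity by blast
      moreover have "b \<le> cmod (of_real (\<bar>b\<bar> + 1))" unfolding norm_of_real by linarith
      moreover have "0 < \<bar>b\<bar> + 1" by linarith
      ultimately show False using of_real_in_sector[OF pi4(1)] by blast
    qed
    then show "L = C" using tendsto_unique L inf[OF pi4] by blast
  qed (use inf in blast)
  have f_0: "f_zero f = C - (2 ^ n / pi) * dint (\<lambda>z. 1 / z ^ Suc n)" unfolding f_zero_def
  proof (rule the_equality)
    fix L assume "\<forall>\<psi>. 0 < \<psi> \<and> \<psi> < pi/2 \<longrightarrow> (f \<longlongrightarrow> L) (at 0 within sector \<psi>)"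
    then have L: "(f \<longlongrightarrow> L) (at 0 within sector (pi/4))" using pi4 by blast
    have "(0::complex) islimpt sector (pi/4)"
      unfolding islimpt_approachable
    proof (intro allI impI)
      fix e :: real assume "0 < e"
      then show "\<exists>x'\<in>sector (pi/4). x' \<noteq> 0 \<and> dist x' 0 < e"
        using of_real_in_sector[OF pi4(1), of "e/2"] by (intro bexI[of _ "complex_of_real (e/2)"]) auto
    qed
    then have "at 0 within sector (pi/4) \<noteq> bot" by (simp add: trivial_limit_within)
    then show "L = C - (2 ^ n / pi) * dint (\<lambda>z. 1 / z ^ Suc n)" using tendsto_unique L zero[OF pi4] by blast
  qed (use zero in blast)
  show ?thesis using assms f_inf f_0 C[of \<mu>] by (auto simp: fval_def)
qed

text \<open>Cutting off \<open>N\<close> where it is large makes it admissible, at a cost that tends to 0 by dominated convergence.\<close>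

lemma dint_factor_approx:
  fixes N :: "complex \<Rightarrow> 'b::complex_banach_algebra"
  assumes adm: "admissible c (\<lambda>z. X * N z)" and N: "continuous_on {z. 0 < Re z} N" and "e > 0"
  obtains C where "norm (dint (\<lambda>z. X * N z) - X * C) < e"
    "\<And>Y. (\<And>z. 0 < Re z \<Longrightarrow> Y * N z = N z * Y) \<Longrightarrow> Y * C = C * Y"
proof -
  let ?L = "\<lambda>z. X * N z"
  \<comment> \<open>Continuous, with values in [0, 1], equal to 1 at any given point for large j,
    and small enough that \<open>cut j z\<close> times norm (N z) is at most j / |z|^(n+1).\<close>
  define cut where "cut = (\<lambda>j::nat. \<lambda>z. min 1 (real j / (1 + norm (N z) * cmod z ^ Suc n)))"
  have pos: "1 + norm (N z) * cmod z ^ Suc n > 0" for z by (simp add: add_pos_nonneg)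
  have c01: "0 \<le> cut j z" "cut j z \<le> 1" for j z using less_imp_le[OF pos] by (auto simp: cut_def)
  have c_cont: "continuous_on {z. 0 < Re z} (cut j)" for j unfolding cut_def
    using pos by (intro continuous_intros N) (metis less_irrefl)
  have c0: "0 \<le> c" using admissible_nonneg[OF adm] .
  have Lcont: "continuous_on {z. 0 < Re z} ?L" and Lle: "\<And>z. 0 < Re z \<Longrightarrow> norm (?L z) \<le> c / cmod z ^ Suc n"
    using adm by (auto simp: admissible_def)
  have a1: "admissible (real j) (\<lambda>z. of_real (cut j z) *\<^sub>C N z)" for j
    unfolding admissible_def
  proof (intro conjI allI impI)
    show "continuous_on {z. 0 < Re z} (\<lambda>z. of_real (cut j z) *\<^sub>C N z)" by (intro continuous_intros c_cont N)
    fix z assume z: "0 < Re z"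
    have z0: "cmod z ^ Suc n > 0" using z by (intro zero_less_power) auto
    have "norm (of_real (cut j z) *\<^sub>C N z) = cut j z * norm (N z)" using c01[of j z] by (simp add: norm_scaleC)
    also have "\<dots> \<le> real j / (1 + norm (N z) * cmod z ^ Suc n) * norm (N z)"
      unfolding cut_def by (intro mult_right_mono) auto
    also have "\<dots> = real j * (norm (N z) / (1 + norm (N z) * cmod z ^ Suc n))" by simp
    also have "\<dots> \<le> real j * (1 / cmod z ^ Suc n)"
    proof (rule mult_left_mono)
      have "norm (N z) * cmod z ^ Suc n \<le> 1 * (1 + norm (N z) * cmod z ^ Suc n)" by simp
      then show "norm (N z) / (1 + norm (N z) * cmod z ^ Suc n) \<le> 1 / cmod z ^ Suc n"
        using pos[of z] z0 by (simp only: pos_divide_le_eq pos_le_divide_eq times_divide_eq_left)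
    qed simp
    also have "\<dots> = real j / cmod z ^ Suc n" by simp
    finally show "norm (of_real (cut j z) *\<^sub>C N z) \<le> real j / cmod z ^ Suc n" .
  qed
  have sc: "X * (of_real (cut j z) *\<^sub>C N z) = of_real (cut j z) *\<^sub>C ?L z" for j z by (simp add: scaleC_mult_right)
  have scaled: "admissible c (\<lambda>z. of_real (s z) *\<^sub>C ?L z)" if s: "continuous_on {z. 0 < Re z} s" "\<And>z. 0 \<le> s z" "\<And>z. s z \<le> 1" for s
    unfolding admissible_def
  proof (intro conjI allI impI)
    show "continuous_on {z. 0 < Re z} (\<lambda>z. of_real (s z) *\<^sub>C ?L z)" by (intro continuous_intros s Lcont)
    fix z assume z: "0 < Re z"
    have "norm (of_real (s z) *\<^sub>C ?L z) \<le> 1 * norm (?L z)" unfolding norm_scaleC using s(2,3)[of z] by (intro mult_right_mono) auto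
    then show "norm (of_real (s z) *\<^sub>C ?L z) \<le> c / cmod z ^ Suc n" using Lle[OF z] by simp
  qed
  have a2: "admissible c (\<lambda>z. X * (of_real (cut j z) *\<^sub>C N z))" for j
    unfolding sc by (intro scaled c_cont c01)
  have a3: "admissible c (\<lambda>z. ?L z - X * (of_real (cut j z) *\<^sub>C N z))" for j
  proof -
    have "?L z - X * (of_real (cut j z) *\<^sub>C N z) = of_real (1 - cut j z) *\<^sub>C ?L z" for z
      by (simp add: sc scaleC_diff_left scaleC_one)
    then show ?thesis using scaled[of "\<lambda>z. 1 - cut j z"] c01 c_cont by (simp add: continuous_on_diff)
  qed
  have "(\<lambda>j. dint (\<lambda>z. ?L z - X * (of_real (cut j z) *\<^sub>C N z))) \<longlonglongrightarrow> 0"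
  proof (rule dint_dominated[OF a3])
    fix z :: complex
    have "\<forall>\<^sub>F j in sequentially. 1 + norm (N z) * cmod z ^ Suc n \<le> real j"
      using filterlim_real_sequentially unfolding filterlim_at_top by blast
    then have "\<forall>\<^sub>F j in sequentially. ?L z - X * (of_real (cut j z) *\<^sub>C N z) = 0"
    proof eventually_elim
      case (elim j)
      then have "cut j z = 1" using pos[of z] by (simp add: cut_def min_def del: power_Suc)
      then show ?case by (simp add: scaleC_one)
    qed
    then show "(\<lambda>j. ?L z - X * (of_real (cut j z) *\<^sub>C N z)) \<longlonglongrightarrow> 0" by (rule tendsto_eventually)
  qed
  then obtain j where j: "norm (dint (\<lambda>z. ?L z - X * (of_real (cut j z) *\<^sub>C N z))) < e"
    using \<open>e > 0\<close> by (auto simp: lim_sequentially dist_norm)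
  show ?thesis
  proof (rule that[of "dint (\<lambda>z. of_real (cut j z) *\<^sub>C N z)"])
    show "norm (dint ?L - X * dint (\<lambda>z. of_real (cut j z) *\<^sub>C N z)) < e"
      using j unfolding dint_diff[OF adm a2]
        dint_linear[OF bounded_linear_mult_right scaleC_mult_right a1] .
    fix Y assume Y: "\<And>z. 0 < Re z \<Longrightarrow> Y * N z = N z * Y"
    have "Y * dint (\<lambda>z. of_real (cut j z) *\<^sub>C N z) = dint (\<lambda>z. Y * (of_real (cut j z) *\<^sub>C N z))"
      by (rule dint_linear[OF bounded_linear_mult_right scaleC_mult_right a1, symmetric])
    also have "\<dots> = dint (\<lambda>z. (of_real (cut j z) *\<^sub>C N z) * Y)"
      by (rule dint_cong) (simp add: scaleC_mult Y)
    also have "\<dots> = dint (\<lambda>z. of_real (cut j z) *\<^sub>C N z) * Y"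
      by (rule dint_linear[OF bounded_linear_mult_left scaleC_mult_left a1])
    finally show "Y * dint (\<lambda>z. of_real (cut j z) *\<^sub>C N z) = dint (\<lambda>z. of_real (cut j z) *\<^sub>C N z) * Y" .
  qed
qed

end

section \<open>Resolvents and the spectral mapping theorem\<close>

text \<open>Passing from s to t multiplies the integrand by (\<alpha>^2 / (\<alpha>^2 +
  \<beta>^2))^((t-s)/2) \<le> 1. This provides the natural index in \<open>fD\<close>.\<close>

lemma Dclass_mono:
  assumes "s \<le> t" "f \<in> Dclass s"
  shows "f \<in> Dclass t"
proof -
  have le: "\<alpha> powr t * a / (\<alpha>\<^sup>2 + \<beta>\<^sup>2) powr ((t + 1) / 2) \<le> \<alpha> powr s * a / (\<alpha>\<^sup>2 + \<beta>\<^sup>2) powr ((s + 1) / 2)"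
    if "0 < \<alpha>" "0 \<le> a" for \<alpha> \<beta> a :: real
  proof -
    define r where "r = \<alpha>\<^sup>2 + \<beta>\<^sup>2"
    have r: "0 < r" "\<alpha>\<^sup>2 \<le> r" using that by (auto simp: r_def add_pos_nonneg)
    have "(\<alpha>\<^sup>2) powr ((t - s) / 2) = (\<alpha> powr 2) powr ((t - s) / 2)" using that by simp
    also have "\<dots> = \<alpha> powr (t - s)" unfolding powr_powr by (simp add: diff_divide_distrib)
    finally have "\<alpha> powr t = \<alpha> powr s * (\<alpha>\<^sup>2) powr ((t - s) / 2)"
      by (simp add: powr_add[symmetric])
    also have "\<dots> \<le> \<alpha> powr s * r powr ((t - s) / 2)"
      using assms r that by (intro mult_left_mono powr_mono2) auto
    finally have "\<alpha> powr t * a / r powr ((t + 1) / 2) \<le> \<alpha> powr s * r powr ((t - s) / 2) * a / r powr ((t + 1) / 2)"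
      using that by (intro divide_right_mono mult_right_mono) auto
    moreover have "r powr ((t + 1) / 2) = r powr ((s + 1) / 2) * r powr ((t - s) / 2)"
      unfolding powr_add[symmetric] by (rule arg_cong[of _ _ "(powr) r"]) (simp add: field_simps)
    moreover have "\<alpha> powr s * r powr ((t - s) / 2) * a / (r powr ((s + 1) / 2) * r powr ((t - s) / 2)) =
      \<alpha> powr s * a / r powr ((s + 1) / 2)" using r(1) by simp
    ultimately show ?thesis unfolding r_def[symmetric] by simp
  qed
  have "(\<integral>\<^sup>+ \<alpha>. (\<integral>\<^sup>+ \<beta>. ennreal (\<alpha> powr t * cmod (deriv f (Complex \<alpha> \<beta>)) / (\<alpha>\<^sup>2 + \<beta>\<^sup>2) powr ((t + 1) / 2)) \<partial>lborel) * indicator {0<..} \<alpha> \<partial>lborel)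
     \<le> (\<integral>\<^sup>+ \<alpha>. (\<integral>\<^sup>+ \<beta>. ennreal (\<alpha> powr s * cmod (deriv f (Complex \<alpha> \<beta>)) / (\<alpha>\<^sup>2 + \<beta>\<^sup>2) powr ((s + 1) / 2)) \<partial>lborel) * indicator {0<..} \<alpha> \<partial>lborel)"
    by (intro nn_integral_mono) (auto simp: indicator_def intro!: nn_integral_mono ennreal_leI le)
  then show ?thesis using assms(2) by (auto simp: Dclass_def)
qed

lemma Dinf_imp_nat: "f \<in> Dinf \<Longrightarrow> \<exists>n::nat. f \<in> Dclass (real n)"
  using Dclass_mono real_arch_simple unfolding Dinf_def by blast

lemma norm_cop_bound: "0 \<le> K \<Longrightarrow> (\<And>x. norm (cop_app T x) \<le> K * norm x) \<Longrightarrow> norm T \<le> K"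
  by transfer (rule norm_blinfun_bound)

lemma scaleC_cancel: "c *\<^sub>C x = c *\<^sub>C y \<longleftrightarrow> c = 0 \<or> x = (y::'a::complex_banach)"
proof
  assume "c *\<^sub>C x = c *\<^sub>C y"
  then have "inverse c *\<^sub>C (c *\<^sub>C x) = inverse c *\<^sub>C (c *\<^sub>C y)" by simp
  then show "c = 0 \<or> x = y" by (cases "c = 0") (simp_all add: scaleC_scaleC scaleC_one)
qed auto

text \<open>The resolvent as an element of the operator algebra, given by its two inverse
  properties, so that computations avoid the definite description in \<open>res\<close>.\<close>

definition is_res :: "'a::complex_banach set \<Rightarrow> ('a \<Rightarrow> 'a) \<Rightarrow> complex \<Rightarrow> 'a cop \<Rightarrow> bool" where
  "is_res D A z T \<longleftrightarrow> (\<forall>y. cop_app T y \<in> D \<and> z *\<^sub>C cop_app T y + A (cop_app T y) = y) \<and>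
     (\<forall>u\<in>D. cop_app T (z *\<^sub>C u + A u) = u)"

lemma is_res_res:
  assumes "is_res D A z T"
  shows "res D A z y = cop_app T y"
  unfolding res_def
proof (rule the_equality)
  show "cop_app T y \<in> D \<and> z *\<^sub>C cop_app T y + A (cop_app T y) = y" using assms by (auto simp: is_res_def)
  show "u = cop_app T y" if "u \<in> D \<and> z *\<^sub>C u + A u = y" for u
    using assms that by (auto simp: is_res_def)
qed

lemma is_res_inv_ok:
  assumes "is_res D A z T"
  shows "inv_ok D A z"
  unfolding inv_ok_def is_res_res[OF assms]
proof
  show "\<forall>y. \<exists>!u. u \<in> D \<and> z *\<^sub>C u + A u = y" using assms unfolding is_res_def by metis
  show "\<exists>K. \<forall>y. norm (cop_app T y) \<le> K * norm y" using norm_cop_app by blast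
qed

lemma inv_ok_is_res:
  assumes D: "csubspace D" and A: "clinear_on D A" and ok: "inv_ok D A z"
  obtains T where "is_res D A z T"
proof -
  let ?r = "res D A z"
  have ex1: "\<exists>!u. u \<in> D \<and> z *\<^sub>C u + A u = y" for y using ok by (simp add: inv_ok_def)
  have r: "?r y \<in> D" "z *\<^sub>C ?r y + A (?r y) = y" for y
    using theI'[OF ex1[of y]] by (auto simp: res_def)
  have uniq: "?r (z *\<^sub>C u + A u) = u" if "u \<in> D" for u
    using ex1[of "z *\<^sub>C u + A u"] r[of "z *\<^sub>C u + A u"] that by blast
  have add: "?r (x + y) = ?r x + ?r y" for x y
  proof -
    have "z *\<^sub>C (?r x + ?r y) + A (?r x + ?r y) = (z *\<^sub>C ?r x + A (?r x)) + (z *\<^sub>C ?r y + A (?r y))"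
      using A r(1) by (simp add: clinear_on_def scaleC_add_right)
    also have "\<dots> = x + y" by (simp add: r)
    finally show ?thesis using uniq[of "?r x + ?r y"] D r(1) by (simp add: csubspace_def)
  qed
  have sc: "?r (c *\<^sub>C x) = c *\<^sub>C ?r x" for c x
  proof -
    have "z *\<^sub>C (c *\<^sub>C ?r x) + A (c *\<^sub>C ?r x) = c *\<^sub>C (z *\<^sub>C ?r x + A (?r x))"
      using A r(1) by (simp add: clinear_on_def scaleC_add_right scaleC_scaleC mult.commute)
    also have "\<dots> = c *\<^sub>C x" by (simp add: r)
    finally show ?thesis using uniq[of "c *\<^sub>C ?r x"] D r(1) by (simp add: csubspace_def)
  qed
  obtain K where "\<And>y. norm (?r y) \<le> K * norm y" using ok by (auto simp: inv_ok_def)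
  from cop_exists[of ?r, OF add sc this] obtain T where "\<And>y. cop_app T y = ?r y" by metis
  then show ?thesis using that[of T] r uniq by (simp add: is_res_def)
qed

lemma resolvent_identity:
  assumes "is_res D A z S" "is_res D A w T"
  shows "S - T = (w - z) *\<^sub>C (S * T)"
proof (rule cop_eqI)
  fix y
  define u where "u = cop_app T y"
  have u: "u \<in> D" "w *\<^sub>C u + A u = y" using assms(2) by (auto simp: is_res_def u_def)
  have "u = cop_app S (z *\<^sub>C u + A u)" using assms(1) u by (simp add: is_res_def)
  also have "z *\<^sub>C u + A u = y - (w - z) *\<^sub>C u" using u(2) by (simp add: scaleC_diff_left algebra_simps)
  also have "cop_app S \<dots> = cop_app S y - (w - z) *\<^sub>C cop_app S u" by (simp add: cop_app_arg_simps)
  finally have "u = cop_app S y - (w - z) *\<^sub>C cop_app S u" .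
  then have "cop_app S y - u = (w - z) *\<^sub>C cop_app S u" by (metis add_diff_cancel_left' diff_add_cancel)
  then show "cop_app (S - T) y = cop_app ((w - z) *\<^sub>C (S * T)) y"
    by (simp add: cop_app_simps u_def)
qed

lemma commutes_mult:
  fixes Y S T :: "'b::complex_banach_algebra"
  assumes "Y * S = S * Y" "Y * T = T * Y"
  shows "Y * (S * T) = (S * T) * Y"
proof -
  have "Y * (S * T) = S * (Y * T)" by (simp only: assms(1) mult.assoc[symmetric])
  then show ?thesis by (simp only: assms(2) mult.assoc)
qed

lemma commutes_power:
  fixes Y S :: "'b::complex_banach_algebra"
  assumes "Y * S = S * Y"
  shows "Y * S ^ k = S ^ k * Y"
proof (induction k)
  case (Suc k)
  then show ?case using commutes_mult[OF assms Suc] by simp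
qed simp

text \<open>The sum of S^(m-k) q^k over k \<le> m, the cofactor of S - q in S^(m+1) -
  q^(m+1).\<close>

primrec geo :: "nat \<Rightarrow> 'b::complex_banach_algebra \<Rightarrow> complex \<Rightarrow> 'b" where
  "geo 0 S q = 1"
| "geo (Suc m) S q = S * geo m S q + q ^ Suc m *\<^sub>C 1"

lemma geo_commute: "Y * S = S * Y \<Longrightarrow> Y * geo m S q = geo m S q * Y"
proof (induction m)
  case (Suc m)
  show ?case using commutes_mult[OF Suc.prems Suc.IH[OF Suc.prems]]
    by (simp add: scaleC_ring_distribs)
qed simp

lemma geo_factor: "S ^ Suc m - q ^ Suc m *\<^sub>C 1 = (S - q *\<^sub>C 1) * geo m S q"
proof (induction m)
  case (Suc m)
  have "(S - q *\<^sub>C 1) * geo (Suc m) S q = S * ((S - q *\<^sub>C 1) * geo m S q) + q ^ Suc m *\<^sub>C S - q ^ Suc (Suc m) *\<^sub>C 1"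
    by (simp add: algebra_simps scaleC_mult scaleC_scaleC scaleC_add_right scaleC_diff_right)
  also have "\<dots> = S ^ Suc (Suc m) - q ^ Suc (Suc m) *\<^sub>C 1"
    unfolding Suc[symmetric] by (simp add: right_diff_distrib scaleC_mult_right)
  finally show ?case by simp
qed simp

lemma geo_continuous:
  assumes "continuous_on Z S" "continuous_on Z q"
  shows "continuous_on Z (\<lambda>z. geo m (S z) (q z))"
  by (induction m) (use assms in \<open>auto intro!: continuous_intros\<close>)

section \<open>Resolvents of a sectorial operator and the spectrum of R\<close>

locale sectorial =
  fixes D :: "'a::complex_banach set" and A :: "'a \<Rightarrow> 'a"
  assumes sect: "sect_op D A"
begin

lemma csub: "csubspace D" and clin: "clinear_on D A"
  using sect by (auto simp: sect_op_def)

text \<open>The inequality cos \<theta> |\<mu>| \<le> Re \<mu> defines a closed set containing the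
  sector, and cos \<theta> > 0.\<close>

lemma spec_subset:
  assumes "\<mu> \<in> spec D A"
  shows "\<mu> = 0 \<or> 0 < Re \<mu>"
proof -
  obtain \<theta> where \<theta>: "0 \<le> \<theta>" "\<theta> < pi/2" "spec D A \<subseteq> closure (sector \<theta>)" using sect by (auto simp: sect_op_def)
  have "closed {z. cos \<theta> * cmod z \<le> Re z}" by (intro closed_Collect_le continuous_intros)
  moreover have "sector \<theta> \<subseteq> {z. cos \<theta> * cmod z \<le> Re z}" using \<theta> by (auto intro!: sector_Re)
  ultimately have "closure (sector \<theta>) \<subseteq> {z. cos \<theta> * cmod z \<le> Re z}" by (rule closure_minimal[rotated])
  then have le: "cos \<theta> * cmod \<mu> \<le> Re \<mu>" using assms \<theta>(3) by auto
  have "0 < cos \<theta>" using \<theta> by (intro cos_gt_zero_pi) auto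
  then show ?thesis using le by (cases "\<mu> = 0") (auto intro: less_le_trans[of 0 "cos \<theta> * cmod \<mu>"])
qed

definition Rz :: "complex \<Rightarrow> 'a cop" where "Rz z = (SOME T. is_res D A z T)"

lemma
  shows is_res_Rz: "0 < Re z \<Longrightarrow> is_res D A z (Rz z)"
    and Rz_bound: "\<exists>M\<ge>0. \<forall>z. 0 < Re z \<longrightarrow> norm (Rz z) \<le> M / cmod z"
proof -
  obtain \<theta> where \<theta>: "0 \<le> \<theta>" "\<theta> < pi/2"
    "\<forall>\<phi>\<in>{\<theta><..pi}. \<exists>M. \<forall>z\<in>sector (pi - \<phi>). inv_ok D A z \<and> (\<forall>y. norm (z *\<^sub>C res D A z y) \<le> M * norm y)"
    using sect by (auto simp: sect_op_def)
  \<comment> \<open>This angle is available because \<theta> < pi/2, and its complementary sector is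
    the whole open right half-plane.\<close>
  have "pi/2 \<in> {\<theta><..pi}" using \<theta> by auto
  then obtain M where M: "\<forall>z\<in>sector (pi - pi/2). inv_ok D A z \<and> (\<forall>y. norm (z *\<^sub>C res D A z y) \<le> M * norm y)"
    using \<theta>(3) by blast
  have sec: "z \<in> sector (pi - pi/2)" if "0 < Re z" for z
    using that Arg_Re_pos[of z] by (auto simp: sector_def)
  show isr: "is_res D A z (Rz z)" if z: "0 < Re z" for z
  proof -
    obtain T where "is_res D A z T" using inv_ok_is_res[OF csub clin] M sec[OF z] by blast
    then show ?thesis unfolding Rz_def by (rule someI)
  qed
  show "\<exists>M\<ge>0. \<forall>z. 0 < Re z \<longrightarrow> norm (Rz z) \<le> M / cmod z"
  proof (intro exI[of _ "max 0 M"] conjI allI impI)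
    fix z :: complex assume z: "0 < Re z"
    then have z0: "cmod z > 0" by auto
    show "norm (Rz z) \<le> max 0 M / cmod z"
    proof (rule norm_cop_bound)
      fix y
      have "cmod z * norm (cop_app (Rz z) y) \<le> M * norm y"
        using M sec[OF z] is_res_res[OF isr[OF z]] by (metis norm_scaleC)
      also have "\<dots> \<le> max 0 M * norm y" by (intro mult_right_mono) auto
      finally show "norm (cop_app (Rz z) y) \<le> max 0 M / cmod z * norm y" using z0 by (simp add: field_simps)
    qed (use z0 in auto)
  qed simp
qed

lemma Rz_continuous: "continuous_on {z. 0 < Re z} Rz"
  unfolding continuous_on_def
proof
  obtain M where M: "M \<ge> 0" "\<And>z. 0 < Re z \<Longrightarrow> norm (Rz z) \<le> M / cmod z" using Rz_bound by blast
  fix v :: complex assume "v \<in> {z. 0 < Re z}"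
  then have v: "0 < Re v" by simp
  have ev: "\<forall>\<^sub>F z in at v within {z. 0 < Re z}. norm (Rz z - Rz v) \<le> cmod (v - z) * ((M / cmod z) * (M / cmod v))"
    unfolding eventually_at_filter
  proof (rule always_eventually, intro allI impI)
    fix z assume "z \<in> {z. 0 < Re z}"
    then have z: "0 < Re z" by simp
    have "norm (Rz z - Rz v) = cmod (v - z) * norm (Rz z * Rz v)"
      using resolvent_identity[OF is_res_Rz[OF z] is_res_Rz[OF v]] by (simp add: norm_scaleC)
    also have "\<dots> \<le> cmod (v - z) * (norm (Rz z) * norm (Rz v))" by (intro mult_left_mono norm_mult_ineq) simp
    also have "\<dots> \<le> cmod (v - z) * ((M / cmod z) * (M / cmod v))"
      using M z v by (intro mult_left_mono mult_mono) auto
    finally show "norm (Rz z - Rz v) \<le> cmod (v - z) * ((M / cmod z) * (M / cmod v))" .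
  qed
  have "((\<lambda>z. cmod (v - z) * ((M / cmod z) * (M / cmod v))) \<longlongrightarrow> cmod (v - v) * ((M / cmod v) * (M / cmod v))) (at v within {z. 0 < Re z})"
    using v by (intro tendsto_intros) auto
  then have "((\<lambda>z. cmod (v - z) * ((M / cmod z) * (M / cmod v))) \<longlongrightarrow> 0) (at v within {z. 0 < Re z})" by simp
  from Lim_null_comparison[OF ev this] have "((\<lambda>z. Rz z - Rz v) \<longlongrightarrow> 0) (at v within {z. 0 < Re z})" .
  then show "(Rz \<longlongrightarrow> Rz v) (at v within {z. 0 < Re z})" by (rule Lim_null[THEN iffD2])
qed

lemma Rz_power_continuous: "continuous_on {z. 0 < Re z} (\<lambda>z. Rz z ^ k)"
  by (induction k) (auto intro!: continuous_intros Rz_continuous)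

abbreviation R :: "'a cop" where "R \<equiv> Rz 1"

lemma is_res_R: "is_res D A 1 R" by (rule is_res_Rz) simp

lemma Rz_R: "0 < Re z \<Longrightarrow> Rz z = R + (1 - z) *\<^sub>C (R * Rz z)"
  using resolvent_identity[OF is_res_R is_res_Rz[of z]] by (simp add: algebra_simps scaleC_diff_left)

lemma Rz_R': "0 < Re z \<Longrightarrow> Rz z = R + (1 - z) *\<^sub>C (Rz z * R)"
  using resolvent_identity[OF is_res_Rz[of z] is_res_R] by (simp add: algebra_simps)

text \<open>By the resolvent identity 1 + (z - 1) R and 1 + (1 - z) Rz are inverse to each other, so
  whatever commutes with the first commutes with the second; for z \<noteq> 1 this isolates
  \<open>Rz z\<close>.\<close>

lemma commutes_Rz:
  assumes Y: "Y * R = R * Y" and z: "0 < Re z"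
  shows "Y * Rz z = Rz z * Y"
proof (cases "z = 1")
  case False
  define P Q where "P = 1 + (z - 1) *\<^sub>C R" and "Q = 1 + (1 - z) *\<^sub>C Rz z"
  have sub: "(1 - z) *\<^sub>C (R * Rz z) = Rz z - R" "(1 - z) *\<^sub>C (Rz z * R) = Rz z - R"
    using Rz_R[OF z] Rz_R'[OF z] by (metis add_diff_cancel_left')+
  have m: "(z - 1) *\<^sub>C x = - ((1 - z) *\<^sub>C x)" for x :: "'a cop" by (simp add: scaleC_minus_left[symmetric])
  have "P * Q = 1 + (z - 1) *\<^sub>C R + (1 - z) *\<^sub>C Rz z + (z - 1) *\<^sub>C ((1 - z) *\<^sub>C (R * Rz z))"
    unfolding P_def Q_def
    by (simp add: scaleC_ring_distribs scaleC_add_right scaleC_scaleC mult.commute)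
  then have PQ: "P * Q = 1" unfolding sub by (simp add: m scaleC_diff_right)
  have "Q * P = 1 + (z - 1) *\<^sub>C R + (1 - z) *\<^sub>C Rz z + (z - 1) *\<^sub>C ((1 - z) *\<^sub>C (Rz z * R))"
    unfolding P_def Q_def
    by (simp add: scaleC_ring_distribs scaleC_add_right scaleC_scaleC mult.commute)
  then have QP: "Q * P = 1" unfolding sub by (simp add: m scaleC_diff_right)
  have "Y * P = P * Y" unfolding P_def by (simp add: scaleC_ring_distribs Y)
  from commutes_inverse[OF PQ QP this] have "(1 - z) *\<^sub>C (Y * Rz z) = (1 - z) *\<^sub>C (Rz z * Y)"
    unfolding Q_def by (simp add: scaleC_ring_distribs)
  then show ?thesis using False by (simp add: scaleC_cancel)
qed (use Y in simp)

text \<open>With \<rho> = 1/(1 + \<mu>), the identity R - \<rho> = -\<rho> (A - \<mu>) R suggests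
  the inverse -(1 + \<mu>)(1 + (1 + \<mu>)(A - \<mu>)^-1).\<close>

lemma resolvent_imp_inverse:
  assumes "1 + \<mu> \<noteq> 0" "\<mu> \<notin> spec D A"
  obtains V where "V * (R - (1 / (1 + \<mu>)) *\<^sub>C 1) = 1" "(R - (1 / (1 + \<mu>)) *\<^sub>C 1) * V = 1"
proof -
  obtain T where T: "is_res D A (- \<mu>) T" using inv_ok_is_res[OF csub clin] assms(2) by (auto simp: spec_def)
  let ?\<rho> = "1 / (1 + \<mu>)"
  have e: "(1 + \<mu>) *\<^sub>C (R * T) = T - R" "(1 + \<mu>) *\<^sub>C (T * R) = T - R"
    using resolvent_identity[OF is_res_R T] resolvent_identity[OF T is_res_R]
    by (simp_all add: scaleC_minus_left scaleC_diff_left algebra_simps scaleC_add_left)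
  have r: "?\<rho> *\<^sub>C ((1 + \<mu>) *\<^sub>C x) = x" "(1 + \<mu>) *\<^sub>C (?\<rho> *\<^sub>C x) = x" for x :: "'a cop"
    using assms(1) by (simp_all add: scaleC_scaleC scaleC_one)
  define Q where "Q = 1 + (1 + \<mu>) *\<^sub>C T"
  have "Q * (R - ?\<rho> *\<^sub>C 1) = R + (1 + \<mu>) *\<^sub>C (T * R) - ?\<rho> *\<^sub>C 1 - ?\<rho> *\<^sub>C ((1 + \<mu>) *\<^sub>C T)"
    unfolding Q_def by (simp add: distrib_right right_diff_distrib scaleC_mult scaleC_add_right)
  then have 1: "Q * (R - ?\<rho> *\<^sub>C 1) = - (?\<rho> *\<^sub>C 1)" unfolding e r by simp
  have "(R - ?\<rho> *\<^sub>C 1) * Q = R + (1 + \<mu>) *\<^sub>C (R * T) - ?\<rho> *\<^sub>C 1 - ?\<rho> *\<^sub>C ((1 + \<mu>) *\<^sub>C T)"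
    unfolding Q_def by (simp add: distrib_left left_diff_distrib scaleC_mult scaleC_diff_right r)
  then have 2: "(R - ?\<rho> *\<^sub>C 1) * Q = - (?\<rho> *\<^sub>C 1)" unfolding e r by simp
  show ?thesis
    by (rule that[of "- ((1 + \<mu>) *\<^sub>C Q)"]) (simp_all add: scaleC_mult 1 2 scaleC_minus_right r)
qed

text \<open>Carries smallness of (A - \<mu>) u over to the bounded operator R - 1/(1 +
  \<mu>).\<close>

lemma R_shift:
  assumes "1 + \<mu> \<noteq> 0" "u \<in> D"
  shows "cop_app (R - (1 / (1 + \<mu>)) *\<^sub>C 1) u = - ((1 / (1 + \<mu>)) *\<^sub>C cop_app R (A u - \<mu> *\<^sub>C u))"
proof -
  have "u = cop_app R (1 *\<^sub>C u + A u)" using is_res_R assms(2) by (simp add: is_res_def)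
  also have "1 *\<^sub>C u + A u = (A u - \<mu> *\<^sub>C u) + (1 + \<mu>) *\<^sub>C u" by (simp add: scaleC_add_left)
  finally have u: "u = cop_app R (A u - \<mu> *\<^sub>C u) + (1 + \<mu>) *\<^sub>C cop_app R u" unfolding cop_app_arg_simps(1,4) .
  have "(1 / (1 + \<mu>)) *\<^sub>C u = (1 / (1 + \<mu>)) *\<^sub>C cop_app R (A u - \<mu> *\<^sub>C u) + cop_app R u"
    using assms(1) by (subst u) (simp add: scaleC_add_right scaleC_scaleC scaleC_one)
  then show ?thesis by (simp add: cop_app_simps)
qed

lemma inverse_imp_resolvent:
  assumes "1 + \<mu> \<noteq> 0" and V: "V * (R - (1 / (1 + \<mu>)) *\<^sub>C 1) = 1" "(R - (1 / (1 + \<mu>)) *\<^sub>C 1) * V = 1"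
  shows "\<mu> \<notin> spec D A"
proof -
  let ?\<rho> = "1 / (1 + \<mu>)" and ?X = "R - (1 / (1 + \<mu>)) *\<^sub>C 1"
  have RV: "R * V = V * R"
    by (rule commutes_inverse[OF V(2,1)]) (simp add: scaleC_ring_distribs)
  \<comment> \<open>Inverting R - \<rho> = -\<rho> (A - \<mu>) R gives this candidate for (A -
    \<mu>)^-1; the factor R on the left puts its range into D.\<close>
  define T where "T = - (?\<rho> *\<^sub>C (R * V))"
  have "is_res D A (- \<mu>) T" unfolding is_res_def
  proof (intro conjI allI ballI)
    fix u assume u: "u \<in> D"
    have "cop_app T (- \<mu> *\<^sub>C u + A u) = cop_app V (- (?\<rho> *\<^sub>C cop_app R (A u - \<mu> *\<^sub>C u)))"
      unfolding T_def RV using cop_app_arg_simps(2)[of V 0] 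
      by (simp add: cop_app_simps cop_app_arg_simps scaleC_minus_left scaleC_minus_right scaleC_diff_right scaleC_scaleC mult.commute)
    also have "\<dots> = cop_app (V * ?X) u" using R_shift[OF assms(1) u] by (simp add: cop_app_simps)
    also have "\<dots> = u" by (simp add: V cop_app_simps)
    finally show "cop_app T (- \<mu> *\<^sub>C u + A u) = u" .
  next
    fix y
    define v where "v = cop_app V y"
    define u where "u = cop_app R v"
    have u: "u \<in> D" "1 *\<^sub>C u + A u = v" using is_res_R by (auto simp: is_res_def u_def)
    have T: "cop_app T y = (- ?\<rho>) *\<^sub>C u" unfolding T_def u_def v_def by (simp add: cop_app_simps scaleC_minus_left)
    then show D: "cop_app T y \<in> D" using csub u by (simp add: csubspace_def)
    have AT: "A (cop_app T y) = (- ?\<rho>) *\<^sub>C A u" unfolding T using clin u by (simp add: clinear_on_def)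
    have "- \<mu> *\<^sub>C cop_app T y + A (cop_app T y) = (- ?\<rho>) *\<^sub>C (A u - \<mu> *\<^sub>C u)"
      unfolding AT unfolding T
      by (simp add: scaleC_diff_right scaleC_scaleC scaleC_minus_left scaleC_minus_right mult.commute)
    also have "A u - \<mu> *\<^sub>C u = v - (1 + \<mu>) *\<^sub>C u" using u(2) by (auto simp: scaleC_add_left)
    also have "(- ?\<rho>) *\<^sub>C \<dots> = u - ?\<rho> *\<^sub>C v" using assms(1) by (simp add: scaleC_minus_left scaleC_diff_right scaleC_scaleC scaleC_one)
    also have "\<dots> = cop_app (?X * V) y" by (simp add: u_def v_def cop_app_simps)
    also have "\<dots> = y" by (simp add: V cop_app_simps)
    finally show "- \<mu> *\<^sub>C cop_app T y + A (cop_app T y) = y" .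
  qed
  then show ?thesis using is_res_inv_ok by (auto simp: spec_def)
qed

end

section \<open>The operator f(A) and its approximate factorizations\<close>

locale D_calculus = sectorial D A + D_fun f n
  for D :: "'a::complex_banach set" and A :: "'a \<Rightarrow> 'a" and f n
begin

text \<open>The integral is taken in operator norm, whereas \<open>fD\<close> integrates after
  application to a vector. Approximation and commutation become statements in the algebra, and
  \<open>F_app\<close> leads back to \<open>fD\<close>.\<close>

definition F :: "'a cop" where
  "F = f_infty f *\<^sub>C 1 - complex_of_real (2 ^ n / pi) *\<^sub>C dint (\<lambda>z. Rz z ^ Suc n)"

lemma admissible_Rz: "\<exists>c. admissible c (\<lambda>z. Rz z ^ Suc n)"
proof -
  obtain M where M: "M \<ge> 0" "\<And>z. 0 < Re z \<Longrightarrow> norm (Rz z) \<le> M / cmod z" using Rz_bound by blast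
  have "norm (Rz z ^ Suc k) \<le> M ^ Suc k / cmod z ^ Suc k" if z: "0 < Re z" for z k
  proof (induction k)
    case 0 then show ?case using M(2)[OF z] by simp
  next
    case (Suc k)
    have "norm (Rz z ^ Suc (Suc k)) \<le> norm (Rz z) * norm (Rz z ^ Suc k)" by (simp add: norm_mult_ineq)
    also have "\<dots> \<le> (M / cmod z) * (M ^ Suc k / cmod z ^ Suc k)" using M z by (intro mult_mono M Suc) auto
    finally show ?case by simp
  qed
  then show ?thesis using Rz_power_continuous unfolding admissible_def by blast
qed

lemma F_commutes:
  assumes "Y * R = R * Y"
  shows "Y * F = F * Y"
proof -
  obtain c where c: "admissible c (\<lambda>z. Rz z ^ Suc n)" using admissible_Rz by blast
  have pw: "Y * Rz z ^ k = Rz z ^ k * Y" if "0 < Re z" for z k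
    by (rule commutes_power[OF commutes_Rz[OF assms that]])
  have "Y * dint (\<lambda>z. Rz z ^ Suc n) = dint (\<lambda>z. Y * Rz z ^ Suc n)"
    by (rule dint_linear[OF bounded_linear_mult_right scaleC_mult_right c, symmetric])
  also have "\<dots> = dint (\<lambda>z. Rz z ^ Suc n * Y)" by (intro dint_cong pw)
  also have "\<dots> = dint (\<lambda>z. Rz z ^ Suc n) * Y" by (rule dint_linear[OF bounded_linear_mult_left scaleC_mult_left c])
  finally have "Y * dint (\<lambda>z. Rz z ^ Suc n) = dint (\<lambda>z. Rz z ^ Suc n) * Y" .
  then show ?thesis unfolding F_def scaleC_ring_distribs by simp
qed

lemma F_app:
  "cop_app F x = f_infty f *\<^sub>C x - complex_of_real (2 ^ n / pi) *\<^sub>C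
       integral {0<..} (\<lambda>\<alpha>. integral UNIV (\<lambda>\<beta>.
          (complex_of_real (\<alpha> ^ n) * deriv f (Complex \<alpha> \<beta>)) *\<^sub>C ((res D A (Complex \<alpha> (- \<beta>))) ^^ (n + 1)) x))"
proof -
  obtain c where c: "admissible c (\<lambda>z. Rz z ^ Suc n)" using admissible_Rz by blast
  have "cop_app (dint (\<lambda>z. Rz z ^ Suc n)) x = dint (\<lambda>z. cop_app (Rz z ^ Suc n) x)"
    by (rule dint_linear[OF bounded_linear_cop_app cop_app_simps(7) c, symmetric])
  also have "\<dots> = integral {0<..} (\<lambda>\<alpha>. integral UNIV (\<lambda>\<beta>.
          (complex_of_real (\<alpha> ^ n) * deriv f (Complex \<alpha> \<beta>)) *\<^sub>C ((res D A (Complex \<alpha> (- \<beta>))) ^^ (n + 1)) x))"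
    unfolding dint_def ker_def[abs_def]
  proof (intro integral_cong)
    fix \<alpha> \<beta> :: real assume "\<alpha> \<in> {0<..}"
    then have "res D A (Complex \<alpha> (- \<beta>)) = cop_app (Rz (Complex \<alpha> (- \<beta>)))"
      by (intro ext is_res_res is_res_Rz) simp
    then show "(complex_of_real (\<alpha> ^ n) * g (Complex \<alpha> \<beta>)) *\<^sub>C cop_app (Rz (Complex \<alpha> (- \<beta>)) ^ Suc n) x =
      (complex_of_real (\<alpha> ^ n) * deriv f (Complex \<alpha> \<beta>)) *\<^sub>C ((res D A (Complex \<alpha> (- \<beta>))) ^^ (n + 1)) x"
      by (simp add: cop_app_power del: power_Suc)
  qed
  finally show ?thesis by (simp add: F_def cop_app_simps)
qed

text \<open>\<open>Rz_R\<close> pulls one factor R out of Rz^(n+1). For large z the cofactor is only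
  bounded by a multiple of |z|^-n, hence the recourse to \<open>dint_factor_approx\<close>.\<close>

lemma approx_infty:
  assumes "e > 0"
  obtains C where "norm (F - f_infty f *\<^sub>C 1 - R * C) < e" "\<And>Y. Y * R = R * Y \<Longrightarrow> Y * C = C * Y"
proof -
  obtain c where c: "admissible c (\<lambda>z. Rz z ^ Suc n)" using admissible_Rz by blast
  define s where "s = complex_of_real (2 ^ n / pi)"
  have s0: "cmod s > 0" by (simp add: s_def)
  define N where "N = (\<lambda>z. (1 + (1 - z) *\<^sub>C Rz z) * Rz z ^ n)"
  have eq: "R * N z = Rz z ^ Suc n" if "0 < Re z" for z
  proof -
    have "R * (1 + (1 - z) *\<^sub>C Rz z) = Rz z" using Rz_R[OF that] by (simp add: distrib_left scaleC_mult_right)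
    then show ?thesis by (simp add: N_def mult.assoc[symmetric])
  qed
  have Ncont: "continuous_on {z. 0 < Re z} N" unfolding N_def by (intro continuous_intros Rz_continuous Rz_power_continuous)
  have adm: "admissible c (\<lambda>z. R * N z)"
    using c unfolding admissible_def by (auto simp: eq simp del: power_Suc cong: continuous_on_cong_simp)
  have "e / cmod s > 0" using assms s0 by simp
  from dint_factor_approx[OF adm Ncont this] obtain C where C: "norm (dint (\<lambda>z. R * N z) - R * C) < e / cmod s"
    "\<And>Y. (\<And>z. 0 < Re z \<Longrightarrow> Y * N z = N z * Y) \<Longrightarrow> Y * C = C * Y" by blast
  have dN: "dint (\<lambda>z. R * N z) = dint (\<lambda>z. Rz z ^ Suc n)" by (rule dint_cong) (rule eq)
  show ?thesis
  proof (rule that[of "(- s) *\<^sub>C C"])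
    have "F - f_infty f *\<^sub>C 1 - R * ((- s) *\<^sub>C C) = (- s) *\<^sub>C (dint (\<lambda>z. Rz z ^ Suc n) - R * C)"
      unfolding F_def s_def[symmetric] by (simp add: scaleC_mult_right scaleC_minus_left scaleC_diff_right)
    then show "norm (F - f_infty f *\<^sub>C 1 - R * ((- s) *\<^sub>C C)) < e"
      using C(1) s0 unfolding dN by (simp add: norm_scaleC field_simps del: power_Suc)
    fix Y assume Y: "Y * R = R * Y"
    have "Y * N z = N z * Y" if z: "0 < Re z" for z
    proof -
      have Yz: "Y * Rz z = Rz z * Y" by (rule commutes_Rz[OF Y z])
      have "Y * (1 + (1 - z) *\<^sub>C Rz z) = (1 + (1 - z) *\<^sub>C Rz z) * Y"
        by (simp add: scaleC_ring_distribs Yz)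
      then show ?thesis unfolding N_def by (rule commutes_mult[OF _ commutes_power[OF Yz]])
    qed
    from C(2)[OF this] show "Y * ((- s) *\<^sub>C C) = ((- s) *\<^sub>C C) * Y" by (simp add: scaleC_mult)
  qed
qed

text \<open>Subtracting \<open>fval_eq\<close> from the definition of F leaves the kernel Rz^(n+1) -
  q^(n+1) with q = 1/(\<mu> + z). \<open>geo_factor\<close> splits off Rz - q, which in turn
  contains the factor R - 1/(1 + \<mu>). For \<mu> = 0 the cofactor may grow like |z|^-(n+2) near 0,
  so it has to be cut off.\<close>

lemma approx_fval:
  assumes \<mu>: "\<mu> = 0 \<or> 0 < Re \<mu>" and "e > 0"
  obtains C where "norm (F - fval f \<mu> *\<^sub>C 1 - (R - (1 / (1 + \<mu>)) *\<^sub>C 1) * C) < e"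
    "\<And>Y. Y * R = R * Y \<Longrightarrow> Y * C = C * Y"
proof -
  let ?X = "R - (1 / (1 + \<mu>)) *\<^sub>C 1"
  obtain c where c: "admissible c (\<lambda>z. Rz z ^ Suc n)" using admissible_Rz by blast
  define s where "s = complex_of_real (2 ^ n / pi)"
  have s0: "cmod s > 0" by (simp add: s_def)
  have \<mu>1: "1 + \<mu> \<noteq> 0" using \<mu> by (auto simp: complex_eq_iff)
  have nz: "\<mu> + z \<noteq> 0" if "0 < Re z" for z using \<mu> that by (auto simp: complex_eq_iff)
  define q where "q = (\<lambda>z. 1 / (\<mu> + z))"
  have q_cont: "continuous_on {z. 0 < Re z} q" unfolding q_def by (intro continuous_intros) (use nz in auto)
  obtain k where k: "0 < k" "k * cmod \<mu> \<le> Re \<mu>"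
  proof (cases "\<mu> = 0")
    case True then show ?thesis using that[of 1] by simp
  next
    case False then show ?thesis using that[of "Re \<mu> / cmod \<mu>"] \<mu> by auto
  qed
  obtain d where d: "admissible d (\<lambda>z. 1 / (\<mu> + z) ^ Suc n)" using admissible_pole[OF k] by blast
  \<comment> \<open>Formally Rz - q = (\<mu> - A) / ((A + z)(\<mu> + z)) and R - 1/(1 + \<mu>) =
    (\<mu> - A) / ((A + 1)(\<mu> + 1)); this is their quotient, with (A + 1)/(A + z) written as 1 +
    (1 - z) Rz.\<close>
  define N1 where "N1 = (\<lambda>z. (q z * (1 + \<mu>)) *\<^sub>C (1 + (1 - z) *\<^sub>C Rz z))"
  define N where "N = (\<lambda>z. N1 z * geo n (Rz z) (q z))"
  have e1: "?X * N1 z = Rz z - q z *\<^sub>C 1" if z: "0 < Re z" for z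
  proof -
    let ?B = "1 + (1 - z) *\<^sub>C Rz z"
    have RB: "R * ?B = Rz z" using Rz_R[OF z] by (simp add: distrib_left scaleC_mult_right)
    have "?X * N1 z = (q z * (1 + \<mu>)) *\<^sub>C (R * ?B - (1 / (1 + \<mu>)) *\<^sub>C ?B)"
      unfolding N1_def by (simp only: scaleC_mult left_diff_distrib mult_1)
    also have "\<dots> = (q z * (1 + \<mu>)) *\<^sub>C Rz z - q z *\<^sub>C 1 - (q z * (1 - z)) *\<^sub>C Rz z"
      unfolding RB using \<mu>1 by (simp add: scaleC_diff_right scaleC_add_right scaleC_scaleC)
    also have "\<dots> = (q z * (\<mu> + z)) *\<^sub>C Rz z - q z *\<^sub>C 1"
      by (simp add: scaleC_add_left scaleC_diff_left algebra_simps)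
    also have "q z * (\<mu> + z) = 1" using nz[OF z] by (simp add: q_def)
    finally show ?thesis by (simp add: scaleC_one)
  qed
  have eq: "?X * N z = Rz z ^ Suc n - (1 / (\<mu> + z) ^ Suc n) *\<^sub>C 1" if z: "0 < Re z" for z
    using e1[OF z] geo_factor[of "Rz z" n "q z"] unfolding N_def
    by (simp add: mult.assoc[symmetric] q_def power_one_over del: power_Suc)
  have one: "admissible (d * norm (1::'a cop)) (\<lambda>z. (1 / (\<mu> + z) ^ Suc n) *\<^sub>C (1::'a cop))"
    using d unfolding admissible_def
    by (auto simp: norm_scaleC mult_right_mono simp flip: times_divide_eq_left intro!: continuous_intros simp del: power_Suc)
  have diff: "admissible (c + d * norm (1::'a cop)) (\<lambda>z. Rz z ^ Suc n - (1 / (\<mu> + z) ^ Suc n) *\<^sub>C 1)"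
    by (rule admissible_diff[OF c one])
  have Ncont: "continuous_on {z. 0 < Re z} N" unfolding N_def N1_def
    by (intro continuous_intros Rz_continuous geo_continuous q_cont)
  have adm: "admissible (c + d * norm (1::'a cop)) (\<lambda>z. ?X * N z)"
    using diff unfolding admissible_def by (auto simp: eq simp del: power_Suc cong: continuous_on_cong_simp)
  have "e / cmod s > 0" using assms s0 by simp
  from dint_factor_approx[OF adm Ncont this] obtain C where C: "norm (dint (\<lambda>z. ?X * N z) - ?X * C) < e / cmod s"
    "\<And>Y. (\<And>z. 0 < Re z \<Longrightarrow> Y * N z = N z * Y) \<Longrightarrow> Y * C = C * Y" by blast
  define m where "m = max c (d * norm (1::'a cop))"
  have "dint (\<lambda>z. ?X * N z) = dint (\<lambda>z. Rz z ^ Suc n - (1 / (\<mu> + z) ^ Suc n) *\<^sub>C 1)" by (rule dint_cong) (rule eq)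
  also have "\<dots> = dint (\<lambda>z. Rz z ^ Suc n) - dint (\<lambda>z. (1 / (\<mu> + z) ^ Suc n) *\<^sub>C 1)"
    by (rule dint_diff[OF admissible_mono[OF c] admissible_mono[OF one], of m]) (simp_all add: m_def)
  also have "dint (\<lambda>z. (1 / (\<mu> + z) ^ Suc n) *\<^sub>C (1::'a cop)) = dint (\<lambda>z. 1 / (\<mu> + z) ^ Suc n) *\<^sub>C 1"
    by (rule dint_linear[OF bounded_bilinear.bounded_linear_left[OF bounded_bilinear_scaleC] _ d])
       (simp add: scaleC_complex_def scaleC_scaleC)
  finally have dN: "dint (\<lambda>z. ?X * N z) = dint (\<lambda>z. Rz z ^ Suc n) - dint (\<lambda>z. 1 / (\<mu> + z) ^ Suc n) *\<^sub>C 1" .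
  show ?thesis
  proof (rule that[of "(- s) *\<^sub>C C"])
    have fv: "fval f \<mu> = f_infty f - s * dint (\<lambda>z. 1 / (\<mu> + z) ^ Suc n)" unfolding s_def by (rule fval_eq[OF \<mu>])
    have "F - fval f \<mu> *\<^sub>C 1 - ?X * ((- s) *\<^sub>C C) = (- s) *\<^sub>C (dint (\<lambda>z. ?X * N z) - ?X * C)"
      unfolding F_def s_def[symmetric] dN fv
      by (simp add: scaleC_mult_right scaleC_minus_left scaleC_diff scaleC_scaleC)
    then show "norm (F - fval f \<mu> *\<^sub>C 1 - ?X * ((- s) *\<^sub>C C)) < e"
      using C(1) s0 by (simp add: norm_scaleC field_simps)
    fix Y assume Y: "Y * R = R * Y"
    have "Y * N z = N z * Y" if z: "0 < Re z" for z
    proof -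
      have Yz: "Y * Rz z = Rz z * Y" by (rule commutes_Rz[OF Y z])
      have "Y * N1 z = N1 z * Y" unfolding N1_def
        by (simp add: scaleC_ring_distribs Yz)
      then show ?thesis unfolding N_def by (rule commutes_mult[OF _ geo_commute[OF Yz]])
    qed
    from C(2)[OF this] show "Y * ((- s) *\<^sub>C C) = ((- s) *\<^sub>C C) * Y" by (simp add: scaleC_mult)
  qed
qed

end

section \<open>Eigenvectors, adjoint eigenvectors and spectra\<close>

context D_calculus
begin

lemma one_plus_spec: "\<mu> \<in> spec D A \<Longrightarrow> 1 + \<mu> \<noteq> 0"
  using spec_subset[of \<mu>] by (auto simp: complex_eq_iff)

text \<open>\<open>C\<close> commutes with R, so the factor R - 1/(1 + \<mu>) can be moved next to
  the vector, where \<open>R_shift\<close> applies. K depends on e through \<open>C\<close>, which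
  is harmless as e is fixed before a limit is taken.\<close>

lemma F_estimate:
  assumes "\<mu> \<in> spec D A" "e > 0"
  obtains K where "K \<ge> 0" "\<And>x. x \<in> D \<Longrightarrow> norm (cop_app F x - fval f \<mu> *\<^sub>C x) \<le> e * norm x + K * norm (A x - \<mu> *\<^sub>C x)"
proof -
  let ?\<rho> = "1 / (1 + \<mu>)"
  let ?X = "R - ?\<rho> *\<^sub>C 1"
  obtain C where C: "norm (F - fval f \<mu> *\<^sub>C 1 - ?X * C) < e" "\<And>Y. Y * R = R * Y \<Longrightarrow> Y * C = C * Y"
    using approx_fval[OF spec_subset[OF assms(1)] assms(2)] by blast
  have XC: "?X * C = C * ?X" by (rule C(2)) (simp add: scaleC_ring_distribs)
  define E where "E = F - fval f \<mu> *\<^sub>C 1 - ?X * C"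
  show ?thesis
  proof (rule that[of "norm C * (cmod ?\<rho> * norm R)"])
    fix x assume x: "x \<in> D"
    have "cop_app F x - fval f \<mu> *\<^sub>C x = cop_app (E + C * ?X) x" unfolding E_def XC by (simp add: cop_app_simps)
    also have "\<dots> = cop_app E x + cop_app C (cop_app ?X x)" by (simp only: cop_app_simps)
    also have "norm \<dots> \<le> norm E * norm x + norm C * norm (cop_app ?X x)"
      by (rule order_trans[OF norm_triangle_ineq add_mono[OF norm_cop_app norm_cop_app]])
    also have "norm (cop_app ?X x) \<le> cmod ?\<rho> * (norm R * norm (A x - \<mu> *\<^sub>C x))"
      unfolding R_shift[OF one_plus_spec[OF assms(1)] x] norm_minus_cancel norm_scaleC
      by (intro mult_left_mono norm_cop_app) simp
    also have "norm E * norm x \<le> e * norm x" using C(1) by (intro mult_right_mono) (auto simp: E_def)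
    finally show "norm (cop_app F x - fval f \<mu> *\<^sub>C x) \<le> e * norm x + norm C * (cmod ?\<rho> * norm R) * norm (A x - \<mu> *\<^sub>C x)"
      by (simp add: mult_left_mono mult.assoc)
  qed simp
qed

lemma eigenvector:
  assumes "x \<in> D" "A x = \<mu> *\<^sub>C x"
  shows "cop_app F x = fval f \<mu> *\<^sub>C x"
proof (cases "x = 0")
  case False
  \<comment> \<open>A nonzero eigenvector places \<mu> in the spectrum, hence at 0 or in the open
    half-plane, where the reproducing formula is available.\<close>
  have spec: "\<mu> \<in> spec D A"
  proof (rule ccontr)
    assume "\<mu> \<notin> spec D A"
    then obtain T where T: "is_res D A (- \<mu>) T" using inv_ok_is_res[OF csub clin] by (auto simp: spec_def)
    then have "x = cop_app T (- \<mu> *\<^sub>C x + A x)" using assms(1) by (simp add: is_res_def)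
    then show False using assms(2) False by (simp add: scaleC_minus_left cop_app_arg_simps)
  qed
  have "norm (cop_app F x - fval f \<mu> *\<^sub>C x) \<le> 0 + e" if "e > 0" for e
  proof -
    have "e / norm x > 0" using that False by simp
    from F_estimate[OF spec this] obtain K where
      "norm (cop_app F x - fval f \<mu> *\<^sub>C x) \<le> e / norm x * norm x + K * norm (A x - \<mu> *\<^sub>C x)" using assms(1) by blast
    then show ?thesis using assms(2) False by simp
  qed
  then have "norm (cop_app F x - fval f \<mu> *\<^sub>C x) \<le> 0" by (rule field_le_epsilon)
  then show ?thesis by simp
qed (simp add: cop_app_arg_simps)

lemma approx_eigenvector:
  assumes xs: "\<And>k. xs k \<in> D" "\<And>k. norm (xs k) = 1" and lim: "(\<lambda>k. norm (A (xs k) - \<mu> *\<^sub>C xs k)) \<longlonglongrightarrow> 0"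
  shows "(\<lambda>k. norm (cop_app F (xs k) - fval f \<mu> *\<^sub>C xs k)) \<longlonglongrightarrow> 0"
proof -
  \<comment> \<open>Otherwise the unit vectors would be images of vectors tending to 0 under a
    bounded inverse.\<close>
  have spec: "\<mu> \<in> spec D A"
  proof (rule ccontr)
    assume "\<mu> \<notin> spec D A"
    then obtain T where T: "is_res D A (- \<mu>) T" using inv_ok_is_res[OF csub clin] by (auto simp: spec_def)
    have "1 \<le> norm T * norm (A (xs k) - \<mu> *\<^sub>C xs k)" for k
    proof -
      have "xs k = cop_app T (- \<mu> *\<^sub>C xs k + A (xs k))" using T xs(1) by (simp add: is_res_def)
      then have "norm (xs k) = norm (cop_app T (A (xs k) - \<mu> *\<^sub>C xs k))" by (simp add: scaleC_minus_left)
      then show ?thesis using norm_cop_app[of T "A (xs k) - \<mu> *\<^sub>C xs k"] xs(2)[of k] by simp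
    qed
    moreover have "(\<lambda>k. norm T * norm (A (xs k) - \<mu> *\<^sub>C xs k)) \<longlonglongrightarrow> norm T * 0" by (intro tendsto_intros lim)
    ultimately have "1 \<le> norm T * 0" by (intro LIMSEQ_le_const) auto
    then show False by simp
  qed
  show ?thesis
  proof (rule tendstoI)
    fix e :: real assume "e > 0"
    then have "e / 2 > 0" by simp
    from F_estimate[OF spec this] obtain K where K: "K \<ge> 0"
      "\<And>x. x \<in> D \<Longrightarrow> norm (cop_app F x - fval f \<mu> *\<^sub>C x) \<le> e / 2 * norm x + K * norm (A x - \<mu> *\<^sub>C x)" by blast
    have "(\<lambda>k. K * norm (A (xs k) - \<mu> *\<^sub>C xs k)) \<longlonglongrightarrow> K * 0" by (intro tendsto_intros lim)
    then have "\<forall>\<^sub>F k in sequentially. K * norm (A (xs k) - \<mu> *\<^sub>C xs k) < e / 2"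
      using \<open>e > 0\<close> by (intro order_tendstoD(2)) auto
    then show "\<forall>\<^sub>F k in sequentially. dist (norm (cop_app F (xs k) - fval f \<mu> *\<^sub>C xs k)) 0 < e"
    proof eventually_elim
      case (elim k)
      then show ?case using K(2)[OF xs(1)[of k]] xs(2)[of k] by simp
    qed
  qed
qed

text \<open>\<phi> vanishes on the range of R - 1/(1 + \<mu>). This factor stands on the left in the
  approximate factorization of f(A) - f(\<mu>), so \<phi> sees only the error term.\<close>

lemma adjoint_eigenvector:
  assumes \<phi>: "cfunctional \<phi>" and eig: "\<And>x. x \<in> D \<Longrightarrow> \<phi> (A x) = \<mu> * \<phi> x"
  shows "\<phi> (cop_app F x) = fval f \<mu> * \<phi> x"
proof -
  have lin: "\<phi> (x + y) = \<phi> x + \<phi> y" "\<phi> (c *\<^sub>C x) = c * \<phi> x" for x y c using \<phi> by (auto simp: cfunctional_def)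
  have lind: "\<phi> (x - y) = \<phi> x - \<phi> y" for x y using lin(1)[of "x - y" y] by simp
  show ?thesis
  proof (cases "\<mu> \<in> spec D A")
    \<comment> \<open>Outside the spectrum A - \<mu> is onto, so \<phi> = 0 and both sides vanish,
      whatever value \<open>fval f \<mu>\<close> has there.\<close>
    case False
    then obtain T where T: "is_res D A (- \<mu>) T" using inv_ok_is_res[OF csub clin] by (auto simp: spec_def)
    have "\<phi> y = 0" for y
    proof -
      have "y = - \<mu> *\<^sub>C cop_app T y + A (cop_app T y)" "cop_app T y \<in> D" using T by (auto simp: is_res_def)
      then have "\<phi> y = - \<mu> * \<phi> (cop_app T y) + \<mu> * \<phi> (cop_app T y)" using eig lin by metis
      then show ?thesis by simp
    qed
    then show ?thesis by simp
  next
    case True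
    obtain K where K: "\<And>x. cmod (\<phi> x) \<le> K * norm x" using \<phi> by (auto simp: cfunctional_def)
    have K0: "0 \<le> \<bar>K\<bar> * norm x" by simp
    have K': "cmod (\<phi> y) \<le> \<bar>K\<bar> * norm y" for y
      by (rule order_trans[OF K mult_right_mono]) auto
    let ?\<rho> = "1 / (1 + \<mu>)"
    let ?X = "R - ?\<rho> *\<^sub>C 1"
    have X0: "\<phi> (cop_app ?X y) = 0" for y
    proof -
      have "cop_app R y \<in> D" "1 *\<^sub>C cop_app R y + A (cop_app R y) = y" using is_res_R by (auto simp: is_res_def)
      then have "\<phi> y = \<phi> (cop_app R y) + \<mu> * \<phi> (cop_app R y)" using eig lin by (metis mult_1)
      then have "\<phi> (cop_app R y) = ?\<rho> * \<phi> y" using one_plus_spec[OF True] by (simp add: field_simps)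
      then show ?thesis by (simp add: cop_app_simps lind lin)
    qed
    have "cmod (\<phi> (cop_app F x) - fval f \<mu> * \<phi> x) \<le> 0 + e" if "e > 0" for e
    proof -
      have pos: "\<bar>K\<bar> * norm x + 1 > 0" using K0 by linarith
      then have "e / (\<bar>K\<bar> * norm x + 1) > 0" using that by simp
      from approx_fval[OF spec_subset[OF True] this] obtain C where
        C: "norm (F - fval f \<mu> *\<^sub>C 1 - ?X * C) < e / (\<bar>K\<bar> * norm x + 1)" by blast
      define E where "E = F - fval f \<mu> *\<^sub>C 1 - ?X * C"
      have "\<phi> (cop_app E x) = \<phi> (cop_app F x) - fval f \<mu> * \<phi> x - \<phi> (cop_app ?X (cop_app C x))"
        unfolding E_def cop_app_simps(2)[of "F - fval f \<mu> *\<^sub>C 1"] cop_app_simps(6) by (simp add: cop_app_simps lind lin)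
      then have "cmod (\<phi> (cop_app F x) - fval f \<mu> * \<phi> x) = cmod (\<phi> (cop_app E x))" by (simp add: X0)
      also have "\<dots> \<le> \<bar>K\<bar> * (norm E * norm x)"
        by (rule order_trans[OF K']) (intro mult_left_mono norm_cop_app, simp)
      also have "\<dots> = norm E * (\<bar>K\<bar> * norm x)" by simp
      also have "\<dots> \<le> e / (\<bar>K\<bar> * norm x + 1) * (\<bar>K\<bar> * norm x + 1)"
        using C K0 pos that by (intro mult_mono) (auto simp: E_def)
      also have "\<dots> = e" using pos by simp
      finally show ?thesis by simp
    qed
    then have "cmod (\<phi> (cop_app F x) - fval f \<mu> * \<phi> x) \<le> 0" by (rule field_le_epsilon)
    then show ?thesis by simp
  qed
qed

lemma cop_eq_iff: "S = T \<longleftrightarrow> (\<forall>x. cop_app S x = cop_app T x)"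
  using cop_eqI by blast

lemma is_res_UNIV:
  "is_res UNIV (cop_app F) (- a) T \<longleftrightarrow> (F - a *\<^sub>C 1) * T = 1 \<and> T * (F - a *\<^sub>C 1) = 1"
proof -
  have "(F - a *\<^sub>C 1) * T = 1 \<longleftrightarrow> (\<forall>y. - a *\<^sub>C cop_app T y + cop_app F (cop_app T y) = y)"
    by (simp add: cop_eq_iff cop_app_simps scaleC_minus_left)
  moreover have "T * (F - a *\<^sub>C 1) = 1 \<longleftrightarrow> (\<forall>u. cop_app T (- a *\<^sub>C u + cop_app F u) = u)"
    by (simp add: cop_eq_iff cop_app_simps cop_app_arg_simps scaleC_minus_left)
  ultimately show ?thesis by (auto simp: is_res_def)
qed

lemma spec_F: "a \<in> spec UNIV (cop_app F) \<longleftrightarrow> (\<nexists>T. (F - a *\<^sub>C 1) * T = 1 \<and> T * (F - a *\<^sub>C 1) = 1)"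
proof -
  have lin: "csubspace (UNIV :: 'a set)" "clinear_on UNIV (cop_app F)"
    by (auto simp: csubspace_def clinear_on_def cop_app_arg_simps)
  have "inv_ok UNIV (cop_app F) (- a) \<longleftrightarrow> (\<exists>T. is_res UNIV (cop_app F) (- a) T)"
  proof
    assume "inv_ok UNIV (cop_app F) (- a)"
    then obtain T where "is_res UNIV (cop_app F) (- a) T" by (rule inv_ok_is_res[OF lin])
    then show "\<exists>T. is_res UNIV (cop_app F) (- a) T" ..
  next
    assume "\<exists>T. is_res UNIV (cop_app F) (- a) T"
    then show "inv_ok UNIV (cop_app F) (- a)" by (auto intro: is_res_inv_ok)
  qed
  then show ?thesis by (simp add: spec_def is_res_UNIV)
qed

text \<open>If f(A) - f(\<mu>) had an inverse T, then (R - 1/(1 + \<mu>)) C T would be close to the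
  unit and so invertible. As R - 1/(1 + \<mu>) commutes with C T, it would be invertible
  itself.\<close>

lemma fval_in_spec:
  assumes "\<mu> \<in> spec D A"
  shows "fval f \<mu> \<in> spec UNIV (cop_app F)"
proof (rule ccontr)
  assume "fval f \<mu> \<notin> spec UNIV (cop_app F)"
  then obtain T where T: "(F - fval f \<mu> *\<^sub>C 1) * T = 1" "T * (F - fval f \<mu> *\<^sub>C 1) = 1" using spec_F by blast
  let ?X = "R - (1 / (1 + \<mu>)) *\<^sub>C 1"
  \<comment> \<open>This tolerance stays below 1 after multiplication by norm T.\<close>
  have "1 / (norm T + 1) > 0" by (simp add: add_nonneg_pos)
  from approx_fval[OF spec_subset[OF assms] this] obtain C where
    C: "norm (F - fval f \<mu> *\<^sub>C 1 - ?X * C) < 1 / (norm T + 1)" "\<And>Y. Y * R = R * Y \<Longrightarrow> Y * C = C * Y" by blast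
  have "R * (F - fval f \<mu> *\<^sub>C 1) = (F - fval f \<mu> *\<^sub>C 1) * R"
    using F_commutes[of R] by (simp add: scaleC_ring_distribs)
  then have RT: "R * T = T * R" by (rule commutes_inverse[OF T])
  have RC: "R * C = C * R" by (rule C(2)) simp
  have XCT: "?X * (C * T) = (C * T) * ?X"
    using commutes_mult[OF RC RT] by (simp add: scaleC_ring_distribs)
  have "norm (1 - ?X * (C * T)) = norm ((F - fval f \<mu> *\<^sub>C 1 - ?X * C) * T)"
    unfolding left_diff_distrib[of "F - fval f \<mu> *\<^sub>C 1"] T(1) by (simp add: mult.assoc)
  also have "\<dots> \<le> norm (F - fval f \<mu> *\<^sub>C 1 - ?X * C) * norm T" by (rule norm_mult_ineq)
  also have "\<dots> \<le> 1 / (norm T + 1) * norm T" using C(1) by (intro mult_right_mono) auto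
  also have "\<dots> < 1" using norm_ge_zero[of T] by (simp add: add_nonneg_pos)
  finally obtain Y where Y: "?X * (C * T) * Y = 1" "Y * (?X * (C * T)) = 1" using inverse_near_one by blast
  have l: "(Y * (C * T)) * ?X = 1" using Y(2) unfolding XCT by (simp add: mult.assoc)
  have r: "?X * ((C * T) * Y) = 1" using Y(1) by (simp add: mult.assoc)
  \<comment> \<open>A left and a right inverse coincide.\<close>
  have "Y * (C * T) = (Y * (C * T)) * (?X * ((C * T) * Y))" unfolding r by simp
  also have "\<dots> = ((Y * (C * T)) * ?X) * ((C * T) * Y)" by (simp only: mult.assoc)
  also have "\<dots> = (C * T) * Y" unfolding l by simp
  finally have "?X * (Y * (C * T)) = 1" using r by simp
  with l have "\<mu> \<notin> spec D A" by (rule inverse_imp_resolvent[OF one_plus_spec[OF assms]])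
  then show False using assms by simp
qed

text \<open>In \<open>invertible_local_to_global\<close>, \<rho> = 1/(1 + \<mu>) stands for the
  point \<mu> and \<rho> = 0 for infinity. On the spectrum and at infinity, f has a value b
  different from a, and b - a = G - (F - b) is nearly a combination of G and R - \<rho>. Off the
  spectrum R - \<rho> is invertible by itself.\<close>

lemma spec_subset_image:
  assumes a: "a \<notin> fval f ` spec D A" "a \<noteq> f_infty f"
  shows "a \<notin> spec UNIV (cop_app F)"
proof -
  define G where "G = F - a *\<^sub>C 1"
  have G_comm: "Y * G = G * Y" if "Y * R = R * Y" for Y
    using F_commutes[OF that] by (simp add: G_def scaleC_ring_distribs)
  let ?\<A> = "{S. S * R = R * S \<and> S * G = G * S}"
  have approx: "\<exists>U\<in>?\<A>. \<exists>V\<in>?\<A>. norm (1 - U * G - V * X) < 1"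
    if b: "b \<noteq> a" and C: "norm (F - b *\<^sub>C 1 - X * C) < cmod (b - a)" "\<And>Y. Y * R = R * Y \<Longrightarrow> Y * C = C * Y"
      and X: "X * R = R * X" for b X C
  proof -
    \<comment> \<open>Dividing b - a = G - (F - b) by b - a and replacing F - b by X C suggests U =
      s and V = -s C.\<close>
    define s where "s = 1 / (b - a)"
    have s: "s * (b - a) = 1" "cmod s * cmod (b - a) = 1" using b by (auto simp: s_def norm_divide)
    have s0: "cmod s > 0" using b by (simp add: s_def norm_divide)
    have CR: "C * R = R * C" using C(2)[of R] by simp
    have "1 - (s *\<^sub>C 1) * G - (- (s *\<^sub>C C)) * X = (- s) *\<^sub>C (F - b *\<^sub>C 1 - X * C)"
    proof -
      have 1: "1 = (s * (b - a)) *\<^sub>C (1::'a cop)" using s by (simp add: scaleC_one)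
      have "1 - (s *\<^sub>C 1) * G - (- (s *\<^sub>C C)) * X = (s * (b - a)) *\<^sub>C 1 - (s *\<^sub>C 1) * G - (- (s *\<^sub>C C)) * X"
        using 1 by simp
      also have "\<dots> = (- s) *\<^sub>C (F - b *\<^sub>C 1 - X * C)"
        using C(2)[OF X] by (simp add: G_def scaleC_minus_left scaleC_diff scaleC_mult_left
          scaleC_scaleC right_diff_distrib)
      finally show ?thesis .
    qed
    then have "norm (1 - (s *\<^sub>C 1) * G - (- (s *\<^sub>C C)) * X) = cmod s * norm (F - b *\<^sub>C 1 - X * C)"
      by (simp add: norm_scaleC)
    also have "\<dots> < cmod s * cmod (b - a)" using C(1) s0 by simp
    finally have "norm (1 - (s *\<^sub>C 1) * G - (- (s *\<^sub>C C)) * X) < 1" using s by simp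
    moreover have "s *\<^sub>C 1 \<in> ?\<A>" by (simp add: scaleC_mult)
    moreover have "- (s *\<^sub>C C) \<in> ?\<A>" using CR G_comm[OF CR] by (simp add: scaleC_mult)
    ultimately show ?thesis by blast
  qed
  have "\<exists>S. S * G = 1 \<and> G * S = 1"
  proof (rule invertible_local_to_global)
    show RG: "R * G = G * R" by (rule G_comm) simp
    fix \<rho> :: complex
    have XR: "(R - \<rho> *\<^sub>C 1) * R = R * (R - \<rho> *\<^sub>C 1)" for \<rho>
      by (simp add: scaleC_ring_distribs)
    show "\<exists>U\<in>?\<A>. \<exists>V\<in>?\<A>. norm (1 - U * G - V * (R - \<rho> *\<^sub>C 1)) < 1"
    proof (cases "\<rho> = 0")
      case True
      have "cmod (f_infty f - a) > 0" using a(2) by simp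
      from approx_infty[OF this] obtain C where "norm (F - f_infty f *\<^sub>C 1 - R * C) < cmod (f_infty f - a)"
        "\<And>Y. Y * R = R * Y \<Longrightarrow> Y * C = C * Y" by blast
      from approx[OF a(2)[symmetric] this] show ?thesis using True by simp
    next
      case False
      define \<mu> where "\<mu> = 1 / \<rho> - 1"
      have \<mu>: "1 + \<mu> \<noteq> 0" "1 / (1 + \<mu>) = \<rho>" using False by (auto simp: \<mu>_def)
      show ?thesis
      proof (cases "\<mu> \<in> spec D A")
        case True
        then have b: "fval f \<mu> \<noteq> a" using a(1) by auto
        then have "cmod (fval f \<mu> - a) > 0" by simp
        from approx_fval[OF spec_subset[OF True] this] obtain C where
          "norm (F - fval f \<mu> *\<^sub>C 1 - (R - \<rho> *\<^sub>C 1) * C) < cmod (fval f \<mu> - a)"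
          "\<And>Y. Y * R = R * Y \<Longrightarrow> Y * C = C * Y" unfolding \<mu>(2) by blast
        from approx[OF b this XR] show ?thesis .
      next
        case False
        from resolvent_imp_inverse[OF \<mu>(1) this] obtain V where
          V: "V * (R - \<rho> *\<^sub>C 1) = 1" "(R - \<rho> *\<^sub>C 1) * V = 1" unfolding \<mu>(2) by blast
        have VR: "V * R = R * V" using commutes_inverse[OF V(2,1), of R] XR[of \<rho>] by simp
        have "V \<in> ?\<A>" using VR G_comm[OF VR] by simp
        moreover have "0 \<in> ?\<A>" by simp
        moreover have "norm (1 - 0 * G - V * (R - \<rho> *\<^sub>C 1)) < 1" by (simp add: V)
        ultimately show ?thesis by blast
      qed
    qed
  qed
  then show ?thesis unfolding spec_F G_def by blast
qed

end

theorem theorem9p3: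
  fixes D :: "'a::complex_banach set" and A :: "'a \<Rightarrow> 'a" and f :: "complex \<Rightarrow> complex"
  assumes "sect_op D A" and "f \<in> Dinf"
  shows "(\<forall>x \<mu>. x \<in> D \<and> A x = \<mu> *\<^sub>C x \<longrightarrow> fD f D A x = fval f \<mu> *\<^sub>C x)
    \<and> (\<forall>\<phi> \<mu>. adj_dom D A \<phi> \<and> adj D A \<phi> = (\<lambda>x. \<mu> * \<phi> x) \<longrightarrow>
           adj UNIV (fD f D A) \<phi> = (\<lambda>x. fval f \<mu> * \<phi> x))
    \<and> (\<forall>xs :: nat \<Rightarrow> 'a. \<forall>\<mu>. (\<forall>n. xs n \<in> D \<and> norm (xs n) = 1) \<and>
           (\<lambda>n. norm (A (xs n) - \<mu> *\<^sub>C xs n)) \<longlonglongrightarrow> 0 \<longrightarrow>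
           (\<lambda>n. norm (fD f D A (xs n) - fval f \<mu> *\<^sub>C xs n)) \<longlonglongrightarrow> 0)
    \<and> spec UNIV (fD f D A) \<union> {f_infty f} = fval f ` spec D A \<union> {f_infty f}"
proof -
  \<comment> \<open>The same least index as in \<open>fD\<close>, so that \<open>F_app\<close>
    matches it literally.\<close>
  define n where "n = (LEAST n::nat. f \<in> Dclass (real n))"
  have "f \<in> Dclass (real n)" unfolding n_def using Dinf_imp_nat[OF assms(2)] by (rule LeastI_ex)
  then interpret D_calculus D A f n using assms(1) by unfold_locales
  have fD: "fD f D A = cop_app F" by (rule ext) (simp only: fD_def F_app n_def[symmetric] Let_def)
  show ?thesis unfolding fD
  proof (intro conjI allI impI)
    show "cop_app F x = fval f \<mu> *\<^sub>C x" if "x \<in> D \<and> A x = \<mu> *\<^sub>C x" for x \<mu>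
      using that eigenvector by blast
    show "(\<lambda>k. norm (cop_app F (xs k) - fval f \<mu> *\<^sub>C xs k)) \<longlonglongrightarrow> 0"
      if "(\<forall>n. xs n \<in> D \<and> norm (xs n) = 1) \<and> (\<lambda>n. norm (A (xs n) - \<mu> *\<^sub>C xs n)) \<longlonglongrightarrow> 0" for xs \<mu>
      using that by (intro approx_eigenvector) auto
    show "spec UNIV (cop_app F) \<union> {f_infty f} = fval f ` spec D A \<union> {f_infty f}"
      using fval_in_spec spec_subset_image by blast
  next
    fix \<phi> \<mu> assume hyp: "adj_dom D A \<phi> \<and> adj D A \<phi> = (\<lambda>x. \<mu> * \<phi> x)"
    then have \<phi>: "cfunctional \<phi>" and ex: "\<exists>\<psi>. cfunctional \<psi> \<and> (\<forall>x\<in>D. \<phi> (A x) = \<psi> x)" by (auto simp: adj_dom_def)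
    \<comment> \<open>\<open>adj\<close> is a choice, but \<open>adj_dom\<close> guarantees that the
      chosen functional agrees with \<phi> after A on D.\<close>
    have "\<phi> (A x) = \<mu> * \<phi> x" if "x \<in> D" for x
      using someI_ex[OF ex] hyp that by (auto simp: adj_def)
    then have F: "\<phi> (cop_app F x) = fval f \<mu> * \<phi> x" for x by (rule adjoint_eigenvector[OF \<phi>])
    obtain K where K: "\<And>x. cmod (\<phi> x) \<le> K * norm x" using \<phi> by (auto simp: cfunctional_def)
    have "cfunctional (\<lambda>x. fval f \<mu> * \<phi> x)" unfolding cfunctional_def
    proof (intro conjI exI allI)
      show "cmod (fval f \<mu> * \<phi> x) \<le> (cmod (fval f \<mu>) * K) * norm x" for x
        unfolding norm_mult mult.assoc by (intro mult_left_mono K) simp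
    qed (use \<phi> in \<open>auto simp: cfunctional_def algebra_simps\<close>)
    \<comment> \<open>On the full space the functional is determined at every vector, so the choice
      in \<open>adj\<close> is forced.\<close>
    then show "adj UNIV (cop_app F) \<phi> = (\<lambda>x. fval f \<mu> * \<phi> x)" unfolding adj_def
      by (intro some_equality) (auto simp: F)
  qed
qed

end
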